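(* Let $S,\Sigma$ be real symmetric positive definite $n\times n$ matrices, let $A$ be a real $n\times n$ matrix all of whose eigenvalues have positive real part with $AS+SA'=\Sigma$, and let the data be generated by the stationary Ornstein--Uhlenbeck system $dx_t=-Ax_t\,dt+\Sigma^{1/2}dW_t$ in $\mathbb{R}^n$. Put $C(h)=\mathbb{E}[x_{t+h}x_t']$, $Q=AS-\tfrac12\Sigma$, and, for a sampling interval $\Delta>0$, $Q_\Delta=\tfrac12\bigl(C(\Delta)-C(\Delta)'\bigr)$. Call the following condition the sampling bound: $\max_j|\operatorname{Im}\lambda_j(A)|<\pi/\Delta$, where $\lambda_j(A)$ are the eigenvalues of $A$. (i) (Contemporaneous covariance identifies no direction.) The pair $(S,\Sigma)$ identifies only the gradient part $A_0=\tfrac12\Sigma S^{-1}$. The identified set for the drift is the affine space $$\mathcal{A}(S,\Sigma)=\Bigl\{\bigl(\tfrac12\Sigma+Q\bigr)S^{-1}:\ Q'=-Q\Bigr\},$$ of dimension $n(n-1)/2$; every member is automatically stable, and every member has the same stationary law $N(0,S)$. Consequently every functional of the contemporaneous law, including the correlation matrix, any distance transform of it, any graph built from such distances, any undirected centrality, and the principal components, is constant on $\mathcal{A}(S,\Sigma)$ and carries no information about $Q$. (ii) (The lag restores identification.) Under the sampling bound, $(S,C(\Delta))$ point-identifies $A$, and hence $Q$, through $A=-\Delta^{-1}\log\bigl(C(\Delta)S^{-1}\bigr)$ with the principal logarithm, and the discrete circulation $Q_\Delta$ vanishes if and only if $Q$ vanishes. (iii) (Direction is time asymmetry.) The following are equivalent: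 (a) $Q=0$; (b) $C(h)=C(h)'$ for every real $h\ge0$; (c) the process is statistically time reversible, $\{x_t\}\overset{d}{=}\{x_{-t}\}$. Under the sampling bound these are further equivalent to (d) $Q_\Delta=0$ at the single sampled lag $\Delta$. Without the sampling bound, (d) is strictly weaker: a system rotating by exactly a full turn per sampling interval has $Q\neq0$ while every sampled lagged covariance $C(k\Delta)$, $k=0,1,2,\dots$, is symmetric.
   Context: A prime denotes transpose. $W_t$ is a standard $n$-dimensional Brownian motion. The stationary system is a centred stationary Gaussian process with stationary law $N(0,S)$, $C(h)=e^{-Ah}S$ for $h\ge0$ and $C(-h)=C(h)'$; the Lyapunov equation $AS+SA'=\Sigma$ makes $Q$ antisymmetric. A drift matrix is stable when all its eigenvalues have positive real part. The identified set given $(S,\Sigma)$ is the set of all stable real drift matrices $A$ with $AS+SA'=\Sigma$. The contemporaneous law is the law of the single-time vector $x_t$. The principal logarithm of a matrix with no eigenvalues on $(-\infty,0]$ is its unique logarithm whose eigenvalues all have imaginary part in $(-\pi,\pi)$. A system rotating by exactly a full turn per sampling interval is one with drift $A=cI+\omega J$, where $c>0$, $\omega\Delta=2\pi$, and $J$ is a rotation generator (a nonzero real antisymmetric matrix with $e^{2\pi J}=I$), so that $e^{-A\Delta}=e^{-c\Delta}I$. *)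

theory Defs
  imports "HOL-Probability.Probability"
begin

section \<open>Matrices\<close>

primrec matrix_pow :: "'a::semiring_1^'n^'n \<Rightarrow> nat \<Rightarrow> 'a^'n^'n" where
  "matrix_pow A 0 = mat 1"
| "matrix_pow A (Suc k) = A ** matrix_pow A k"

definition matrix_exp :: "'a::{real_normed_field, banach}^'n^'n \<Rightarrow> 'a^'n^'n" where
  "matrix_exp A = (\<Sum>k. (1 / fact k) *\<^sub>R matrix_pow A k)"

definition eigenvalues :: "complex^'n^'n \<Rightarrow> complex set" where
  "eigenvalues M = {l. \<exists>v. v \<noteq> 0 \<and> M *v v = l *s v}"

definition cmatrix :: "real^'n^'n \<Rightarrow> complex^'n^'n" where
  "cmatrix A = map_matrix complex_of_real A"

text \<open>Meaningful when \<open>M\<close> has no eigenvalue on the closed negative real axis.\<close>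
definition principal_log :: "complex^'n^'n \<Rightarrow> complex^'n^'n" where
  "principal_log M =
     (THE L. matrix_exp L = M \<and> (\<forall>l\<in>eigenvalues L. - pi < Im l \<and> Im l < pi))"

definition symmetric_posdef :: "real^'n^'n \<Rightarrow> bool" where
  "symmetric_posdef S \<longleftrightarrow> transpose S = S \<and> (\<forall>v. v \<noteq> 0 \<longrightarrow> 0 < v \<bullet> (S *v v))"

definition antisymmetric :: "real^'n^'n \<Rightarrow> bool" where
  "antisymmetric Q \<longleftrightarrow> transpose Q = - Q"

definition stable_drift :: "real^'n^'n \<Rightarrow> bool" where
  "stable_drift A \<longleftrightarrow> (\<forall>l\<in>eigenvalues (cmatrix A). 0 < Re l)"

definition sampling_bound :: "real^'n^'n \<Rightarrow> real \<Rightarrow> bool" where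
  "sampling_bound A \<Delta> \<longleftrightarrow> (\<forall>l\<in>eigenvalues (cmatrix A). \<bar>Im l\<bar> < pi / \<Delta>)"

definition lyapunov :: "real^'n^'n \<Rightarrow> real^'n^'n \<Rightarrow> real^'n^'n \<Rightarrow> bool" where
  "lyapunov A S \<Sigma> \<longleftrightarrow> A ** S + S ** transpose A = \<Sigma>"

definition identified_set :: "real^'n^'n \<Rightarrow> real^'n^'n \<Rightarrow> (real^'n^'n) set" where
  "identified_set S \<Sigma> = {B. stable_drift B \<and> lyapunov B S \<Sigma>}"

definition gradient_part :: "real^'n^'n \<Rightarrow> real^'n^'n \<Rightarrow> real^'n^'n" where
  "gradient_part S \<Sigma> = (1/2) *\<^sub>R (\<Sigma> ** matrix_inv S)"

definition circulation :: "real^'n^'n \<Rightarrow> real^'n^'n \<Rightarrow> real^'n^'n \<Rightarrow> real^'n^'n" where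
  "circulation A S \<Sigma> = A ** S - (1/2) *\<^sub>R \<Sigma>"

definition drift_family :: "real^'n^'n \<Rightarrow> real^'n^'n \<Rightarrow> (real^'n^'n) set" where
  "drift_family S \<Sigma> = {((1/2) *\<^sub>R \<Sigma> + Q) ** matrix_inv S | Q. antisymmetric Q}"

definition rotation_generator :: "real^'n^'n \<Rightarrow> bool" where
  "rotation_generator J \<longleftrightarrow> J \<noteq> 0 \<and> antisymmetric J \<and> matrix_exp ((2 * pi) *\<^sub>R J) = mat 1"

definition full_turn_drift :: "real^'n^'n \<Rightarrow> real \<Rightarrow> bool" where
  "full_turn_drift A \<Delta> \<longleftrightarrow> (\<exists>c \<omega> J. 0 < c \<and> \<omega> * \<Delta> = 2 * pi \<and> rotation_generator J \<and>
     A = c *\<^sub>R mat 1 + \<omega> *\<^sub>R J)"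

text \<open>The autocovariance \<open>C(h)\<close> implied by the parameters \<open>A\<close> and \<open>S\<close>.\<close>
definition ou_autocov :: "real^'n^'n \<Rightarrow> real^'n^'n \<Rightarrow> real \<Rightarrow> real^'n^'n" where
  "ou_autocov A S h =
     (if 0 \<le> h then matrix_exp ((- h) *\<^sub>R A) ** S
      else transpose (matrix_exp (h *\<^sub>R A) ** S))"


section \<open>Gaussian laws and processes\<close>

text \<open>The normal law on the line with mean 0 and variance \<open>v\<close>; degenerate for \<open>v = 0\<close>.\<close>
definition centred_normal :: "real \<Rightarrow> real measure" where
  "centred_normal v =
     (if v = 0 then return borel 0 else density lborel (\<lambda>x. ennreal (normal_density 0 (sqrt v) x)))"

text \<open>\<open>\<mu>\<close> is the law \<open>N(0,V)\<close>: every linear functional is normal with the right variance.\<close>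
definition is_normal_law :: "(real^'n) measure \<Rightarrow> real^'n^'n \<Rightarrow> bool" where
  "is_normal_law \<mu> V \<longleftrightarrow> sets \<mu> = sets borel \<and>
     (\<forall>u. distr \<mu> borel (\<lambda>z. u \<bullet> z) = centred_normal (u \<bullet> (V *v u)))"

definition centred_gaussian_process :: "'a measure \<Rightarrow> (real \<Rightarrow> 'a \<Rightarrow> real^'n) \<Rightarrow> bool" where
  "centred_gaussian_process M x \<longleftrightarrow>
     (\<forall>t. x t \<in> borel_measurable M) \<and>
     (\<forall>I u. finite I \<longrightarrow>
        (\<exists>v\<ge>0. distr M borel (\<lambda>\<omega>. \<Sum>t\<in>I. u t \<bullet> x t \<omega>) = centred_normal v))"

text \<open>The law of a process indexed by the whole line, on the product \<open>\<sigma>\<close>-algebra.\<close>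
definition process_law :: "'a measure \<Rightarrow> (real \<Rightarrow> 'a \<Rightarrow> real^'n) \<Rightarrow> (real \<Rightarrow> real^'n) measure" where
  "process_law M x = distr M (\<Pi>\<^sub>M t\<in>UNIV. borel) (\<lambda>\<omega> t. x t \<omega>)"

definition stationary_process :: "'a measure \<Rightarrow> (real \<Rightarrow> 'a \<Rightarrow> real^'n) \<Rightarrow> bool" where
  "stationary_process M x \<longleftrightarrow> (\<forall>h. process_law M (\<lambda>t. x (t + h)) = process_law M x)"

definition time_reversible :: "'a measure \<Rightarrow> (real \<Rightarrow> 'a \<Rightarrow> real^'n) \<Rightarrow> bool" where
  "time_reversible M x \<longleftrightarrow> process_law M x = process_law M (\<lambda>t. x (- t))"

text \<open>\<open>E[X Y']\<close>\<close>
definition cross_moment :: "'a measure \<Rightarrow> ('a \<Rightarrow> real^'n) \<Rightarrow> ('a \<Rightarrow> real^'n) \<Rightarrow> real^'n^'n" where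
  "cross_moment M X Y = (\<chi> i j. \<integral>\<omega>. X \<omega> $ i * Y \<omega> $ j \<partial>M)"


section \<open>The Ornstein--Uhlenbeck system\<close>

text \<open>A standard Brownian motion on the whole time line relative to the filtration \<open>F\<close>.
  Since time is two-sided and \<open>W 0 = 0\<close>, it is the past increments, and not \<open>W t\<close> itself, that
  are known at time \<open>t\<close>.\<close>
definition brownian_motion ::
  "'a measure \<Rightarrow> (real \<Rightarrow> 'a measure) \<Rightarrow> (real \<Rightarrow> 'a \<Rightarrow> real^'n) \<Rightarrow> bool" where
  "brownian_motion M F W \<longleftrightarrow>
     prob_space M \<and> filtration (space M) F \<and> (\<forall>t. subalgebra M (F t)) \<and>
     (\<forall>t. W t \<in> borel_measurable M) \<and>
     (\<forall>s t. s \<le> t \<longrightarrow>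
        (\<lambda>\<omega>. W t \<omega> - W s \<omega>) \<in> borel_measurable (F t) \<and>
        prob_space.indep_set M (sets (F s))
          (sets (vimage_algebra (space M) (\<lambda>\<omega>. W t \<omega> - W s \<omega>) borel)) \<and>
        is_normal_law (distr M borel (\<lambda>\<omega>. W t \<omega> - W s \<omega>)) ((t - s) *\<^sub>R mat 1)) \<and>
     (AE \<omega> in M. W 0 \<omega> = 0 \<and> continuous_on UNIV (\<lambda>t. W t \<omega>))"

text \<open>\<open>x\<close> is a stationary, centred Gaussian (weak) solution of
  \<open>dx\<^sub>t = - A x\<^sub>t dt + \<Sigma>\<^sup>1\<^sup>/\<^sup>2 dW\<^sub>t\<close>, with \<open>R\<close> the symmetric
  positive definite square root of \<open>\<Sigma>\<close>. The noise is additive, so the stochastic integral of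
  the constant \<open>R\<close> is \<open>R (W t - W s)\<close>. Neither the stationary covariance nor the
  autocovariance of \<open>x\<close> is prescribed.\<close>
definition stationary_ou ::
  "'a measure \<Rightarrow> real^'n^'n \<Rightarrow> real^'n^'n \<Rightarrow> (real \<Rightarrow> 'a \<Rightarrow> real^'n) \<Rightarrow> bool" where
  "stationary_ou M A \<Sigma> x \<longleftrightarrow>
     prob_space M \<and> centred_gaussian_process M x \<and> stationary_process M x \<and>
     (\<exists>F W R. brownian_motion M F W \<and> symmetric_posdef R \<and> R ** R = \<Sigma> \<and>
        (\<forall>t. x t \<in> borel_measurable (F t)) \<and>
        (AE \<omega> in M. continuous_on UNIV (\<lambda>t. x t \<omega>) \<and>
           (\<forall>s t. s \<le> t \<longrightarrow>
              x t \<omega> - x s \<omega> =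
                - integral {s..t} (\<lambda>r. A *v x r \<omega>) + R *v (W t \<omega> - W s \<omega>))))"

definition ou_innovation_cov :: "real^'n^'n \<Rightarrow> real^'n^'n \<Rightarrow> real \<Rightarrow> real^'n^'n" where
  "ou_innovation_cov B \<Sigma> h =
     integral {0..h} (\<lambda>s. matrix_exp ((- s) *\<^sub>R B) ** \<Sigma> ** transpose (matrix_exp ((- s) *\<^sub>R B)))"

text \<open>\<open>\<mu>\<close> is invariant under the transition semigroup
  \<open>x\<^sub>t\<^sub>+\<^sub>h = e\<^sup>-\<^sup>B\<^sup>h x\<^sub>t + z\<close>, where the innovation
  \<open>z\<close>, with law \<open>\<nu>\<close>, is independent of \<open>x\<^sub>t\<close>.\<close>
definition ou_stationary_law :: "real^'n^'n \<Rightarrow> real^'n^'n \<Rightarrow> (real^'n) measure \<Rightarrow> bool" where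
  "ou_stationary_law B \<Sigma> \<mu> \<longleftrightarrow> prob_space \<mu> \<and> sets \<mu> = sets borel \<and>
     (\<forall>h\<ge>0. \<exists>\<nu>. is_normal_law \<nu> (ou_innovation_cov B \<Sigma> h) \<and>
        distr (\<mu> \<Otimes>\<^sub>M \<nu>) borel (\<lambda>(y, z). matrix_exp ((- h) *\<^sub>R B) *v y + z) = \<mu>)"


section \<open>Functionals of the contemporaneous law\<close>

definition covariance_matrix :: "(real^'n) measure \<Rightarrow> real^'n^'n" where
  "covariance_matrix \<mu> =
     (\<chi> i j. (\<integral>z. z $ i * z $ j \<partial>\<mu>) - (\<integral>z. z $ i \<partial>\<mu>) * (\<integral>z. z $ j \<partial>\<mu>))"

definition correlation_matrix :: "(real^'n) measure \<Rightarrow> real^'n^'n" where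
  "correlation_matrix \<mu> = (let K = covariance_matrix \<mu> in
     (\<chi> i j. K $ i $ j / sqrt (K $ i $ i * K $ j $ j)))"

text \<open>Pairs of a component variance and a unit loading vector.\<close>
definition principal_components :: "(real^'n) measure \<Rightarrow> (real \<times> (real^'n)) set" where
  "principal_components \<mu> = {(l, v). norm v = 1 \<and> covariance_matrix \<mu> *v v = l *\<^sub>R v}"

end

theory Submission
  imports Defs "HOL-Computational_Algebra.Fundamental_Theorem_Algebra"
begin

text \<open>The Lyapunov equation \<open>A S + S A' = \<Sigma>\<close> says that \<open>A S - \<Sigma>/2\<close> is antisymmetric, and for an
  eigenvector \<open>S u\<close> of \<open>A\<close> it gives \<open>Re \<lambda> (u, S u) = (u, \<Sigma> u)/2 > 0\<close>, so every solution is stable.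
  Pairing the integrated equation with \<open>x\<^sub>0\<close> and using that the increments of \<open>W\<close> are uncorrelated
  with \<open>x\<^sub>0\<close> yields \<open>C' = - A C\<close>, hence \<open>C h = e\<^sup>-\<^sup>A\<^sup>h V\<close>; comparing second moments to
  first order in time shows that \<open>V\<close> solves the Lyapunov equation, which has only one symmetric
  solution, so \<open>V = S\<close>. Laws of Gaussian vectors and processes are identified through their linear
  functionals, so invariance and reversibility become identities between covariances.

  A logarithm with spectrum in the strip \<open>\<bar>Im\<bar> < \<pi>\<close> is unique. Symmetry of \<open>e\<^sup>-\<^sup>A\<^sup>\<Delta> S\<close> says that
  \<open>A\<close> and \<open>S A' S\<^sup>-\<^sup>1\<close>, which have the same spectrum, have the same exponential; under the sampling
  bound they are therefore equal, which is \<open>A S = S A'\<close>, that is, \<open>Q = 0\<close>.\<close>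

section \<open>Matrix algebra and analysis\<close>

text \<open>Two obstacles shape the development. First, \<open>stationary_ou\<close> prescribes only
  the path equation, so neither the stationary covariance nor \<open>C\<close> may be assumed; both
  are extracted from second moments, and of the noise only the mean, variance and independence of
  increments enter. Paths are continuous only almost surely, so time integrals are taken along a
  version that vanishes on a null set.

  Second, the logarithm has to be unique also for matrices that are not diagonalizable. Jordan form
  is avoided: polynomials in \<open>Z \<mapsto> X Z - Z Y\<close> are applied to one matrix, and an
  annihilating polynomial of least degree yields eigenvectors by splitting off a root. The bound
  \<open>pi\<close> is the right one because two eigenvalues in the open strip differ by less than
  \<open>2 * pi\<close> in imaginary part.

  Laws are compared through characteristic functions in one real variable, one coordinate at a time.
  The given Brownian motion also supplies the standard normal law from which the innovation laws are
  built. The decay of the flow that makes the invariant law unique comes from the quadratic form of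
  \<open>S\<close>, not from eigenvalue estimates.\<close>

lemma norm_vec_le_sum:
  fixes x :: "'a::real_normed_vector^'n"
  shows "norm x \<le> (\<Sum>i\<in>UNIV. norm (x $ i))"
  by (simp add: norm_vec_def L2_set_le_sum)

lemma norm_entry_le: "norm (A $ i $ j) \<le> norm (A :: 'a::real_normed_vector^'n^'m)"
  using Finite_Cartesian_Product.norm_nth_le[of "A $ i" j] Finite_Cartesian_Product.norm_nth_le[of A i]
  by linarith

lemma matrix_mult_scaleR_left: "(c *\<^sub>R A) ** B = c *\<^sub>R (A ** B)"
  for A :: "'a::real_normed_field^'n^'m" and B :: "'a^'p^'n"
  by (simp add: matrix_matrix_mult_def vec_eq_iff scaleR_sum_right)

lemma matrix_mult_scaleR_right: "A ** (c *\<^sub>R B) = c *\<^sub>R (A ** B)"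
  for A :: "'a::real_normed_field^'n^'m" and B :: "'a^'p^'n"
  by (simp add: matrix_matrix_mult_def vec_eq_iff scaleR_sum_right)

text \<open>The norm is Euclidean in the entries. The crude constant counts the entries of the
  product, each a sum over \<open>'n\<close> of terms bounded by \<open>norm a * norm b\<close>; any
  finite constant will do, since the aim is to inherit product rules and limits.\<close>

lemma bounded_bilinear_matrix_mult:
  "bounded_bilinear ((**) :: 'a::real_normed_field^'n^'m \<Rightarrow> 'a^'p^'n \<Rightarrow> 'a^'p^'m)"
proof
  show "\<exists>K. \<forall>a b. norm ((a :: 'a^'n^'m) ** (b :: 'a^'p^'n)) \<le> norm a * norm b * K"
  proof (intro exI allI)
    fix a :: "'a^'n^'m" and b :: "'a^'p^'n"
    have "norm (a ** b) \<le> (\<Sum>i\<in>UNIV. norm ((a ** b) $ i))"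
      by (rule norm_vec_le_sum)
    also have "\<dots> \<le> (\<Sum>i\<in>UNIV. \<Sum>j\<in>UNIV. norm ((a ** b) $ i $ j))"
      by (intro sum_mono norm_vec_le_sum)
    also have "\<dots> \<le> (\<Sum>i\<in>(UNIV::'m set). \<Sum>j\<in>(UNIV::'p set). \<Sum>k\<in>(UNIV::'n set). norm a * norm b)"
    proof (intro sum_mono)
      fix i j
      show "norm ((a ** b) $ i $ j) \<le> (\<Sum>k\<in>(UNIV::'n set). norm a * norm b)"
        unfolding matrix_matrix_mult_def by (simp only: vec_lambda_beta, intro sum_norm_le)
          (simp add: norm_mult mult_mono norm_entry_le)
    qed
    also have "\<dots> = norm a * norm b * (real CARD('m) * real CARD('p) * real CARD('n))"
      by simp
    finally show "norm (a ** b) \<le> norm a * norm b * (real CARD('m) * real CARD('p) * real CARD('n))" .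
  qed
  show "(a + a') ** b = a ** b + a' ** b" for a a' :: "'a^'n^'m" and b :: "'a^'p^'n"
    by (simp add: matrix_matrix_mult_def vec_eq_iff algebra_simps sum.distrib)
qed (simp_all add: matrix_add_ldistrib matrix_mult_scaleR_left matrix_mult_scaleR_right)

interpretation matrix_mult:
  bounded_bilinear "(**) :: 'a::real_normed_field^'n^'m \<Rightarrow> 'a^'p^'n \<Rightarrow> 'a^'p^'m"
  by (rule bounded_bilinear_matrix_mult)

lemma bounded_linear_entry: "bounded_linear (\<lambda>A :: 'a::real_normed_vector^'n^'m. A $ i $ j)"
  by (rule bounded_linear_compose[OF bounded_linear_vec_nth bounded_linear_vec_nth])

lemma bounded_linear_vecI:
  fixes f :: "'a::real_normed_vector \<Rightarrow> 'b::real_normed_vector^'n"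
  assumes "\<And>i. bounded_linear (\<lambda>x. f x $ i)"
  shows "bounded_linear f"
proof -
  have "linear f"
  proof (rule linearI)
    show "f (x + y) = f x + f y" for x y
      using linear_add[OF bounded_linear.linear[OF assms]] by (simp add: vec_eq_iff)
    show "f (c *\<^sub>R x) = c *\<^sub>R f x" for c x
      using linear_scale[OF bounded_linear.linear[OF assms]] by (simp add: vec_eq_iff)
  qed
  moreover have "\<exists>K. \<forall>x. norm (f x) \<le> norm x * K"
  proof -
    obtain K where K: "\<And>i x. norm (f x $ i) \<le> norm x * K i"
      using bounded_linear.bounded[OF assms] by metis
    have "norm (f x) \<le> norm x * (\<Sum>i\<in>UNIV. K i)" for x
      using norm_vec_le_sum[of "f x"] sum_mono[of UNIV "\<lambda>i. norm (f x $ i)" "\<lambda>i. norm x * K i"] K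
      by (fastforce simp: sum_distrib_left)
    then show ?thesis by blast
  qed
  ultimately show ?thesis
    by (simp add: bounded_linear_def bounded_linear_axioms_def linear_linear)
qed

lemma has_vector_derivative_vecI:
  assumes "\<And>i. ((\<lambda>t. f t $ i) has_vector_derivative f' $ i) (at t within T)"
  shows "(f has_vector_derivative f') (at t within T)"
  using assms unfolding has_vector_derivative_def has_derivative_at_within
  by (auto intro!: vec_tendstoI bounded_linear_scaleR_left)

section \<open>The matrix exponential\<close>

lemma matrix_pow_scaleR:
  "matrix_pow (t *\<^sub>R A) k = t ^ k *\<^sub>R matrix_pow (A :: 'a::{real_normed_field,banach}^'n^'n) k"
  by (induction k) (simp_all add: matrix_mult_scaleR_left matrix_mult_scaleR_right)

text \<open>The bilinearity constant \<open>K\<close> is absorbed into the base: powers grow at most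
  like \<open>(norm A * K) ^ k\<close>, so a scalar exponential series dominates.\<close>

lemma summable_norm_matrix_exp:
  fixes A :: "'a::{real_normed_field,banach}^'n^'n"
  shows "summable (\<lambda>k. norm ((1 / fact k) *\<^sub>R matrix_pow A k))"
proof -
  obtain K where K: "0 < K" "\<And>(a :: 'a^'n^'n) (b :: 'a^'n^'n). norm (a ** b) \<le> norm a * norm b * K"
    using matrix_mult.pos_bounded by blast
  have pow: "norm (matrix_pow A k) \<le> norm (mat 1 :: 'a^'n^'n) * (norm A * K) ^ k" for k
  proof (induction k)
    case (Suc k)
    have "norm (matrix_pow A (Suc k)) \<le> norm A * norm (matrix_pow A k) * K"
      using K by simp
    also have "\<dots> \<le> norm A * (norm (mat 1 :: 'a^'n^'n) * (norm A * K) ^ k) * K"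
      using Suc K by (intro mult_right_mono mult_left_mono) auto
    finally show ?case by (simp add: mult_ac)
  qed simp
  show ?thesis
  proof (rule summable_comparison_test')
    show "summable (\<lambda>k. norm (mat 1 :: 'a^'n^'n) * (inverse (fact k) * (norm A * K) ^ k))"
      by (intro summable_mult summable_exp)
    show "norm (norm ((1 / fact k) *\<^sub>R matrix_pow A k))
        \<le> norm (mat 1 :: 'a^'n^'n) * (inverse (fact k) * (norm A * K) ^ k)" for k
      using mult_left_mono[OF pow[of k], of "inverse (fact k)"]
      by (simp add: divide_inverse_commute mult_ac)
  qed
qed

lemma summable_matrix_exp:
  fixes A :: "'a::{real_normed_field,banach}^'n^'n"
  shows "summable (\<lambda>k. (1 / fact k) *\<^sub>R matrix_pow A k)"
  by (rule summable_norm_cancel[OF summable_norm_matrix_exp])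

text \<open>Transposition, complexification, entries and one-sided products are moved inside the
  exponential through this, so that they only have to be checked on powers.\<close>

lemma matrix_exp_linear_image:
  fixes A :: "'a::{real_normed_field,banach}^'n^'n"
  assumes "bounded_linear f"
  shows "f (matrix_exp A) = (\<Sum>k. (1 / fact k) *\<^sub>R f (matrix_pow A k))"
  using bounded_linear.suminf[OF assms summable_matrix_exp[of A]]
  by (simp add: matrix_exp_def linear_scale[OF bounded_linear.linear[OF assms]])

text \<open>Since \<open>P\<close> may be rectangular and singular, this one rule covers
  commutation, similarity and eigenvectors (take one of the matrices to be
  \<open>mat r\<close>).\<close>

lemma matrix_exp_intertwine:
  fixes A :: "'a::{real_normed_field,banach}^'n^'n" and B :: "'a^'m^'m"
  assumes "P ** A = B ** P"
  shows "P ** matrix_exp A = matrix_exp B ** P"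
proof -
  have "P ** matrix_pow A k = matrix_pow B k ** P" for k
    by (induction k) (simp_all add: matrix_mul_assoc assms, simp add: matrix_mul_assoc[symmetric])
  then show ?thesis
    by (simp add: matrix_exp_linear_image[OF matrix_mult.bounded_linear_right]
        matrix_exp_linear_image[OF matrix_mult.bounded_linear_left])
qed

lemma matrix_exp_commute: "A ** matrix_exp (t *\<^sub>R A) = matrix_exp (t *\<^sub>R A) ** A"
  for A :: "'a::{real_normed_field,banach}^'n^'n"
  by (rule matrix_exp_intertwine) (simp add: matrix_mult_scaleR_left matrix_mult_scaleR_right)

lemma bounded_linear_transpose:
  "bounded_linear (transpose :: 'a::real_normed_vector^'n^'m \<Rightarrow> 'a^'m^'n)"
  by (intro bounded_linear_vecI) (simp add: transpose_def bounded_linear_entry)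

lemma matrix_pow_Suc_right: "matrix_pow A (Suc k) = matrix_pow A k ** A"
proof (induction k)
  case (Suc k)
  show ?case
    by (subst matrix_pow.simps, subst Suc) (simp add: matrix_mul_assoc)
qed simp

lemma transpose_matrix_exp: "transpose (matrix_exp A) = matrix_exp (transpose A)"
  for A :: "'a::{real_normed_field,banach}^'n^'n"
proof -
  have "transpose (matrix_pow A k) = matrix_pow (transpose A) k" for k
  proof (induction k)
    case (Suc k)
    then show ?case
      by (subst matrix_pow_Suc_right) (simp add: matrix_transpose_mul)
  qed simp
  then show ?thesis
    by (simp add: matrix_exp_linear_image[OF bounded_linear_transpose])
       (simp add: matrix_exp_def)
qed

section \<open>Complexification of real matrices\<close>

lemma cmatrix_mult: "cmatrix (A ** B) = cmatrix A ** cmatrix B"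
  by (simp add: cmatrix_def matrix_matrix_mult_def map_matrix_def vec_eq_iff)

lemma cmatrix_mat_1 [simp]: "cmatrix (mat 1) = mat 1"
  by (simp add: cmatrix_def mat_def map_matrix_def vec_eq_iff)

lemma cmatrix_nth [simp]: "cmatrix A $ i $ j = complex_of_real (A $ i $ j)"
  by (simp add: cmatrix_def)

lemma cmatrix_eq_iff [simp]: "cmatrix A = cmatrix B \<longleftrightarrow> A = B"
  by (simp add: vec_eq_iff)

lemma cmatrix_scaleR: "cmatrix (c *\<^sub>R A) = c *\<^sub>R cmatrix A"
  by (simp add: vec_eq_iff) (simp add: scaleR_conv_of_real)

lemma bounded_linear_cmatrix: "bounded_linear cmatrix"
  by (intro bounded_linear_vecI)
    (auto intro: bounded_linear_compose[OF bounded_linear_of_real bounded_linear_entry])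

lemma cmatrix_matrix_exp: "cmatrix (matrix_exp A) = matrix_exp (cmatrix A)"
proof -
  have "cmatrix (matrix_pow A k) = matrix_pow (cmatrix A) k" for k
    by (induction k) (simp_all add: cmatrix_mult)
  then show ?thesis
    by (simp add: matrix_exp_linear_image[OF bounded_linear_cmatrix])
       (simp add: matrix_exp_def)
qed

text \<open>Each entry is an everywhere convergent power series over the scalar field, restricted to
  real arguments. Termwise differentiation applies to it, and \<open>diffs\<close> of its
  coefficients are the coefficients of the same entry of
  \<open>A ** matrix_exp (t *\<^sub>R A)\<close>.\<close>

lemma matrix_exp_has_vector_derivative:
  fixes A :: "'a::{real_normed_field,banach}^'n^'n"
  shows "((\<lambda>t. matrix_exp (t *\<^sub>R A)) has_vector_derivative A ** matrix_exp (t *\<^sub>R A)) (at t within T)"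
proof (intro has_vector_derivative_vecI)
  fix i j
  define c where "c k = (1 / fact k) *\<^sub>R matrix_pow A k $ i $ j" for k
  have entry: "matrix_exp (s *\<^sub>R A) $ i $ j = (\<Sum>k. c k * of_real s ^ k)" for s
    by (simp add: matrix_exp_linear_image[OF bounded_linear_entry] matrix_pow_scaleR c_def
        scaleR_conv_of_real[where 'a = 'a] mult_ac of_real_power)
  \<comment> \<open>The radius of convergence is infinite: each term is bounded by the norm of the
    corresponding term of the exponential series of \<open>norm z *\<^sub>R A\<close>.\<close>
  have summable: "summable (\<lambda>k. c k * z ^ k)" for z
  proof (rule summable_norm_cancel, rule summable_comparison_test')
    show "summable (\<lambda>k. norm ((1 / fact k) *\<^sub>R matrix_pow (norm z *\<^sub>R A) k))"
      by (rule summable_norm_matrix_exp)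
    show "norm (norm (c k * z ^ k)) \<le> norm ((1 / fact k) *\<^sub>R matrix_pow (norm z *\<^sub>R A) k)" for k
      using mult_right_mono[OF norm_entry_le[of "matrix_pow A k" i j], of "norm z ^ k / fact k"]
      by (simp add: c_def matrix_pow_scaleR norm_mult norm_power mult_ac)
  qed
  have diffs: "diffs c k = ((1 / fact k) *\<^sub>R (A ** matrix_pow A k)) $ i $ j" for k
    by (simp add: diffs_def c_def scaleR_conv_of_real[where 'a = 'a] field_simps del: of_nat_Suc)
  have "(A ** matrix_exp (t *\<^sub>R A)) $ i $ j = (\<Sum>k. diffs c k * of_real t ^ k)"
    by (simp add: matrix_exp_linear_image[OF bounded_linear_compose[OF bounded_linear_entry
            matrix_mult.bounded_linear_right]] matrix_pow_scaleR diffs matrix_mult_scaleR_right)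
       (simp add: scaleR_conv_of_real[where 'a = 'a] mult_ac of_real_power)
  moreover have "((\<lambda>z. \<Sum>k. c k * z ^ k) has_field_derivative (\<Sum>k. diffs c k * of_real t ^ k))
      (at (of_real t))"
    by (rule termdiffs_strong_converges_everywhere[OF summable])
  ultimately have "((\<lambda>z. \<Sum>k. c k * z ^ k) has_derivative (*) ((A ** matrix_exp (t *\<^sub>R A)) $ i $ j))
      (at (of_real t))"
    by (simp add: has_field_derivative_def)
  from has_derivative_compose[OF has_derivative_of_real[OF has_derivative_ident] this]
  show "((\<lambda>t. matrix_exp (t *\<^sub>R A) $ i $ j) has_vector_derivative
      (A ** matrix_exp (t *\<^sub>R A)) $ i $ j) (at t within T)"
    by (simp add: has_vector_derivative_def entry scaleR_conv_of_real[where 'a = 'a] mult_ac)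
qed

lemma matrix_exp_0 [simp]: "matrix_exp (0 :: 'a::{real_normed_field,banach}^'n^'n) = mat 1"
proof -
  have "matrix_exp (0 :: 'a^'n^'n) = (\<Sum>k. if k = 0 then mat 1 else 0)"
    unfolding matrix_exp_def
    by (intro suminf_cong) (auto simp: gr0_conv_Suc)
  also have "\<dots> = mat 1"
    using sums_If_finite_set[of "{0::nat}" "\<lambda>_. mat 1 :: 'a^'n^'n"] by (simp add: sums_iff)
  finally show ?thesis .
qed

lemmas matrix_mult_has_vector_derivative =
  bounded_bilinear.has_vector_derivative[OF bounded_bilinear_matrix_mult]

abbreviation flow :: "'a::{real_normed_field,banach}^'n^'n \<Rightarrow> real \<Rightarrow> 'a^'n^'n" where
  "flow A t \<equiv> matrix_exp ((- t) *\<^sub>R A)"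

lemma matrix_exp_minus_has_vector_derivative:
  fixes A :: "'a::{real_normed_field,banach}^'n^'n"
  shows "((\<lambda>t. flow A t) has_vector_derivative - (A ** flow A t))
    (at t within T)"
  using matrix_exp_has_vector_derivative[of "- A" t T] by (simp add: matrix_mult.minus_left)

text \<open>The product has derivative zero because \<open>A\<close> commutes with its exponential.
  A convex \<open>T\<close> admits one-sided derivatives at end points, as needed for the
  autocovariance on \<open>{0..t}\<close>.\<close>

lemma matrix_ode_flow_inverse:
  fixes A :: "'a::{real_normed_field,banach}^'n^'n" and X :: "real \<Rightarrow> 'a^'m^'n"
  assumes "convex T" "0 \<in> T"
    and X: "\<And>t. t \<in> T \<Longrightarrow> (X has_vector_derivative A ** X t) (at t within T)" and t: "t \<in> T"
  shows "flow A t ** X t = X 0"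
proof -
  have "((\<lambda>t. flow A t ** X t) has_vector_derivative 0) (at t within T)"
    if "t \<in> T" for t
    using matrix_mult_has_vector_derivative[OF matrix_exp_minus_has_vector_derivative[of A] X[OF that]] matrix_exp_commute[of A "- t"]
    by (simp add: matrix_mult.minus_left matrix_mul_assoc)
  from has_vector_derivative_zero_constant[OF assms(1) this]
  obtain c where "\<And>s. s \<in> T \<Longrightarrow> flow A s ** X s = c" by blast
  from this[OF t] this[OF assms(2)] show ?thesis by simp
qed

lemma matrix_exp_minus_mult: "matrix_exp (- A) ** matrix_exp A = mat 1"
  for A :: "'a::{real_normed_field,banach}^'n^'n"
  using matrix_ode_flow_inverse[OF convex_UNIV UNIV_I matrix_exp_has_vector_derivative, of 1 A] by simp

lemma matrix_exp_mult_minus: "matrix_exp A ** matrix_exp (- A) = mat 1"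
  for A :: "'a::{real_normed_field,banach}^'n^'n"
  using matrix_exp_minus_mult[of "- A"] by simp

text \<open>Besides determining the autocovariance, this is how closed formulas for exponentials are
  proved below: exhibit a solution with the right initial value.\<close>

lemma matrix_ode_unique:
  fixes A :: "'a::{real_normed_field,banach}^'n^'n" and X :: "real \<Rightarrow> 'a^'m^'n"
  assumes "convex T" "0 \<in> T"
    and "\<And>t. t \<in> T \<Longrightarrow> (X has_vector_derivative A ** X t) (at t within T)" and "t \<in> T"
  shows "X t = matrix_exp (t *\<^sub>R A) ** X 0"
  using arg_cong[OF matrix_ode_flow_inverse[OF assms], of "\<lambda>Y. matrix_exp (t *\<^sub>R A) ** Y"]
    matrix_exp_mult_minus[of "t *\<^sub>R A"]
  by (simp add: matrix_mul_assoc)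

lemma matrix_exp_add_scaleR:
  fixes A :: "'a::{real_normed_field,banach}^'n^'n"
  shows "matrix_exp ((s + t) *\<^sub>R A) = matrix_exp (s *\<^sub>R A) ** matrix_exp (t *\<^sub>R A)"
proof -
  have "((\<lambda>s. matrix_exp ((s + t) *\<^sub>R A)) has_vector_derivative A ** matrix_exp ((s + t) *\<^sub>R A)) (at s)" for s
    using vector_diff_chain_at[of "\<lambda>s. s + t" 1 s "\<lambda>t. matrix_exp (t *\<^sub>R A)",
        OF _ matrix_exp_has_vector_derivative[of A "s + t" UNIV]]
    by (simp add: o_def has_vector_derivative_def has_derivative_add_const)

  from matrix_ode_unique[OF convex_UNIV UNIV_I this UNIV_I, of s] show ?thesis by simp
qed

lemma mat_eq_scale: "mat c ** A = A ** mat c" for A :: "'a::comm_semiring_1^'n^'n"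
  by (simp add: matrix_matrix_mult_def mat_def vec_eq_iff if_distrib if_distribR
      sum.delta sum.delta' mult.commute cong: if_cong)

lemma mat_mult_nth: "(mat c ** A) $ i $ j = c * A $ i $ j" for A :: "'a::comm_semiring_1^'n^'m"
  by (simp add: matrix_matrix_mult_def mat_def if_distrib if_distribR
      sum.delta sum.delta' cong: if_cong)

text \<open>Both sides solve \<open>X' = (A + mat c) ** X\<close>, since scalar matrices commute
  with everything. The shift turns an eigenvalue \<open>r\<close> of the Sylvester operator into a
  factor \<open>exp r\<close>.\<close>

lemma matrix_exp_add_mat:
  fixes A :: "'a::{real_normed_field,banach}^'n^'n"
  shows "matrix_exp (A + mat c) = mat (exp c) ** matrix_exp A"
proof -
  have "bounded_linear (mat :: 'a \<Rightarrow> 'a^'n^'n)"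
  proof (intro bounded_linear_vecI)
    show "bounded_linear (\<lambda>x::'a. mat x $ i $ j)" for i j :: 'n
      by (cases "i = j") (simp_all add: mat_def bounded_linear_ident bounded_linear_zero)
  qed
  moreover have "((\<lambda>t. exp (t *\<^sub>R c)) has_vector_derivative c * exp (t *\<^sub>R c)) (at t)" for t :: real
    using exp_scaleR_has_vector_derivative_right[of c t UNIV] by (simp add: mult.commute)
  ultimately have "((\<lambda>t. mat (exp (t *\<^sub>R c)) :: 'a^'n^'n) has_vector_derivative mat (c * exp (t *\<^sub>R c)))
      (at t)" for t :: real
    by (rule bounded_linear.has_vector_derivative)
  from matrix_mult_has_vector_derivative[OF this matrix_exp_has_vector_derivative]
  have "((\<lambda>t. mat (exp (t *\<^sub>R c)) ** matrix_exp (t *\<^sub>R A)) has_vector_derivative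
      (A + mat c) ** (mat (exp (t *\<^sub>R c)) ** matrix_exp (t *\<^sub>R A))) (at t)" for t
  proof (rule has_vector_derivative_eq_rhs)
    have "mat (exp (t *\<^sub>R c)) ** (A ** matrix_exp (t *\<^sub>R A))
        = A ** (mat (exp (t *\<^sub>R c)) ** matrix_exp (t *\<^sub>R A))"
      by (simp add: matrix_mul_assoc mat_eq_scale[of _ A])
    moreover have "mat (c * exp (t *\<^sub>R c)) ** matrix_exp (t *\<^sub>R A)
        = mat c ** (mat (exp (t *\<^sub>R c)) ** matrix_exp (t *\<^sub>R A))"
      by (simp add: vec_eq_iff mat_mult_nth mult.assoc)
    ultimately show "mat (exp (t *\<^sub>R c)) ** (A ** matrix_exp (t *\<^sub>R A))
        + mat (c * exp (t *\<^sub>R c)) ** matrix_exp (t *\<^sub>R A)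
        = (A + mat c) ** (mat (exp (t *\<^sub>R c)) ** matrix_exp (t *\<^sub>R A))"
      by (simp add: matrix_mult.add_left)
  qed
  from matrix_ode_unique[OF convex_UNIV UNIV_I this UNIV_I, of 1] show ?thesis
    by simp
qed

section \<open>Uniqueness of the principal logarithm\<close>

text \<open>The kernel consists of the matrices intertwining \<open>X\<close> and \<open>Y\<close>.
  With \<open>Y = 0\<close> the operator is left multiplication by \<open>X\<close>, so ordinary
  polynomials in a matrix fall under the same definitions.\<close>

definition sylvester :: "complex^'n^'n \<Rightarrow> complex^'n^'n \<Rightarrow> complex^'n^'n \<Rightarrow> complex^'n^'n" where
  "sylvester X Y Z = X ** Z - Z ** Y"

text \<open>This is \<open>p\<close> evaluated at the operator and applied to \<open>Z\<close>, by
  Horner's scheme. Complex coefficients act as scalar matrices \<open>mat a\<close>.\<close>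

definition sylvester_poly ::
  "complex^'n^'n \<Rightarrow> complex^'n^'n \<Rightarrow> complex poly \<Rightarrow> complex^'n^'n \<Rightarrow> complex^'n^'n" where
  "sylvester_poly X Y p Z = fold_coeffs (\<lambda>a W. mat a ** Z + sylvester X Y W) p 0"

lemma sylvester_0 [simp]: "sylvester X Y 0 = 0"
  by (simp add: sylvester_def matrix_mult.zero_left matrix_mult.zero_right)

lemma sylvester_add: "sylvester X Y (V + W) = sylvester X Y V + sylvester X Y W"
  by (simp add: sylvester_def matrix_mult.add_left matrix_mult.add_right)

lemma sylvester_mat: "sylvester X Y (mat c ** W) = mat c ** sylvester X Y W"
  by (simp add: sylvester_def matrix_mult.diff_right matrix_mul_assoc mat_eq_scale[of c X])

lemma mat_add: "mat (a + b) = mat a + mat b" for a b :: "'a::comm_monoid_add"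
  by (simp add: mat_def vec_eq_iff)

lemma mat_mult: "mat (a * b) = mat a ** mat b" for a b :: "'a::comm_semiring_1"
  by (simp add: vec_eq_iff mat_mult_nth) (simp add: mat_def)

lemma mat_eq_0_iff: "mat c ** W = 0 \<longleftrightarrow> c = 0 \<or> W = 0" for W :: "'a::field^'n^'m"
  by (auto simp: vec_eq_iff mat_mult_nth)

lemma sylvester_poly_0 [simp]: "sylvester_poly X Y 0 Z = 0"
  by (simp add: sylvester_poly_def)

lemma sylvester_poly_pCons [simp]:
  "sylvester_poly X Y (pCons a p) Z = mat a ** Z + sylvester X Y (sylvester_poly X Y p Z)"
  by (cases "p = 0 \<and> a = 0") (auto simp: sylvester_poly_def matrix_mult.zero_left)

lemma sylvester_poly_add:
  "sylvester_poly X Y (p + q) Z = sylvester_poly X Y p Z + sylvester_poly X Y q Z"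
  by (induction p q rule: poly_induct2)
     (simp_all add: mat_add matrix_mult.add_left sylvester_add algebra_simps)

lemma sylvester_poly_smult: "sylvester_poly X Y (smult c p) Z = mat c ** sylvester_poly X Y p Z"
  by (induction p)
     (simp_all add: mat_mult matrix_mult.add_right sylvester_mat matrix_mul_assoc matrix_mult.zero_right)

lemma sylvester_poly_sum:
  "sylvester_poly X Y (sum f I) Z = (\<Sum>i\<in>I. sylvester_poly X Y (f i) Z)"
  by (induction I rule: infinite_finite_induct) (simp_all add: sylvester_poly_add)

lemma sylvester_poly_monom: "sylvester_poly X Y (monom c k) Z = mat c ** (sylvester X Y ^^ k) Z"
proof (induction k)
  case (Suc k)
  then show ?case by (simp add: monom_Suc matrix_mult.zero_left sylvester_mat)
qed (simp add: monom_0)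

lemma sylvester_poly_linear_factor:
  fixes X Y Z :: "complex^'n^'n"
  shows "sylvester_poly X Y ([:- r, 1:] * q) Z
     = sylvester X Y (sylvester_poly X Y q Z) - mat r ** sylvester_poly X Y q Z"
proof -
  have "[:- r, 1:] * q = smult (- r) q + pCons 0 q" by simp
  moreover have "mat (- r) = - (mat r :: complex^'n^'n)"
    by (simp add: mat_def vec_eq_iff)
  ultimately show ?thesis
    by (simp only: sylvester_poly_add sylvester_poly_smult sylvester_poly_pCons)
       (simp add: matrix_mult.zero_left matrix_mult.minus_left)
qed

lemma sylvester_poly_invariant:
  assumes "0 \<in> V" "Z \<in> V" "\<And>W. W \<in> V \<Longrightarrow> sylvester X Y W \<in> V"
    and "\<And>W c. W \<in> V \<Longrightarrow> mat c ** W \<in> V" "\<And>W W'. W \<in> V \<Longrightarrow> W' \<in> V \<Longrightarrow> W + W' \<in> V"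
  shows "sylvester_poly X Y p Z \<in> V"
  by (induction p) (use assms in auto)

text \<open>A real linear dependence among the iterates is enough here, since a real polynomial is in
  particular a complex one.\<close>
lemma sylvester_annihilator:
  fixes X Y Z :: "complex^'n^'n"
  obtains p where "p \<noteq> 0" "sylvester_poly X Y p Z = 0"
proof -
  define N where "N = DIM(complex^'n^'n)"
  define f where "f k = (sylvester X Y ^^ k) Z" for k
  show thesis
  proof (cases "inj_on f {..N}")
    \<comment> \<open>Linear dependence speaks of the set of iterates and not of their exponents, so
      a repeated iterate is treated apart: the difference of two monomials annihilates
      \<open>Z\<close>.\<close>
    case False
    then obtain i j where ij: "i \<noteq> j" "f i = f j" by (auto simp: inj_on_def)
    have "monom 1 i + smult (- 1) (monom 1 j) \<noteq> (0 :: complex poly)"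
      using ij(1) by (metis coeff_add coeff_monom coeff_smult coeff_0 mult_zero_right add.right_neutral one_neq_zero)
    moreover have "mat (- 1) = - (mat 1 :: complex^'n^'n)" by (simp add: mat_def vec_eq_iff)
    then have "sylvester_poly X Y (monom 1 i + smult (- 1) (monom 1 j)) Z = 0"
      using ij(2) unfolding sylvester_poly_add sylvester_poly_smult sylvester_poly_monom
      by (simp add: f_def matrix_mult.minus_left)
    ultimately show thesis by (rule that)
  next
    case True
    then have "card (f ` {..N}) > DIM(complex^'n^'n)"
      by (simp add: card_image N_def)
    then have "dependent (f ` {..N})"
      using dependent_biggerset[of "f ` {..N}"] by blast
    then obtain u where u: "\<exists>v\<in>f ` {..N}. u v \<noteq> 0" "(\<Sum>v\<in>f ` {..N}. u v *\<^sub>R v) = 0"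
      by (auto simp: dependent_finite)
    define p where "p = (\<Sum>k\<le>N. monom (complex_of_real (u (f k))) k)"
    obtain k where "k \<le> N" "u (f k) \<noteq> 0" using u(1) by auto
    then have "coeff p k \<noteq> 0"
      by (simp add: p_def coeff_sum coeff_monom)
    then have "p \<noteq> 0" by auto
    moreover have "mat (complex_of_real c) ** W = c *\<^sub>R W" for c and W :: "complex^'n^'n"
      by (simp add: vec_eq_iff mat_mult_nth) (simp add: scaleR_conv_of_real)
    then have "sylvester_poly X Y p Z = (\<Sum>k\<le>N. u (f k) *\<^sub>R f k)"
      by (simp add: p_def sylvester_poly_sum sylvester_poly_monom f_def)
    then have "sylvester_poly X Y p Z = 0"
      using u(2) by (simp add: sum.reindex[OF True])
    ultimately show thesis by (rule that)
  qed
qed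

text \<open>Minimality is relative to the single vector \<open>Z\<close>. It ensures that the
  cofactor left after splitting off one linear factor does not annihilate \<open>Z\<close>.\<close>

lemma sylvester_minimal_polynomial:
  fixes X Y Z :: "complex^'n^'n"
  obtains p where "p \<noteq> 0" "sylvester_poly X Y p Z = 0"
    "\<And>q. q \<noteq> 0 \<Longrightarrow> degree q < degree p \<Longrightarrow> sylvester_poly X Y q Z \<noteq> 0"
proof -
  obtain p0 where "p0 \<noteq> 0 \<and> sylvester_poly X Y p0 Z = 0"
    using sylvester_annihilator by blast
  from ex_has_least_nat[of "\<lambda>p. p \<noteq> 0 \<and> sylvester_poly X Y p Z = 0", OF this, of degree]
  show thesis using that by (metis not_le)
qed

lemma degree_linear_factor: "q \<noteq> 0 \<Longrightarrow> degree q < degree ([:- r, 1:] * q)" for q :: "complex poly"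
  by (subst degree_mult_eq) auto

text \<open>If \<open>p = (x - r) q\<close>, then \<open>q\<close> applied to \<open>Z\<close> is
  killed by the operator minus \<open>r\<close>, and it is nonzero by minimality. So every root of a
  minimal annihilator is an eigenvalue.\<close>

lemma sylvester_root_eigenvector:
  assumes "p \<noteq> 0" "sylvester_poly X Y p Z = 0"
    and min: "\<And>q. q \<noteq> 0 \<Longrightarrow> degree q < degree p \<Longrightarrow> sylvester_poly X Y q Z \<noteq> 0"
    and "poly p r = 0"
  obtains q where "p = [:- r, 1:] * q" "sylvester_poly X Y q Z \<noteq> 0"
    "sylvester X Y (sylvester_poly X Y q Z) = mat r ** sylvester_poly X Y q Z"
proof -
  obtain q where q: "p = [:- r, 1:] * q"
    using \<open>poly p r = 0\<close> by (auto simp: poly_eq_0_iff_dvd)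
  have "q \<noteq> 0" using \<open>p \<noteq> 0\<close> q by auto
  moreover from this have "degree q < degree p" unfolding q by (rule degree_linear_factor)
  ultimately show thesis
    using that[OF q] min assms(2) sylvester_poly_linear_factor[of X Y r q Z] q by simp
qed

lemma nonzero_poly_constant_or_root:
  fixes p :: "complex poly"
  assumes "p \<noteq> 0"
  obtains c where "c \<noteq> 0" "p = [:c:]" | r where "poly p r = 0"
proof (cases "degree p = 0")
  case True
  then show thesis using assms that(1) by (metis degree_eq_zeroE pCons_0_0)
next
  case False
  then show thesis
    using that(2) fundamental_theorem_of_algebra[of p] by (auto simp: constant_degree)
qed

text \<open>For an arbitrary annihilator only some root need be an eigenvalue: linear factors are
  removed until the resulting vector is nonzero, and the last factor removed gives the
  eigenvalue.\<close>

lemma annihilator_root_eigenvector: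
  assumes "p \<noteq> 0" "sylvester_poly X Y p Z = 0" "Z \<noteq> 0"
  shows "\<exists>r W. poly p r = 0 \<and> W \<noteq> 0 \<and> sylvester X Y W = mat r ** W"
  using assms
proof (induction "degree p" arbitrary: p rule: less_induct)
  case less
  from less.prems(1) show ?case
  proof (cases rule: nonzero_poly_constant_or_root)
    case (1 c)
    then show ?thesis using less.prems by (simp add: mat_eq_0_iff)
  next
    case (2 r)
    then obtain q where q: "p = [:- r, 1:] * q" by (auto simp: poly_eq_0_iff_dvd)
    show ?thesis
    proof (cases "sylvester_poly X Y q Z = 0")
      case True
      moreover have "q \<noteq> 0" using less.prems(1) q by auto
      moreover from this have "degree q < degree p" unfolding q by (rule degree_linear_factor)
      ultimately obtain s W where "poly q s = 0" "W \<noteq> 0" "sylvester X Y W = mat s ** W"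
        using less.hyps less.prems(3) by blast
      then show ?thesis using q by auto
    next
      case False
      then show ?thesis
        using less.prems(2) sylvester_poly_linear_factor[of X Y r q Z] 2 q by auto
    qed
  qed
qed

text \<open>Eigenvectors are traded for square matrices, here through a nonzero column and below
  through a matrix with all columns equal, so that matrices and Sylvester operators act on one
  space.\<close>

lemma eigenvaluesI_matrix:
  assumes "W \<noteq> 0" "M ** W = mat l ** W"
  shows "l \<in> eigenvalues M"
proof -
  obtain i j where "W $ i $ j \<noteq> 0" using assms(1) by (auto simp: vec_eq_iff)
  then have "column j W \<noteq> 0" by (auto simp: column_def vec_eq_iff)
  moreover have "M *v column j W = l *s column j W"
    using assms(2) by (simp add: vec_eq_iff mat_mult_nth column_def matrix_vector_mult_def)
      (simp add: matrix_matrix_mult_def)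
  ultimately show ?thesis by (auto simp: eigenvalues_def)
qed

lemma eigenvalues_matrixE:
  fixes M :: "complex^'n^'n"
  assumes "l \<in> eigenvalues M"
  obtains W :: "complex^'n^'n" where "W \<noteq> 0" "M ** W = mat l ** W"
proof -
  obtain v where v: "v \<noteq> 0" "M *v v = l *s v" using assms by (auto simp: eigenvalues_def)
  show thesis
  proof
    show "(\<chi> i j. v $ i) \<noteq> (0 :: complex^'n^'n)" using v(1) by (auto simp: vec_eq_iff)
    show "M ** (\<chi> i j. v $ i) = mat l ** (\<chi> i j. v $ i :: complex^'n^'n)"
      using v(2) by (simp add: vec_eq_iff mat_mult_nth matrix_vector_mult_def)
        (simp add: matrix_matrix_mult_def)
  qed
qed

text \<open>The eigenvalue equation reads \<open>(X - mat l) ** W = W ** Y\<close>, so a polynomial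
  annihilating \<open>Y\<close> also annihilates \<open>W\<close> under \<open>X - mat l\<close>.
  Some root \<open>r\<close> of it is an eigenvalue of \<open>X - mat l\<close>, and by minimality
  every root is one of \<open>Y\<close>; hence \<open>l = (l + r) - r\<close>.\<close>

lemma sylvester_eigenvalue:
  assumes "W \<noteq> 0" "sylvester X Y W = mat l ** W"
  obtains a b where "a \<in> eigenvalues X" "b \<in> eigenvalues Y" "l = a - b"
proof -
  obtain p where p: "p \<noteq> 0" "sylvester_poly Y 0 p (mat 1) = 0"
    "\<And>q. q \<noteq> 0 \<Longrightarrow> degree q < degree p \<Longrightarrow> sylvester_poly Y 0 q (mat 1) \<noteq> 0"
    using sylvester_minimal_polynomial by blast
  have XW: "(X - mat l) ** W = W ** Y"
    using assms(2) by (simp add: sylvester_def matrix_mult.diff_left algebra_simps)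
  have "sylvester_poly (X - mat l) 0 q W = W ** sylvester_poly Y 0 q (mat 1)" for q
  proof (induction q)
    case (pCons a q)
    then show ?case
      by (simp add: sylvester_def matrix_mult.zero_right matrix_mult.add_right mat_eq_scale
          matrix_mul_assoc XW)
  qed (simp add: matrix_mult.zero_right)
  then have "sylvester_poly (X - mat l) 0 p W = 0"
    by (simp add: p(2) matrix_mult.zero_right)
  then obtain r V where r: "poly p r = 0" "V \<noteq> 0" "sylvester (X - mat l) 0 V = mat r ** V"
    using annihilator_root_eigenvector p(1) assms(1) by blast
  have "r \<in> eigenvalues Y"
    using sylvester_root_eigenvector[OF p r(1)] eigenvaluesI_matrix
    by (metis sylvester_def matrix_mult.zero_right diff_zero)
  moreover have "X ** V = mat (l + r) ** V"
    using r(3) by (simp add: sylvester_def matrix_mult.diff_left matrix_mult.zero_right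
        mat_add matrix_mult.add_left algebra_simps)
  then have "l + r \<in> eigenvalues X" by (rule eigenvaluesI_matrix[OF r(2)])
  ultimately show thesis using that[of "l + r" r] by simp
qed

lemma matrix_mult_left_commute: "A ** B = B ** A \<Longrightarrow> A ** (B ** W) = B ** (A ** W)"
  by (simp add: matrix_mul_assoc)

lemma matrix_exp_mat: "matrix_exp (mat c :: 'a::{real_normed_field,banach}^'n^'n) = mat (exp c)"
  using matrix_exp_add_mat[of "0 :: 'a^'n^'n" c] by simp

text \<open>The eigenspace of \<open>matrix_exp X\<close> for \<open>m\<close> is invariant under
  \<open>X\<close>, hence contains an eigenvector of \<open>X\<close>, say for \<open>r\<close>. On
  it the exponential acts as \<open>exp r\<close>, which must equal \<open>m\<close>.\<close>

lemma eigenvalues_matrix_exp: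
  fixes X :: "complex^'n^'n"
  assumes "m \<in> eigenvalues (matrix_exp X)"
  obtains l where "l \<in> eigenvalues X" "m = exp l"
proof -
  obtain Z :: "complex^'n^'n" where Z: "Z \<noteq> 0" "matrix_exp X ** Z = mat m ** Z"
    using assms eigenvalues_matrixE by blast
  obtain p where p: "p \<noteq> 0" "sylvester_poly X 0 p Z = 0"
    "\<And>q. q \<noteq> 0 \<Longrightarrow> degree q < degree p \<Longrightarrow> sylvester_poly X 0 q Z \<noteq> 0"
    using sylvester_minimal_polynomial by blast
  let ?V = "{W. matrix_exp X ** W = mat m ** W}"
  have V: "sylvester_poly X 0 q Z \<in> ?V" for q
  proof (rule sylvester_poly_invariant)
    fix W :: "complex^'n^'n"
    assume "W \<in> ?V"
    then show "sylvester X 0 W \<in> ?V"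
      using matrix_mult_left_commute[of "matrix_exp X" X W] matrix_exp_commute[of X 1]
        matrix_mult_left_commute[OF mat_eq_scale[of m X], of W]
      by (simp add: sylvester_def matrix_mult.zero_right)
    show "mat c ** W \<in> ?V" for c
      using \<open>W \<in> ?V\<close> matrix_mult_left_commute[OF mat_eq_scale[of c "matrix_exp X"], of W]
        matrix_mult_left_commute[OF mat_eq_scale[of c "mat m"], of W]
      by simp
  qed (use Z(2) in \<open>simp_all add: matrix_mult.zero_right matrix_mult.add_right\<close>)
  from p(1) obtain r where "poly p r = 0"
  proof (cases rule: nonzero_poly_constant_or_root)
    case (1 c)
    then show thesis using p(2) Z(1) by (simp add: mat_eq_0_iff)
  qed
  with p obtain q where q: "sylvester_poly X 0 q Z \<noteq> 0"
    "sylvester X 0 (sylvester_poly X 0 q Z) = mat r ** sylvester_poly X 0 q Z"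
    using sylvester_root_eigenvector by metis
  define W where "W = sylvester_poly X 0 q Z"
  have XW: "X ** W = mat r ** W"
    using q(2) by (simp add: W_def sylvester_def matrix_mult.zero_right)
  then have "matrix_exp X ** W = W ** matrix_exp (mat r)"
    by (intro matrix_exp_intertwine[symmetric]) (simp add: mat_eq_scale)
  then have "matrix_exp X ** W = mat (exp r) ** W"
    by (simp add: matrix_exp_mat mat_eq_scale)
  moreover have "matrix_exp X ** W = mat m ** W" using V[of q] by (simp add: W_def)
  ultimately have "mat (exp r) ** W = mat m ** W" by simp
  moreover have "W \<noteq> 0" using q(1) by (simp add: W_def)
  ultimately have "m = exp r" by (auto simp: vec_eq_iff mat_mult_nth)
  then show thesis using that eigenvaluesI_matrix[OF \<open>W \<noteq> 0\<close> XW] by blast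
qed

text \<open>\<open>P\<close>, \<open>N\<close>, 0 is a chain of length two under
  \<open>T Z = X Z - Z Y\<close>, and the exponential of \<open>T\<close> sends \<open>P\<close> to
  \<open>P + N\<close>. The conclusion is this identity multiplied by \<open>matrix_exp Y\<close> on
  the right.\<close>

lemma matrix_exp_generalized_intertwine:
  fixes X Y P N :: "complex^'n^'n"
  assumes P: "X ** P - P ** Y = N" and N: "X ** N = N ** Y"
  shows "matrix_exp X ** P = P ** matrix_exp Y + N ** matrix_exp Y"
proof -
  \<comment> \<open>The difference of both sides with \<open>X\<close>, \<open>Y\<close> and
    \<open>N\<close> scaled by \<open>t\<close>; it solves \<open>G' = X ** G\<close> with
    \<open>G 0 = 0\<close>.\<close>
  define G where "G t = matrix_exp (t *\<^sub>R X) ** P - P ** matrix_exp (t *\<^sub>R Y)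
    - t *\<^sub>R (N ** matrix_exp (t *\<^sub>R Y))" for t
  have PY: "P ** Y = X ** P - N" using P by (simp add: algebra_simps)
  have "(G has_vector_derivative X ** G t) (at t)" for t
    unfolding G_def
    by (rule derivative_eq_intros refl matrix_exp_has_vector_derivative
        bounded_linear.has_vector_derivative[OF matrix_mult.bounded_linear_left]
        bounded_linear.has_vector_derivative[OF matrix_mult.bounded_linear_right])+
      (simp add: matrix_mult.diff_right matrix_mult.diff_left matrix_mult_scaleR_right matrix_mul_assoc PY N[symmetric])
  from matrix_ode_unique[OF convex_UNIV UNIV_I this UNIV_I, of 1]
  have "G 1 = 0" by (simp add: G_def matrix_mult.zero_right)
  then show ?thesis by (simp add: G_def algebra_simps)
qed

text \<open>With \<open>T Z = X Z - Z Y\<close> one has \<open>e\<^sup>T I = e\<^sup>X e\<^sup>-\<^sup>Y = I\<close>. An eigenvalue of \<open>T\<close> on the invariant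
  space \<open>{Z. e\<^sup>T Z = Z}\<close> lies in \<open>2 \<pi> \<i> \<int>\<close> and is a difference of eigenvalues of \<open>X\<close> and \<open>Y\<close>, so it
  is zero. Hence \<open>T\<close> is nilpotent at \<open>I\<close>, and \<open>e\<^sup>T I = I\<close> then forces \<open>T I = X - Y = 0\<close>.\<close>
theorem matrix_exp_inj_strip:
  fixes X Y :: "complex^'n^'n"
  assumes exp: "matrix_exp X = matrix_exp Y"
    and X: "\<And>l. l \<in> eigenvalues X \<Longrightarrow> - pi < Im l \<and> Im l < pi"
    and Y: "\<And>l. l \<in> eigenvalues Y \<Longrightarrow> - pi < Im l \<and> Im l < pi"
  shows "X = Y"
proof -
  \<comment> \<open>The fixed space of \<open>Z \<mapsto> e^X Z e^-Y\<close>. It contains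
    \<open>mat 1\<close> by the assumption \<open>exp\<close> and is invariant under the Sylvester
    operator.\<close>
  let ?V = "{Z. matrix_exp X ** Z = Z ** matrix_exp Y}"
  obtain p where p: "p \<noteq> 0" "sylvester_poly X Y p (mat 1) = 0"
    "\<And>q. q \<noteq> 0 \<Longrightarrow> degree q < degree p \<Longrightarrow> sylvester_poly X Y q (mat 1) \<noteq> 0"
    using sylvester_minimal_polynomial by blast
  have V: "sylvester_poly X Y q (mat 1) \<in> ?V" for q
  proof (rule sylvester_poly_invariant)
    fix W assume W: "W \<in> ?V"
    have "matrix_exp X ** (X ** W) = X ** (matrix_exp X ** W)"
      using matrix_exp_commute[of X 1] by (simp add: matrix_mul_assoc)
    then have "matrix_exp X ** (X ** W) = X ** (W ** matrix_exp Y)"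
      using W by simp
    moreover have "matrix_exp X ** (W ** Y) = W ** (Y ** matrix_exp Y)"
      using W matrix_exp_commute[of Y 1] by (simp add: matrix_mul_assoc)
    ultimately show "sylvester X Y W \<in> ?V"
      using W by (simp add: sylvester_def matrix_mult.diff_right matrix_mult.diff_left matrix_mul_assoc)
    show "mat c ** W \<in> ?V" for c
      using W matrix_mult_left_commute[OF mat_eq_scale[of c "matrix_exp X"], of W]
      by (simp add: matrix_mul_assoc[symmetric])
  qed (use exp in \<open>simp_all add: matrix_mult.zero_right matrix_mult.zero_left
      matrix_mult.add_right matrix_mult.add_left\<close>)
  have roots: "r = 0" if root: "poly p r = 0" for r
  proof -
    obtain q where q: "sylvester_poly X Y q (mat 1) \<noteq> 0"
      "sylvester X Y (sylvester_poly X Y q (mat 1)) = mat r ** sylvester_poly X Y q (mat 1)"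
      using sylvester_root_eigenvector[OF p root] by metis
    define W where "W = sylvester_poly X Y q (mat 1)"
    have W: "W \<noteq> 0" "sylvester X Y W = mat r ** W" "matrix_exp X ** W = W ** matrix_exp Y"
      using q V[of q] by (simp_all add: W_def)
    obtain a b where ab: "a \<in> eigenvalues X" "b \<in> eigenvalues Y" "r = a - b"
      using sylvester_eigenvalue[OF W(1,2)] .
    have "W ** (Y + mat r) = X ** W"
      using W(2) by (simp add: sylvester_def matrix_mult.add_right mat_eq_scale algebra_simps)
    then have "W ** matrix_exp (Y + mat r) = matrix_exp X ** W" by (rule matrix_exp_intertwine)
    then have "mat (exp r) ** (matrix_exp X ** W) = matrix_exp X ** W"
      unfolding matrix_exp_add_mat matrix_mul_assoc mat_eq_scale[symmetric]
      by (simp add: W(3) matrix_mul_assoc[symmetric])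
    moreover have "matrix_exp X ** W \<noteq> 0"
    proof
      assume "matrix_exp X ** W = 0"
      then have "matrix_exp (- X) ** (matrix_exp X ** W) = 0" by (simp add: matrix_mult.zero_right)
      then show False using W(1) by (simp add: matrix_mul_assoc matrix_exp_minus_mult)
    qed
    ultimately have "exp r = 1" by (auto simp: vec_eq_iff mat_mult_nth)
    then obtain n :: int where n: "Re r = 0" "Im r = of_int (2 * n) * pi"
      by (auto simp: exp_eq_1)
    \<comment> \<open>\<open>r\<close> is a period of \<open>exp\<close> and a difference of two
      numbers in the strip; only the period 0 is short enough.\<close>
    have "\<bar>Im r\<bar> < 2 * pi" using X[OF ab(1)] Y[OF ab(2)] ab(3) by auto
    then have "\<bar>of_int n\<bar> < (1 :: real)" using n(2) by (simp add: abs_mult)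
    then have "n = 0" by linarith
    then show "r = 0" using n by (simp add: complex_eq_iff)
  qed
  from p(1) obtain r where "poly p r = 0"
  proof (cases rule: nonzero_poly_constant_or_root)
    case (1 c)
    then have "sylvester_poly X Y p (mat 1) $ i $ i = c" for i by simp (simp add: mat_def)
    then show thesis using 1 p(2) by simp
  qed
  then have "poly p 0 = 0" using roots by metis
  then obtain q where q: "p = [:- 0, 1:] * q" "sylvester_poly X Y q (mat 1) \<noteq> 0"
    "sylvester X Y (sylvester_poly X Y q (mat 1)) = mat 0 ** sylvester_poly X Y q (mat 1)"
    using sylvester_root_eigenvector[OF p] by metis
  have "q \<noteq> 0" using p(1) q(1) by auto
  then have "sylvester X Y (mat 1) = 0"
  proof (cases rule: nonzero_poly_constant_or_root)
    case (1 c)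
    then show ?thesis
      using q(3) by (simp add: sylvester_mat mat_eq_0_iff matrix_mult.zero_left del: matrix_mul_rid)
  next
    \<comment> \<open>All roots are 0, so a nonconstant \<open>q\<close> contains a second factor
      \<open>x\<close>. Then \<open>P\<close> and \<open>N\<close> form a chain of length two with
      \<open>N\<close> nonzero, while membership of \<open>P\<close> in \<open>?V\<close> forces
      \<open>N ** matrix_exp Y = 0\<close>.\<close>
    case (2 r)
    then have "poly q 0 = 0" using roots[of r] q(1) by auto
    then obtain s where s: "q = [:- 0, 1:] * s" by (auto simp only: poly_eq_0_iff_dvd)
    define P where "P = sylvester_poly X Y s (mat 1)"
    define N where "N = sylvester_poly X Y q (mat 1)"
    have "X ** P - P ** Y = N"
      using s sylvester_poly_linear_factor[of X Y 0 s "mat 1"]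
      by (simp add: P_def N_def sylvester_def matrix_mult.zero_left)
    moreover have "X ** N = N ** Y"
      using q(3) by (simp add: N_def sylvester_def matrix_mult.zero_left)
    ultimately have "N ** matrix_exp Y = 0"
      using matrix_exp_generalized_intertwine V[of s] by (fastforce simp: P_def)
    then have "N ** matrix_exp Y ** matrix_exp (- Y) = 0" by (simp add: matrix_mult.zero_left)
    then have "N = 0" by (simp add: matrix_mul_assoc[symmetric] matrix_exp_mult_minus)
    then show ?thesis using q(2) by (simp add: N_def)
  qed
  then show ?thesis by (simp add: sylvester_def)
qed

text \<open>The \<open>THE\<close> in \<open>principal_log\<close> has content only once unique
  existence is known; that fact is also part of the final statement.\<close>

lemma principal_log_matrix_exp:
  fixes L :: "complex^'n^'n"
  assumes "\<And>l. l \<in> eigenvalues L \<Longrightarrow> - pi < Im l \<and> Im l < pi"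
  shows "\<exists>!L'. matrix_exp L' = matrix_exp L \<and> (\<forall>l\<in>eigenvalues L'. - pi < Im l \<and> Im l < pi)"
    and "principal_log (matrix_exp L) = L"
proof -
  show ex1: "\<exists>!L'. matrix_exp L' = matrix_exp L \<and> (\<forall>l\<in>eigenvalues L'. - pi < Im l \<and> Im l < pi)"
    using matrix_exp_inj_strip[of _ L] assms by blast
  show "principal_log (matrix_exp L) = L"
    unfolding principal_log_def by (rule the1_equality[OF ex1]) (use assms in auto)
qed

text \<open>By spectral mapping only values \<open>exp l\<close> have to be excluded. Being real and
  nonpositive means \<open>sin (Im l) = 0\<close> and \<open>cos (Im l) \<le> 0\<close>, but in the
  open strip the sine vanishes only at 0, where the cosine is 1.\<close>

lemma eigenvalues_matrix_exp_nonpos: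
  assumes "\<And>l. l \<in> eigenvalues L \<Longrightarrow> - pi < Im l \<and> Im l < pi"
  shows "eigenvalues (matrix_exp L) \<inter> \<real>\<^sub>\<le>\<^sub>0 = {}"
proof -
  have "exp l \<notin> \<real>\<^sub>\<le>\<^sub>0" if "l \<in> eigenvalues L" for l
  proof
    assume "exp l \<in> \<real>\<^sub>\<le>\<^sub>0"
    then have "Re (exp l) \<le> 0" "Im (exp l) = 0"
      by (auto simp: complex_nonpos_Reals_iff)
    then have "cos (Im l) \<le> 0" "sin (Im l) = 0"
      by (auto simp: Re_exp Im_exp mult_le_0_iff)
    then show False
      using assms[OF that] sin_eq_0_pi[of "Im l"] by auto
  qed
  then show ?thesis using eigenvalues_matrix_exp by (metis disjoint_iff)
qed

section \<open>Spectra under scaling, transposition and similarity\<close>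

lemma eigenvalues_scaleR:
  assumes "l \<in> eigenvalues (c *\<^sub>R M)" "c \<noteq> 0"
  obtains k where "k \<in> eigenvalues M" "l = of_real c * k"
proof -
  obtain v where v: "v \<noteq> 0" "(c *\<^sub>R M) *v v = l *s v" using assms by (auto simp: eigenvalues_def)
  have "(c *\<^sub>R M) *v v = of_real c *s (M *v v)"
    by (simp add: vec_eq_iff matrix_vector_mult_def scaleR_conv_of_real[where 'a = complex]
        sum_distrib_left mult.assoc)
  then have "M *v v = (l / of_real c) *s v"
    using v(2) assms(2) by (simp add: vec_eq_iff field_simps)
  then have "l / of_real c \<in> eigenvalues M" using v(1) by (auto simp: eigenvalues_def)
  then show thesis using that[of "l / of_real c"] assms(2) by simp
qed

lemma eigenvalues_iff_det: "l \<in> eigenvalues M \<longleftrightarrow> det (M - mat l) = 0"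
proof -
  have "mat l *v v = l *s v" for v :: "complex^'a"
    by (simp add: vec_eq_iff matrix_vector_mult_def mat_def if_distrib if_distribR cong: if_cong)
  then have "M *v v = l *s v \<longleftrightarrow> (M - mat l) *v v = 0" for v
    by (simp add: matrix_vector_mult_diff_rdistrib)
  then show ?thesis
    unfolding eigenvalues_def
    using invertible_det_nz[of "M - mat l"] matrix_left_invertible_ker[of "M - mat l"]
      invertible_left_inverse[of "M - mat l"] by auto
qed

lemma eigenvalues_transpose: "eigenvalues (transpose M) = eigenvalues M"
proof -
  have "transpose (M - mat l) = transpose M - mat l" for l
    by (simp add: transpose_def mat_def vec_eq_iff)
  then show ?thesis using det_transpose[of "M - mat _"] by (auto simp: eigenvalues_iff_det)
qed

text \<open>Eigenvectors are carried along by the inverse of \<open>P\<close>. This inclusion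
  transports the sampling bound from \<open>A\<close> to a matrix similar to its transpose.\<close>

lemma eigenvalues_similar_subset:
  assumes "P ** N = M ** P" "invertible P"
  shows "eigenvalues M \<subseteq> eigenvalues N"
proof
  fix l assume "l \<in> eigenvalues M"
  then obtain v where v: "v \<noteq> 0" "M *v v = l *s v" by (auto simp: eigenvalues_def)
  obtain P' where P': "P ** P' = mat 1" "P' ** P = mat 1" using assms(2) by (auto simp: invertible_def)
  have "N ** P' = P' ** M"
    by (metis P' assms(1) matrix_mul_assoc matrix_mul_lid matrix_mul_rid)
  then have "N *v (P' *v v) = l *s (P' *v v)"
    by (simp add: matrix_vector_mul_assoc) (simp add: matrix_vector_mul_assoc[symmetric] v(2) vector_scalar_commute)
  moreover have "P *v (P' *v v) = v" by (simp add: matrix_vector_mul_assoc P')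
  then have "P' *v v \<noteq> 0" using v(1) by auto
  ultimately show "l \<in> eigenvalues N" by (auto simp: eigenvalues_def)
qed

section \<open>Quadratic forms\<close>

lemma inner_matrix_transpose: "x \<bullet> (A *v y) = (transpose A *v x) \<bullet> y"
  for x :: "real^'n"
  by (simp add: dot_lmul_matrix)

lemma inner_symmetric_matrix: "transpose K = K \<Longrightarrow> x \<bullet> (K *v y) = y \<bullet> (K *v x)"
  for K :: "real^'n^'n"
  by (metis inner_matrix_transpose inner_commute)

lemma inner_sandwich: "u \<bullet> ((T ** K ** transpose T) *v u) = (transpose T *v u) \<bullet> (K *v (transpose T *v u))"
  for T :: "real^'m^'n"
  by (simp add: matrix_vector_mul_assoc[symmetric] inner_matrix_transpose del: transpose_matrix_vector)

lemma transpose_add: "transpose (A + B) = transpose A + transpose B"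
  by (simp add: transpose_def vec_eq_iff)

lemma transpose_diff: "transpose (A - B) = transpose A - transpose B"
  by (simp add: transpose_def vec_eq_iff)

lemma transpose_minus: "transpose (- A) = - transpose A"
  by (simp add: transpose_def vec_eq_iff)

lemma matrix_vector_mult_scaleR_left: "(c *\<^sub>R A) *v x = c *\<^sub>R (A *v x)" for A :: "real^'n^'m"
  by (simp add: matrix_vector_mult_def vec_eq_iff sum_distrib_left mult.assoc)

lemma matrix_vector_mult_minus_left: "(- A) *v x = - (A *v x)" for A :: "real^'n^'m"
  by (simp add: matrix_vector_mult_def vec_eq_iff sum_negf)

lemma matrix_vector_mult_add_scaleR:
  "(K *v (x + t *\<^sub>R y)) = K *v x + t *\<^sub>R (K *v y)" for K :: "real^'n^'m"
  by (simp add: matrix_vector_right_distrib matrix_vector_mult_scaleR)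

lemma quadratic_expand:
  fixes K :: "real^'n^'n"
  assumes "transpose K = K"
  shows "(x + t *\<^sub>R y) \<bullet> (K *v (x + t *\<^sub>R y))
    = x \<bullet> (K *v x) + 2 * t * (y \<bullet> (K *v x)) + t\<^sup>2 * (y \<bullet> (K *v y))"
  using inner_symmetric_matrix[OF assms, of x y]
  by (simp add: matrix_vector_mult_add_scaleR inner_add_left inner_add_right power2_eq_square algebra_simps)

text \<open>Moving from \<open>u\<close> against \<open>K *v u\<close> lowers the form below 0 to
  first order unless that vector vanishes.\<close>

lemma psd_kernel:
  fixes K :: "real^'n^'n"
  assumes sym: "transpose K = K" and psd: "\<And>v. 0 \<le> v \<bullet> (K *v v)" and u: "u \<bullet> (K *v u) = 0"
  shows "K *v u = 0"
proof -
  define w where "w = K *v u"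
  define c where "c = w \<bullet> (K *v w)"
  have c: "0 \<le> c" by (simp add: c_def psd)
  have "w \<bullet> w = 0"
  proof (rule ccontr)
    assume "w \<bullet> w \<noteq> 0"
    then have k: "0 < w \<bullet> w" by (simp add: order_less_le)
    \<comment> \<open>This step length makes the value exactly
      \<open>- (r\<^sup>2 * (c + 2))\<close>; the added 1 keeps the denominator positive when
      \<open>c = 0\<close>.\<close>
    define r where "r = (w \<bullet> w) / (c + 1)"
    have r: "w \<bullet> w = r * (c + 1)" using c by (simp add: r_def)
    have "0 < r" using k c by (simp add: r_def)
    have "0 \<le> 2 * (- r) * (w \<bullet> w) + (- r)\<^sup>2 * c"
      using psd[of "u + (- r) *\<^sub>R w"] unfolding quadratic_expand[OF sym] by (simp add: u c_def w_def)
    also have "\<dots> = - (r\<^sup>2 * (c + 2))" unfolding r by (simp add: power2_eq_square algebra_simps)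
    finally show False using c \<open>0 < r\<close> by (simp add: mult_le_0_iff)
  qed
  then show ?thesis by (simp add: w_def)
qed

lemma quadratic_form_zero:
  fixes K :: "real^'n^'n"
  assumes "transpose K = K" "\<And>v. v \<bullet> (K *v v) = 0"
  shows "K = 0"
  using psd_kernel[OF assms(1)] assms(2) by (simp add: matrix_eq)

lemma continuous_on_quadratic: "continuous_on A (\<lambda>x. x \<bullet> (K *v x))" for K :: "real^'n^'n"
  by (intro continuous_intros linear_continuous_on) (simp add: linear_linear)

lemma quadratic_scale: "(c *\<^sub>R x) \<bullet> (K *v (c *\<^sub>R x)) = c\<^sup>2 * (x \<bullet> (K *v x))" for K :: "real^'n^'n"
  by (simp add: matrix_vector_mult_scaleR power2_eq_square)

lemma sphere_nonempty_cart: "sphere (0 :: real^'n) 1 \<noteq> {}"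
  using norm_axis_1 by auto

lemma posdef_positive: "symmetric_posdef S \<Longrightarrow> v \<noteq> 0 \<Longrightarrow> 0 < v \<bullet> (S *v v)"
  by (simp add: symmetric_posdef_def)

lemma posdef_symmetric: "symmetric_posdef S \<Longrightarrow> transpose S = S"
  by (simp add: symmetric_posdef_def)

lemma posdef_nonneg: "symmetric_posdef S \<Longrightarrow> 0 \<le> v \<bullet> (S *v v)"
  by (cases "v = 0") (auto dest: posdef_positive[of S v])

text \<open>The generalized Rayleigh quotient attains its maximum on the compact unit sphere, and
  homogeneity extends the bound to all vectors.\<close>

lemma extremal_ratio:
  fixes D S :: "real^'n^'n"
  assumes S: "symmetric_posdef S"
  obtains u c where "u \<noteq> 0" "u \<bullet> (D *v u) = c * (u \<bullet> (S *v u))"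
    "\<And>w. w \<bullet> (D *v w) \<le> c * (w \<bullet> (S *v w))"
proof -
  let ?g = "\<lambda>w :: real^'n. (w \<bullet> (D *v w)) / (w \<bullet> (S *v w))"
  have "w \<bullet> (S *v w) \<noteq> 0" if "w \<in> sphere 0 1" for w
  proof -
    have "w \<noteq> 0" using that by auto
    from posdef_positive[OF S this] show ?thesis by simp
  qed
  then have "continuous_on (sphere 0 1) ?g"
    by (intro continuous_on_divide continuous_on_quadratic ballI) blast
  from continuous_attains_sup[OF compact_sphere sphere_nonempty_cart this]
  obtain u where u: "u \<in> sphere 0 1" "\<And>w. w \<in> sphere 0 1 \<Longrightarrow> ?g w \<le> ?g u" by blast
  then have "u \<noteq> 0" by auto
  then have pos: "0 < u \<bullet> (S *v u)" by (rule posdef_positive[OF S])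
  show thesis
  proof (rule that[OF \<open>u \<noteq> 0\<close>])
    show "u \<bullet> (D *v u) = ?g u * (u \<bullet> (S *v u))" using pos by simp
    fix w :: "real^'n"
    show "w \<bullet> (D *v w) \<le> ?g u * (w \<bullet> (S *v w))"
    proof (cases "w = 0")
      case False
      define e where "e = (1 / norm w) *\<^sub>R w"
      have "e \<in> sphere 0 1" using False by (simp add: e_def)
      from u(2)[OF this] have "?g e \<le> ?g u" .
      moreover have "?g e = ?g w" using False unfolding e_def quadratic_scale by simp
      ultimately show ?thesis using posdef_positive[OF S False] by (simp add: divide_le_eq)
    qed simp
  qed
qed

lemma mat_1_posdef: "symmetric_posdef (mat 1 :: real^'n^'n)"
  by (simp add: symmetric_posdef_def)

text \<open>The constant is the reciprocal of the largest ratio of the form of \<open>K\<close> to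
  that of \<open>S\<close>. It will serve as an exponential rate.\<close>

lemma posdef_lower_bound:
  fixes S K :: "real^'n^'n"
  assumes S: "symmetric_posdef S" and K: "symmetric_posdef K"
  obtains c where "0 < c" "\<And>w. c * (w \<bullet> (K *v w)) \<le> w \<bullet> (S *v w)"
proof -
  obtain u c where u: "u \<noteq> 0" "u \<bullet> (K *v u) = c * (u \<bullet> (S *v u))"
    "\<And>w. w \<bullet> (K *v w) \<le> c * (w \<bullet> (S *v w))"
    using extremal_ratio[OF S] by blast
  have "0 < c"
    using posdef_positive[OF K u(1)] posdef_positive[OF S u(1)] u(2) by (simp add: zero_less_mult_iff)
  then show thesis
    using that[of "1 / c"] u(3) by (simp add: field_simps)
qed

lemma posdef_inverse:
  assumes "symmetric_posdef S"
  shows posdef_inv_right: "S ** matrix_inv S = mat 1" and posdef_inv_left: "matrix_inv S ** S = mat 1"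
proof -
  have "\<forall>x. S *v x = 0 \<longrightarrow> x = 0"
    using assms by (metis inner_zero_right order_less_irrefl symmetric_posdef_def)
  then have "invertible S"
    using matrix_left_invertible_ker invertible_left_inverse by blast
  then have "S ** matrix_inv S = mat 1 \<and> matrix_inv S ** S = mat 1"
    unfolding invertible_def matrix_inv_def by (rule someI_ex)
  then show "S ** matrix_inv S = mat 1" "matrix_inv S ** S = mat 1" by auto
qed

lemma posdef_mult_right_cancel:
  assumes "symmetric_posdef S" shows "X ** S = Y ** S \<longleftrightarrow> X = Y"
  by (metis assms matrix_mul_assoc matrix_mul_rid posdef_inv_right)

lemma posdef_mult_inv_right:
  assumes "symmetric_posdef S" shows "X ** S ** matrix_inv S = X" "X ** matrix_inv S ** S = X"
  by (simp_all add: matrix_mul_assoc[symmetric] posdef_inverse[OF assms])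

section \<open>The Lyapunov equation and the family of drifts\<close>

text \<open>The two summands of the Lyapunov equation are transposes of each other and so share one
  quadratic form.\<close>

lemma lyapunov_quadratic:
  assumes "lyapunov B S K" "transpose S = S"
  shows "w \<bullet> ((B ** S) *v w) = (w \<bullet> (K *v w)) / 2"
proof -
  have "S ** transpose B = transpose (B ** S)"
    by (simp add: matrix_transpose_mul assms(2))
  then have "w \<bullet> (K *v w) = w \<bullet> ((B ** S) *v w) + w \<bullet> (transpose (B ** S) *v w)"
    using assms(1) by (auto simp: lyapunov_def matrix_vector_mult_add_rdistrib inner_add_right
        simp del: transpose_matrix_vector)
  moreover have "w \<bullet> (transpose (B ** S) *v w) = w \<bullet> ((B ** S) *v w)"
    by (subst inner_matrix_transpose) (simp add: inner_commute)
  ultimately show ?thesis by simp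
qed

lemma lyapunov_stable:
  fixes B S K :: "real^'n^'n"
  assumes S: "symmetric_posdef S" and K: "symmetric_posdef K" and B: "lyapunov B S K"
  shows "stable_drift B"
  unfolding stable_drift_def
proof
  fix l assume "l \<in> eigenvalues (cmatrix B)"
  then obtain v where v: "v \<noteq> 0" "cmatrix B *v v = l *s v" by (auto simp: eigenvalues_def)
  \<comment> \<open>The argument stays real: real and imaginary parts of the eigenvector are treated
    separately, and the sum of two real forms replaces the Hermitian one.\<close>
  define a b :: "real^'n" where "a = (\<chi> i. Re (v $ i))" and "b = (\<chi> i. Im (v $ i))"
  have nth: "(\<Sum>j\<in>UNIV. complex_of_real (B $ i $ j) * v $ j) = l * v $ i" for i
    using arg_cong[OF v(2), of "\<lambda>x. x $ i"] by (simp add: matrix_vector_mult_def)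
  have Ba: "B *v a = Re l *\<^sub>R a - Im l *\<^sub>R b"
    using arg_cong[OF nth, of Re] by (simp add: vec_eq_iff matrix_vector_mult_def a_def b_def)
  have Bb: "B *v b = Re l *\<^sub>R b + Im l *\<^sub>R a"
    using arg_cong[OF nth, of Im] by (simp add: vec_eq_iff matrix_vector_mult_def a_def b_def)
  define x y where "x = matrix_inv S *v a" and "y = matrix_inv S *v b"
  have Sx: "S *v x = a" and Sy: "S *v y = b"
    by (simp_all add: x_def y_def matrix_vector_mul_assoc posdef_inverse[OF S])
  have "x \<noteq> 0 \<or> y \<noteq> 0"
  proof (rule ccontr)
    assume "\<not> ?thesis"
    then have "a = 0" "b = 0" using Sx Sy by auto
    then have "v = 0" by (auto simp: vec_eq_iff a_def b_def complex_eq_iff)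
    then show False using v(1) by simp
  qed
  then have pos: "0 < w \<bullet> (W *v w) + w' \<bullet> (W *v w')" if "w = x" "w' = y" "symmetric_posdef W" for w w' W
    using that posdef_positive[of W x] posdef_positive[of W y] posdef_nonneg[of W x] posdef_nonneg[of W y]
    by auto
  \<comment> \<open>The terms with \<open>Im l\<close> cancel by symmetry of
    \<open>S\<close>.\<close>
  have "x \<bullet> ((B ** S) *v x) + y \<bullet> ((B ** S) *v y) = Re l * (x \<bullet> (S *v x) + y \<bullet> (S *v y))"
    using inner_symmetric_matrix[OF posdef_symmetric[OF S], of x y]
    by (simp add: matrix_vector_mul_assoc[symmetric] Sx Sy Ba Bb algebra_simps inner_diff_right inner_add_right)
  then have "0 < Re l * (x \<bullet> (S *v x) + y \<bullet> (S *v y))"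
    using pos[OF refl refl K] by (simp add: lyapunov_quadratic[OF B posdef_symmetric[OF S]])
  then show "0 < Re l"
    using pos[OF refl refl S] by (simp add: zero_less_mult_iff)
qed

lemma lyapunov_circulation_iff:
  assumes S: "transpose S = S" and K: "transpose K = K"
  shows "lyapunov B S K \<longleftrightarrow> antisymmetric (circulation B S K)"
proof -
  have "transpose (B ** S) = S ** transpose B" by (simp add: matrix_transpose_mul S)
  then have "antisymmetric (circulation B S K) \<longleftrightarrow>
      S ** transpose B - (1/2) *\<^sub>R K = (1/2) *\<^sub>R K - B ** S"
    by (simp add: antisymmetric_def circulation_def transpose_diff transpose_scalar K)
  also have "\<dots> \<longleftrightarrow> B ** S + S ** transpose B = (1/2) *\<^sub>R K + (1/2) *\<^sub>R K"
    by (auto simp: algebra_simps)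
  also have "(1/2) *\<^sub>R K + (1/2) *\<^sub>R K = K" by (simp add: scaleR_left_distrib[symmetric])
  finally show ?thesis by (simp add: lyapunov_def)
qed

lemma circulation_drift:
  assumes "symmetric_posdef S"
  shows "circulation (((1/2) *\<^sub>R K + P) ** matrix_inv S) S K = P"
  by (simp add: circulation_def posdef_mult_inv_right[OF assms])

lemma drift_circulation:
  assumes "symmetric_posdef S"
  shows "((1/2) *\<^sub>R K + circulation B S K) ** matrix_inv S = B"
  by (simp add: circulation_def posdef_mult_inv_right[OF assms])

lemma drift_family_iff:
  assumes S: "symmetric_posdef S" and K: "symmetric_posdef K"
  shows "B \<in> drift_family S K \<longleftrightarrow> lyapunov B S K"
  unfolding lyapunov_circulation_iff[OF posdef_symmetric[OF S] posdef_symmetric[OF K]]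
  using circulation_drift[OF S, of K] drift_circulation[OF S, of K B]
  by (auto simp: drift_family_def) (metis)

lemma drift_family_eq_identified_set:
  assumes S: "symmetric_posdef S" and K: "symmetric_posdef K"
  shows "identified_set S K = drift_family S K"
  using lyapunov_stable[OF S K] by (auto simp: drift_family_iff[OF S K] identified_set_def)

lemma bij_betw_circulation:
  assumes S: "symmetric_posdef S" and K: "symmetric_posdef K"
  shows "bij_betw (\<lambda>B. circulation B S K) (drift_family S K) {P. antisymmetric P}"
  by (rule bij_betw_byWitness[where f' = "\<lambda>P. ((1/2) *\<^sub>R K + P) ** matrix_inv S"])
    (auto simp: circulation_drift[OF S] drift_circulation[OF S], auto simp: drift_family_def circulation_drift[OF S])

lemma affine_drift_family:
  assumes S: "symmetric_posdef S" and K: "symmetric_posdef K"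
  shows "affine (drift_family S K)"
  unfolding affine_def
proof (intro ballI allI impI)
  fix X Y and u v :: real
  assume XY: "X \<in> drift_family S K" "Y \<in> drift_family S K" and uv: "u + v = 1"
  have "(u *\<^sub>R X + v *\<^sub>R Y) ** S + S ** transpose (u *\<^sub>R X + v *\<^sub>R Y)
      = u *\<^sub>R (X ** S + S ** transpose X) + v *\<^sub>R (Y ** S + S ** transpose Y)"
    by (simp add: transpose_add transpose_scalar matrix_mult.add_left matrix_mult.add_right
        matrix_mult_scaleR_left matrix_mult_scaleR_right algebra_simps)
  also have "\<dots> = K"
    using XY uv by (simp add: drift_family_iff[OF S K] lyapunov_def scaleR_left_distrib[symmetric])
  finally show "u *\<^sub>R X + v *\<^sub>R Y \<in> drift_family S K"
    by (simp add: drift_family_iff[OF S K] lyapunov_def)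
qed

text \<open>\<open>axis i (axis j 1)\<close> is the matrix unit at \<open>(i, j)\<close>. Besides
  spanning the antisymmetric matrices, these matrices for \<open>i \<noteq> j\<close> generate the
  rotations of coordinate planes used for full turns.\<close>

definition skew_unit :: "'n \<Rightarrow> 'n \<Rightarrow> real^'n^'n" where
  "skew_unit i j = axis i (axis j 1) - axis j (axis i 1)"

lemma skew_unit_nth:
  "skew_unit i j $ k $ l = (if k = i \<and> l = j then 1 else 0) - (if k = j \<and> l = i then 1 else 0)"
  unfolding skew_unit_def vector_minus_component axis_def
  by (cases "k = i"; cases "l = j"; cases "k = j"; cases "l = i") simp_all

lemma inner_skew_unit: "P \<bullet> skew_unit i j = P $ i $ j - P $ j $ i"
  by (simp add: skew_unit_def inner_diff_right inner_axis)

lemma antisymmetric_nth: "antisymmetric P \<longleftrightarrow> (\<forall>i j. P $ j $ i = - P $ i $ j)"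
  by (simp add: antisymmetric_def vec_eq_iff transpose_def)

lemma antisymmetric_skew_unit: "antisymmetric (skew_unit i j)"
  unfolding antisymmetric_nth skew_unit_nth minus_diff_eq
  by (intro allI arg_cong2[of _ _ _ _ "(-)"]) (simp_all only: conj_commute)

lemma subspace_antisymmetric: "subspace {P :: real^'n^'n. antisymmetric P}"
proof -
  have "transpose (0 :: real^'n^'n) = 0" by (simp add: transpose_def vec_eq_iff)
  then show ?thesis
    by (auto simp: subspace_def antisymmetric_def transpose_add transpose_scalar)
qed

lemma dim_antisymmetric: "dim {P :: real^'n^'n. antisymmetric P} = CARD('n) * (CARD('n) - 1) div 2"
proof -
  \<comment> \<open>An injection into \<open>nat\<close> serves as a linear order of the index type,
    selecting one of \<open>(i, j)\<close> and \<open>(j, i)\<close>.\<close>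
  obtain f :: "'n \<Rightarrow> nat" where f: "inj f"
    using finite_imp_inj_to_nat_seg[OF finite_class.finite_UNIV] by blast
  define I where "I = {(i, j). f i < f j}"
  define E where "E = (\<lambda>(i, j). skew_unit i j) ` I"
  have orth: "skew_unit k l \<bullet> skew_unit i j = (if (i, j) = (k, l) then 2 else 0)"
    if "(i, j) \<in> I" "(k, l) \<in> I" for i j k l
  proof -
    have lt: "f i < f j" "f k < f l" using that by (simp_all add: I_def)
    then have ne: "i \<noteq> j" by blast
    show ?thesis
    proof (cases "i = k \<and> j = l")
      case True
      then show ?thesis using ne by (simp add: inner_skew_unit skew_unit_nth)
    next
      case False
      moreover have "\<not> (i = l \<and> j = k)" using lt by (metis less_asym)
      ultimately have "skew_unit k l $ i $ j = 0" "skew_unit k l $ j $ i = 0"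
        unfolding skew_unit_nth by (simp_all only: if_not_P conj_commute diff_self)
      then show ?thesis using False by (simp add: inner_skew_unit)
    qed
  qed
  have inj: "inj_on (\<lambda>(i, j). skew_unit i j) I"
  proof (rule inj_onI, clarify)
    fix i j k l assume "(i, j) \<in> I" "(k, l) \<in> I" "skew_unit i j = skew_unit k l"
    then show "i = k \<and> j = l"
      using orth[of i j k l] orth[of i j i j] by (auto split: if_splits)
  qed
  have "independent E"
  proof (rule pairwise_orthogonal_independent)
    show "pairwise orthogonal E"
      by (auto simp: pairwise_def E_def orthogonal_def orth)
    have "skew_unit i j \<noteq> 0" if "(i, j) \<in> I" for i j
      using orth[OF that that] by auto
    then show "0 \<notin> E" by (force simp: E_def)
  qed
  moreover have "E \<subseteq> {P. antisymmetric P}" by (auto simp: E_def antisymmetric_skew_unit)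
  moreover have "P \<in> span E" if P: "antisymmetric P" for P
  proof -
    have "P = (\<Sum>(i, j)\<in>I. P $ i $ j *\<^sub>R skew_unit i j)"
    proof (intro vec_eq_iff[THEN iffD2] allI)
      fix k l
      \<comment> \<open>At most one of \<open>(k, l)\<close> and \<open>(l, k)\<close> lies in
        \<open>I\<close>. Both are recorded as indicator terms, and antisymmetry of \<open>P\<close>
        reconciles the sign.\<close>
      have "(\<Sum>(i, j)\<in>I. P $ i $ j *\<^sub>R skew_unit i j) $ k $ l
          = (\<Sum>p\<in>I. (if p = (k, l) then P $ k $ l else 0) - (if p = (l, k) then P $ l $ k else 0))"
        unfolding sum_component
      proof (intro sum.cong refl)
        fix p assume "p \<in> I"
        then obtain a b where p: "p = (a, b)" "a \<noteq> b" by (auto simp: I_def)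
        show "(case p of (i, j) \<Rightarrow> P $ i $ j *\<^sub>R skew_unit i j) $ k $ l
            = (if p = (k, l) then P $ k $ l else 0) - (if p = (l, k) then P $ l $ k else 0)"
        proof -
          consider "(k, l) = (a, b)" | "(k, l) = (b, a)" | "(a, b) \<noteq> (k, l)" "(a, b) \<noteq> (l, k)"
            by blast
          then show ?thesis
          proof cases
            case 3
            then have ne: "\<not> (k = a \<and> l = b)" "\<not> (k = b \<and> l = a)" by blast+
            have "skew_unit a b $ k $ l = 0"
              unfolding skew_unit_nth if_not_P[OF ne(1)] if_not_P[OF ne(2)] by simp
            then show ?thesis using p 3 by (simp only: prod.case vector_scaleR_component) simp
          qed (use p in \<open>simp_all add: skew_unit_nth\<close>)
        qed
      qed
      also have "\<dots> = (if f k < f l then P $ k $ l else 0) - (if f l < f k then P $ l $ k else 0)"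
        by (simp add: sum_subtractf I_def)
      also have "\<dots> = P $ k $ l"
      proof -
        have "P $ l $ k = - P $ k $ l" "P $ k $ k + P $ k $ k = 0"
          using P unfolding antisymmetric_nth by (blast, metis add.right_inverse)
        then show ?thesis
          using injD[OF f, of k l] by (cases "f k" "f l" rule: linorder_cases) auto
      qed
      finally show "P $ k $ l = (\<Sum>(i, j)\<in>I. P $ i $ j *\<^sub>R skew_unit i j) $ k $ l" ..
    qed
    also have "\<dots> \<in> span E"
    proof (intro span_sum)
      fix p assume "p \<in> I"
      then have "(\<lambda>(i, j). skew_unit i j) p \<in> span E" by (intro span_base) (simp add: E_def)
      then show "(case p of (i, j) \<Rightarrow> P $ i $ j *\<^sub>R skew_unit i j) \<in> span E"
        by (simp add: prod.case_eq_if span_scale)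
    qed
    finally show ?thesis .
  qed
  ultimately have "dim {P :: real^'n^'n. antisymmetric P} = card E"
    by (intro dim_unique) auto
  also have "card E = card I" by (simp add: E_def card_image[OF inj])
  also have "card I = CARD('n) * (CARD('n) - 1) div 2"
  proof -
    \<comment> \<open>All pairs split into \<open>I\<close>, its mirror image and the
      diagonal.\<close>
    define I' where "I' = {(i, j). f j < f i}"
    define I0 where "I0 = range (\<lambda>i :: 'n. (i, i))"
    have "(i, j) \<in> I \<union> (I' \<union> I0)" for i j
      using injD[OF f, of i j]
      by (cases "f i" "f j" rule: linorder_cases) (simp_all add: I_def I'_def I0_def)
    then have "(UNIV :: ('n \<times> 'n) set) = I \<union> (I' \<union> I0)" by auto
    then have "CARD('n \<times> 'n) = card (I \<union> (I' \<union> I0))" by simp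
    also have "\<dots> = card I + card (I' \<union> I0)"
      by (rule card_Un_disjoint) (auto simp: I_def I'_def I0_def)
    also have "card (I' \<union> I0) = card I' + card I0"
      by (rule card_Un_disjoint) (auto simp: I'_def I0_def)
    also have "card I' = card I"
    proof -
      have "I' = prod.swap ` I" by (auto simp: I_def I'_def)
      then show ?thesis by (simp add: card_image)
    qed
    also have "card I0 = CARD('n)" by (simp add: I0_def card_image inj_on_def)
    finally have "CARD('n) * CARD('n) = 2 * card I + CARD('n)" by simp
    then have "CARD('n) * (CARD('n) - 1) = 2 * card I" by (simp add: diff_mult_distrib2)
    then show ?thesis by simp
  qed
  finally show ?thesis .
qed

lemma aff_dim_drift_family:
  fixes S K :: "real^'n^'n"
  assumes S: "symmetric_posdef S"
  shows "aff_dim (drift_family S K) = int (CARD('n) * (CARD('n) - 1) div 2)"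
proof -
  let ?f = "\<lambda>P :: real^'n^'n. P ** matrix_inv S"
  have "drift_family S K = (+) (gradient_part S K) ` ?f ` {P. antisymmetric P}"
    by (auto simp: drift_family_def gradient_part_def matrix_mult.add_left matrix_mult_scaleR_left image_image)
  moreover have "linear ?f" by (rule bounded_linear.linear[OF matrix_mult.bounded_linear_left])
  moreover have "inj ?f" by (rule injI) (metis posdef_mult_inv_right(2)[OF S])
  ultimately show ?thesis
    using aff_dim_subspace[OF subspace_antisymmetric[where 'n = 'n]]
    by (simp add: aff_dim_translation_eq dim_antisymmetric)
qed

text \<open>At an extremal ratio \<open>c = u'Du / u'Su\<close> one has \<open>D u = c S u\<close>, so \<open>0 = u'(A D + D A')u = c u'Ku\<close>.\<close>
lemma lyapunov_homogeneous_nonpos: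
  fixes A S K D :: "real^'n^'n"
  assumes S: "symmetric_posdef S" and K: "symmetric_posdef K" and A: "lyapunov A S K"
    and D: "transpose D = D" "lyapunov A D 0"
  shows "w \<bullet> (D *v w) \<le> 0"
proof -
  obtain u c where u: "u \<noteq> 0" "u \<bullet> (D *v u) = c * (u \<bullet> (S *v u))"
    "\<And>w. w \<bullet> (D *v w) \<le> c * (w \<bullet> (S *v w))"
    using extremal_ratio[OF S] by blast
  have "(c *\<^sub>R S - D) *v u = 0"
    by (rule psd_kernel)
      (use u posdef_symmetric[OF S] D(1) in \<open>simp_all add: transpose_diff transpose_scalar
        matrix_vector_mult_diff_rdistrib matrix_vector_mult_scaleR_left inner_diff_right\<close>)
  then have "D *v u = c *\<^sub>R (S *v u)"
    by (simp add: matrix_vector_mult_diff_rdistrib matrix_vector_mult_scaleR_left)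
  then have "u \<bullet> ((A ** D) *v u) = c * (u \<bullet> ((A ** S) *v u))"
    by (simp add: matrix_vector_mul_assoc[symmetric] matrix_vector_mult_scaleR)
  then have "c * (u \<bullet> (K *v u)) = 0"
    by (simp add: lyapunov_quadratic[OF A posdef_symmetric[OF S]] lyapunov_quadratic[OF D(2,1)])
  then have "c = 0" using posdef_positive[OF K u(1)] by simp
  then show ?thesis using u(3)[of w] by simp
qed

text \<open>The sign bound applies to \<open>V - S\<close> and to \<open>S - V\<close>, so the form
  of the difference vanishes, and by symmetry so does the matrix.\<close>

lemma lyapunov_unique:
  fixes A S K D :: "real^'n^'n"
  assumes S: "symmetric_posdef S" and K: "symmetric_posdef K" and A: "lyapunov A S K"
    and V: "transpose V = V" "lyapunov A V K"
  shows "V = S"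
proof -
  have 1: "transpose (V - S) = V - S" "transpose (S - V) = S - V"
    using posdef_symmetric[OF S] V(1) by (simp_all add: transpose_diff)
  have "lyapunov A (V - S) 0" "lyapunov A (S - V) 0"
    using A V(2) by (simp_all add: lyapunov_def matrix_mult.diff_left matrix_mult.diff_right algebra_simps)
  from lyapunov_homogeneous_nonpos[OF S K A 1(1) this(1)] lyapunov_homogeneous_nonpos[OF S K A 1(2) this(2)]
  have "w \<bullet> ((V - S) *v w) = 0" for w
    by (intro antisym) (simp_all add: matrix_vector_mult_diff_rdistrib inner_diff_right)
  from quadratic_form_zero[OF 1(1) this] show ?thesis by simp
qed

section \<open>Factorization of a positive semidefinite matrix\<close>

lemma matrix_vector_mult_axis: "K *v axis i 1 = column i K" for K :: "real^'n^'m"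
  by (simp add: matrix_vector_mult_basis)

text \<open>Cholesky elimination, by induction on a set \<open>I\<close> of indices carrying all
  nonzero rows. \<open>T\<close> has no columns outside \<open>I\<close>, so a new pivot column can
  be inserted without disturbing the others.\<close>

lemma psd_factor_aux:
  fixes K :: "real^'n^'n"
  assumes "finite I" "transpose K = K" "\<And>v. 0 \<le> v \<bullet> (K *v v)" "\<And>i j. i \<notin> I \<Longrightarrow> K $ i $ j = 0"
  shows "\<exists>T. K = T ** transpose T \<and> (\<forall>i j. j \<notin> I \<longrightarrow> T $ i $ j = 0)"
  using assms
proof (induction I arbitrary: K rule: finite_induct)
  case empty
  then have "K = 0" by (simp add: vec_eq_iff)
  then show ?case by (intro exI[of _ 0]) (simp add: matrix_mult.zero_left)
next
  case (insert p I)
  have sym: "K $ j $ i = K $ i $ j" for i j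
    using arg_cong[OF insert.prems(1), of "\<lambda>M. M $ i $ j"] by (simp add: transpose_def)
  define k where "k = K $ p $ p"
  have Kp: "K *v axis p 1 = column p K" by (rule matrix_vector_mult_axis)
  have kform: "axis p 1 \<bullet> (K *v axis p 1) = k"
    by (simp add: Kp inner_axis' column_def k_def)
  have "0 \<le> k" using insert.prems(2)[of "axis p 1"] by (simp add: kform)
  show ?case
  proof (cases "k = 0")
    case True
    then have "column p K = 0"
      using psd_kernel[OF insert.prems(1,2)] kform Kp by metis
    then have "K $ p $ j = 0" for j using sym[of p j] by (simp add: column_def vec_eq_iff)
    then have "K $ i $ j = 0" if "i \<notin> I" for i j using insert.prems(3)[of i j] that by (cases "i = p") auto
    from insert.IH[OF insert.prems(1,2) this] show ?thesis by blast
  next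
    case False
    then have "0 < k" using \<open>0 \<le> k\<close> by simp
    \<comment> \<open>The Schur complement: row and column \<open>p\<close> are eliminated by
      completing the square.\<close>
    define K' :: "real^'n^'n" where "K' = (\<chi> a b. K $ a $ b - K $ a $ p * K $ b $ p / k)"
    have K'form: "x \<bullet> (K' *v x) = x \<bullet> (K *v x) - (x \<bullet> column p K)\<^sup>2 / k" for x
    proof -
      have "K' *v x = K *v x - ((x \<bullet> column p K) / k) *\<^sub>R column p K"
        by (simp add: vec_eq_iff matrix_vector_mult_def K'_def column_def inner_vec_def
            right_diff_distrib sum_subtractf sum_divide_distrib sum_distrib_left mult_ac)
      then show ?thesis by (simp add: inner_diff_right power2_eq_square)
    qed
    have "\<exists>T. K' = T ** transpose T \<and> (\<forall>i j. j \<notin> I \<longrightarrow> T $ i $ j = 0)"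
    proof (rule insert.IH)
      show "transpose K' = K'" using sym by (simp add: K'_def transpose_def vec_eq_iff mult.commute)
      show "0 \<le> x \<bullet> (K' *v x)" for x
      proof -
        define s where "s = x \<bullet> column p K"
        \<comment> \<open>The multiple \<open>- s / k\<close> minimizes the form of \<open>K\<close>
          along \<open>axis p 1\<close>; the minimum is the form of \<open>K'\<close>.\<close>
        have "0 \<le> (x + (- s / k) *\<^sub>R axis p 1) \<bullet> (K *v (x + (- s / k) *\<^sub>R axis p 1))"
          by (rule insert.prems(2))
        also have "\<dots> = x \<bullet> (K *v x) + 2 * (- s / k) * s + (- s / k)\<^sup>2 * k"
          unfolding quadratic_expand[OF insert.prems(1)] kform
          using inner_symmetric_matrix[OF insert.prems(1), of "axis p 1" x] by (simp add: Kp s_def)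
        also have "\<dots> = x \<bullet> (K' *v x)"
          using \<open>0 < k\<close> by (simp add: K'form s_def[symmetric] field_simps power2_eq_square)
        finally show ?thesis .
      qed
      show "K' $ i $ j = 0" if "i \<notin> I" for i j
        using insert.prems(3)[of i] that sym[of p j] \<open>0 < k\<close> by (cases "i = p") (auto simp: K'_def k_def)
    qed
    then obtain T' where T': "K' = T' ** transpose T'" "\<And>i j. j \<notin> I \<Longrightarrow> T' $ i $ j = 0" by blast
    define T :: "real^'n^'n" where
      "T = (\<chi> a b. if b = p then K $ a $ p / sqrt k else T' $ a $ b)"
    have "(T ** transpose T) $ a $ b = K $ a $ b" for a b
    proof -
      have "(T ** transpose T) $ a $ b
          = (\<Sum>c\<in>UNIV. T' $ a $ c * T' $ b $ c + (if c = p then K $ a $ p * K $ b $ p / k else 0))"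
        unfolding matrix_matrix_mult_def vec_lambda_beta transpose_def
        by (intro sum.cong refl) (use \<open>0 < k\<close> T'(2)[OF insert.hyps(2)] in \<open>auto simp: T_def\<close>)
      also have "\<dots> = K' $ a $ b + K $ a $ p * K $ b $ p / k"
        by (simp add: sum.distrib T'(1)) (simp add: matrix_matrix_mult_def transpose_def)
      finally show ?thesis by (simp add: K'_def)
    qed
    then have "K = T ** transpose T" by (simp add: vec_eq_iff)
    moreover have "T $ i $ j = 0" if "j \<notin> insert p I" for i j using that T'(2) by (simp add: T_def)
    ultimately show ?thesis by blast
  qed
qed

lemma psd_factor:
  fixes K :: "real^'n^'n"
  assumes "transpose K = K" "\<And>v. 0 \<le> v \<bullet> (K *v v)"
  obtains T :: "real^'n^'n" where "K = T ** transpose T"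
  using psd_factor_aux[of UNIV K] assms by auto

section \<open>The flow of a drift matrix\<close>

text \<open>The product rule puts \<open>B ** S + S ** transpose B\<close> in the middle. Thus the
  innovation integrand has an explicit antiderivative, which gives the innovation covariance a
  closed form.\<close>

lemma sandwich_has_vector_derivative:
  fixes B S K :: "real^'n^'n"
  assumes "lyapunov B S K"
  shows "((\<lambda>s. flow B s ** S ** transpose (flow B s)) has_vector_derivative
    - (flow B s ** K ** transpose (flow B s))) (at s within T)"
proof -
  let ?E = "\<lambda>s. flow B s"
  have E: "(?E has_vector_derivative - (?E s ** B)) (at s within T)"
    using matrix_exp_minus_has_vector_derivative[of B s T] matrix_exp_commute[of B "- s"] by simp
  have "((\<lambda>s. ?E s ** S ** transpose (?E s)) has_vector_derivative
      ?E s ** S ** transpose (- (?E s ** B)) + (- (?E s ** B)) ** S ** transpose (?E s)) (at s within T)"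
    by (intro matrix_mult_has_vector_derivative E
        bounded_linear.has_vector_derivative[OF matrix_mult.bounded_linear_left]
        bounded_linear.has_vector_derivative[OF bounded_linear_transpose])
  moreover have "?E s ** S ** transpose (- (?E s ** B)) + (- (?E s ** B)) ** S ** transpose (?E s)
      = - (?E s ** (B ** S + S ** transpose B) ** transpose (?E s))"
    by (simp add: transpose_minus matrix_transpose_mul matrix_mult.minus_left matrix_mult.minus_right
        matrix_mult.add_left matrix_mult.add_right matrix_mul_assoc)
  ultimately show ?thesis using assms by (simp add: lyapunov_def)
qed

lemma has_integral_innovation:
  fixes B S K :: "real^'n^'n"
  assumes "lyapunov B S K" "0 \<le> h"
  shows "((\<lambda>s. flow B s ** K ** transpose (flow B s)) has_integral
    S - flow B h ** S ** transpose (flow B h)) {0..h}"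
  using fundamental_theorem_of_calculus[OF assms(2), OF
      has_vector_derivative_minus[OF sandwich_has_vector_derivative[OF assms(1)]]]
  by simp

lemma ou_innovation_cov_eq:
  fixes B S K :: "real^'n^'n"
  assumes "lyapunov B S K" "0 \<le> h"
  shows "ou_innovation_cov B K h
    = S - flow B h ** S ** transpose (flow B h)"
  using has_integral_innovation[OF assms] by (simp add: ou_innovation_cov_def integral_unique)

lemma bounded_linear_quadratic: "bounded_linear (\<lambda>M :: real^'n^'n. u \<bullet> (M *v u))"
  by (intro linear_conv_bounded_linear[THEN iffD1] linearI)
     (simp_all add: matrix_vector_mult_add_rdistrib inner_add_right matrix_vector_mult_scaleR_left)

text \<open>Symmetry is read off the closed form, positivity off the integral of nonnegative
  forms.\<close>

lemma ou_innovation_cov_psd: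
  fixes B S K :: "real^'n^'n"
  assumes B: "lyapunov B S K" and S: "symmetric_posdef S" and K: "symmetric_posdef K" and h: "0 \<le> h"
  shows "transpose (ou_innovation_cov B K h) = ou_innovation_cov B K h"
    and "0 \<le> u \<bullet> (ou_innovation_cov B K h *v u)"
proof -
  show "transpose (ou_innovation_cov B K h) = ou_innovation_cov B K h"
    by (simp add: ou_innovation_cov_eq[OF B h] transpose_diff matrix_transpose_mul posdef_symmetric[OF S]
        matrix_mul_assoc)
  have "((\<lambda>s. u \<bullet> ((flow B s ** K ** transpose (flow B s)) *v u))
      has_integral u \<bullet> (ou_innovation_cov B K h *v u)) {0..h}"
    using has_integral_linear[OF has_integral_innovation[OF B h] bounded_linear_quadratic]
    by (simp add: o_def ou_innovation_cov_eq[OF B h])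
  then show "0 \<le> u \<bullet> (ou_innovation_cov B K h *v u)"
    by (rule has_integral_nonneg) (simp add: inner_sandwich posdef_nonneg[OF K] del: transpose_matrix_vector)
qed

lemma gronwall_decay:
  fixes q k :: "real \<Rightarrow> real"
  assumes deriv: "\<And>s. (q has_real_derivative - k s) (at s)" and ck: "\<And>s. c * q s \<le> k s" and "0 \<le> h"
  shows "q h \<le> q 0 * exp (- c * h)"
proof -
  have "exp (c * h) * q h \<le> exp (c * 0) * q 0"
  proof (rule DERIV_nonpos_imp_nonincreasing[OF assms(3)])
    fix s
    have "((\<lambda>h. exp (c * h) * q h) has_real_derivative exp (c * s) * (c * q s - k s)) (at s)"
      by (auto intro!: derivative_eq_intros deriv simp: algebra_simps)
    moreover have "exp (c * s) * (c * q s - k s) \<le> 0"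
      using ck[of s] by (intro mult_nonneg_nonpos) simp_all
    ultimately show "\<exists>y. ((\<lambda>h. exp (c * h) * q h) has_real_derivative y) (at s) \<and> y \<le> 0" by blast
  qed
  then show ?thesis by (simp add: exp_minus field_simps)
qed

text \<open>The form of \<open>S\<close> along the transposed flow has as derivative minus the form
  of \<open>K\<close>, which dominates \<open>c\<close> times the former. This gives exponential
  decay at rate \<open>c\<close>.\<close>

lemma sandwich_decay:
  fixes B S K :: "real^'n^'n"
  assumes B: "lyapunov B S K" and S: "symmetric_posdef S" and K: "symmetric_posdef K"
  shows "((\<lambda>h. u \<bullet> ((flow B h ** S ** transpose (flow B h)) *v u)) \<longlongrightarrow> 0) at_top"
    (is "(?q \<longlongrightarrow> 0) at_top")
proof -
  let ?k = "\<lambda>h. u \<bullet> ((flow B h ** K ** transpose (flow B h)) *v u)"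
  obtain c where c: "0 < c" "\<And>w. c * (w \<bullet> (S *v w)) \<le> w \<bullet> (K *v w)"
    using posdef_lower_bound[OF K S] by blast
  have ck: "c * ?q h \<le> ?k h" for h
    unfolding inner_sandwich by (rule c(2))
  have q0: "0 \<le> ?q h" for h
    unfolding inner_sandwich by (rule posdef_nonneg[OF S])
  have deriv: "(?q has_real_derivative - ?k h) (at h)" for h
    using bounded_linear.has_vector_derivative[OF bounded_linear_quadratic[of u]
        sandwich_has_vector_derivative[OF B, of h UNIV]]
    unfolding has_real_derivative_iff_has_vector_derivative matrix_vector_mult_minus_left inner_minus_right .
  have bound: "?q h \<le> ?q 0 * exp (- c * h)" if "0 \<le> h" for h
    by (rule gronwall_decay[OF deriv ck that])
  have "((\<lambda>h. ?q 0 * exp (- c * h)) \<longlongrightarrow> 0) at_top"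
  proof (rule tendsto_mult_right_zero)
    have "filterlim (\<lambda>h. - c * h) at_bot at_top"
      using c(1) by (intro filterlim_tendsto_neg_mult_at_bot[OF tendsto_const]) (simp_all add: filterlim_ident)
    then show "((\<lambda>h. exp (- c * h)) \<longlongrightarrow> 0) at_top"
      by (rule filterlim_compose[OF exp_at_bot])
  qed
  then show ?thesis
    by (rule tendsto_sandwich[rotated 3, where f = "\<lambda>_. 0"])
      (use q0 bound in \<open>auto intro!: eventually_at_top_linorderI[of 0]\<close>)
qed

lemma ou_innovation_cov_tendsto:
  fixes B S K :: "real^'n^'n"
  assumes B: "lyapunov B S K" and S: "symmetric_posdef S" and K: "symmetric_posdef K"
  shows "((\<lambda>h. u \<bullet> (ou_innovation_cov B K h *v u)) \<longlongrightarrow> u \<bullet> (S *v u)) at_top"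
proof -
  have "((\<lambda>h. u \<bullet> (S *v u) - u \<bullet> ((flow B h ** S ** transpose (flow B h)) *v u))
      \<longlongrightarrow> u \<bullet> (S *v u) - 0) at_top"
    by (intro tendsto_diff tendsto_const sandwich_decay[OF B S K])
  moreover have "\<forall>\<^sub>F h in at_top. u \<bullet> (S *v u)
      - u \<bullet> ((flow B h ** S ** transpose (flow B h)) *v u)
      = u \<bullet> (ou_innovation_cov B K h *v u)"
    using eventually_ge_at_top[of 0]
    by eventually_elim
      (simp add: ou_innovation_cov_eq[OF B] matrix_vector_mult_diff_rdistrib inner_diff_right)
  ultimately show ?thesis by (simp add: tendsto_cong)
qed

lemma flow_decay:
  fixes B S K :: "real^'n^'n"
  assumes B: "lyapunov B S K" and S: "symmetric_posdef S" and K: "symmetric_posdef K"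
  shows "((\<lambda>h. transpose (flow B h) *v u) \<longlongrightarrow> 0) at_top"
proof -
  let ?y = "\<lambda>h. transpose (flow B h) *v u"
  obtain c where c: "0 < c" "\<And>w. c * (w \<bullet> (mat 1 *v w)) \<le> w \<bullet> (S *v w)"
    using posdef_lower_bound[OF S mat_1_posdef] by blast
  have "((\<lambda>h. ?y h \<bullet> ?y h) \<longlongrightarrow> 0) at_top"
  proof (rule tendsto_sandwich[of "\<lambda>_. 0"])
    show "((\<lambda>h. (1 / c) * (?y h \<bullet> (S *v ?y h))) \<longlongrightarrow> 0) at_top"
      using tendsto_mult_right_zero[OF sandwich_decay[OF B S K], of "1 / c" u]
      unfolding inner_sandwich .
    show "\<forall>\<^sub>F h in at_top. ?y h \<bullet> ?y h \<le> (1 / c) * (?y h \<bullet> (S *v ?y h))"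
      using c by (intro always_eventually allI) (simp add: field_simps del: transpose_matrix_vector)
  qed simp_all
  then have "((\<lambda>h. sqrt (?y h \<bullet> ?y h)) \<longlongrightarrow> sqrt 0) at_top" by (rule tendsto_real_sqrt)
  then show ?thesis
    by (simp add: norm_eq_sqrt_inner[symmetric] tendsto_norm_zero_iff)
qed

section \<open>Symmetry of the autocovariance\<close>

text \<open>Once the Lyapunov equation is inserted, the circulation is half of
  \<open>A ** S - S ** transpose A\<close>.\<close>

lemma circulation_zero_iff:
  assumes "lyapunov A S K"
  shows "circulation A S K = 0 \<longleftrightarrow> A ** S = S ** transpose A"
proof -
  have "K = A ** S + S ** transpose A" using assms by (simp add: lyapunov_def)
  then have "circulation A S K = (1/2) *\<^sub>R (A ** S - S ** transpose A)"
    by (simp add: circulation_def vec_eq_iff field_simps)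
  then show ?thesis by simp
qed

lemma autocov_symmetric:
  fixes A S :: "real^'n^'n"
  assumes "transpose S = S" "A ** S = S ** transpose A"
  shows "transpose (matrix_exp (t *\<^sub>R A) ** S) = matrix_exp (t *\<^sub>R A) ** S"
proof -
  have "S ** matrix_exp (t *\<^sub>R transpose A) = matrix_exp (t *\<^sub>R A) ** S"
    by (rule matrix_exp_intertwine) (simp add: matrix_mult_scaleR_left matrix_mult_scaleR_right assms(2))
  then show ?thesis
    by (simp add: matrix_transpose_mul assms(1) transpose_matrix_exp transpose_scalar)
qed

text \<open>Comparing derivatives at lag 0 makes \<open>A ** S\<close> symmetric. Only
  \<open>h \<ge> 0\<close> is available, hence the one-sided derivatives on
  \<open>{0..1}\<close>.\<close>

lemma autocov_symmetric_imp:
  fixes A S :: "real^'n^'n"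
  assumes S: "transpose S = S"
    and sym: "\<And>h. 0 \<le> h \<Longrightarrow> transpose (flow A h ** S) = flow A h ** S"
  shows "A ** S = S ** transpose A"
proof -
  let ?f = "\<lambda>h. flow A h ** S"
  have f: "(?f has_vector_derivative - (A ** S)) (at 0 within {0..1})"
    using bounded_linear.has_vector_derivative[OF matrix_mult.bounded_linear_left
        matrix_exp_minus_has_vector_derivative[of A 0 "{0..1}"], of S]
    by (simp add: matrix_mult.minus_left)
  have "((\<lambda>h. transpose (?f h)) has_vector_derivative transpose (- (A ** S))) (at 0 within {0..1})"
    by (rule bounded_linear.has_vector_derivative[OF bounded_linear_transpose f])
  then have "(?f has_vector_derivative transpose (- (A ** S))) (at 0 within {0..1})"
    by (rule has_vector_derivative_transform[rotated 2]) (use sym in auto)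
  with f have "transpose (- (A ** S)) = - (A ** S)"
    by (intro vector_derivative_unique_within_closed_interval[of 0 1 0 ?f]) (auto simp: cbox_interval)
  then show ?thesis by (simp add: transpose_minus matrix_transpose_mul S)
qed

lemma sampling_bound_strip:
  fixes A :: "real^'n^'n"
  assumes "sampling_bound A \<Delta>" "0 < \<Delta>" "l \<in> eigenvalues (cmatrix ((- \<Delta>) *\<^sub>R A))"
  shows "- pi < Im l \<and> Im l < pi"
proof -
  obtain k where k: "k \<in> eigenvalues (cmatrix A)" "l = of_real (- \<Delta>) * k"
    using assms(2,3) eigenvalues_scaleR[of l "- \<Delta>" "cmatrix A"] unfolding cmatrix_scaleR by auto
  have "\<bar>Im k\<bar> < pi / \<Delta>" using k(1) assms(1) by (auto simp: sampling_bound_def)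
  then have "\<bar>\<Delta> * Im k\<bar> < pi" using assms(2) by (simp add: abs_mult field_simps)
  then show ?thesis by (simp add: k(2)) linarith
qed

lemma sampled_flow_inj:
  fixes A B :: "real^'n^'n"
  assumes "0 < \<Delta>" "sampling_bound A \<Delta>" "sampling_bound B \<Delta>"
    and "flow A \<Delta> = flow B \<Delta>"
  shows "A = B"
proof -
  have "cmatrix ((- \<Delta>) *\<^sub>R A) = cmatrix ((- \<Delta>) *\<^sub>R B)"
  proof (rule matrix_exp_inj_strip)
    show "matrix_exp (cmatrix ((- \<Delta>) *\<^sub>R A)) = matrix_exp (cmatrix ((- \<Delta>) *\<^sub>R B))"
      by (simp only: cmatrix_matrix_exp[symmetric] assms(4))
  qed (use sampling_bound_strip[OF assms(2,1)] sampling_bound_strip[OF assms(3,1)] in \<open>simp_all\<close>)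
  then show ?thesis using assms(1) by (simp only: cmatrix_eq_iff) simp
qed

lemma sampled_autocov_symmetric_imp:
  fixes A S :: "real^'n^'n"
  assumes S: "symmetric_posdef S" and \<Delta>: "0 < \<Delta>" and bound: "sampling_bound A \<Delta>"
    and sym: "transpose (flow A \<Delta> ** S) = flow A \<Delta> ** S"
  shows "A ** S = S ** transpose A"
proof -
  \<comment> \<open>This is the drift of the time-reversed system; symmetry at lag
    \<open>\<Delta>\<close> says that both drifts have the same sampled flow.\<close>
  define B where "B = S ** transpose A ** matrix_inv S"
  have BS: "S ** transpose A = B ** S" by (simp add: B_def posdef_mult_inv_right[OF S])
  have "S ** flow (transpose A) \<Delta> = flow B \<Delta> ** S"
    by (rule matrix_exp_intertwine) (simp add: matrix_mult_scaleR_left matrix_mult_scaleR_right BS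
        matrix_mult.minus_left matrix_mult.minus_right)
  then have "flow A \<Delta> ** S = flow B \<Delta> ** S"
    using sym by (simp add: matrix_transpose_mul posdef_symmetric[OF S] transpose_matrix_exp
        transpose_minus transpose_scalar)
  then have eq: "flow A \<Delta> = flow B \<Delta>"
    by (simp only: posdef_mult_right_cancel[OF S])
  have "invertible (cmatrix S)"
    unfolding invertible_def
    by (intro exI[of _ "cmatrix (matrix_inv S)"]) (simp add: cmatrix_mult[symmetric] posdef_inverse[OF S])
  moreover have "cmatrix S ** transpose (cmatrix A) = cmatrix B ** cmatrix S"
  proof -
    have "transpose (cmatrix A) = cmatrix (transpose A)" by (simp add: transpose_def vec_eq_iff)
    then show ?thesis by (simp only: cmatrix_mult[symmetric] BS)
  qed
  ultimately have "eigenvalues (cmatrix B) \<subseteq> eigenvalues (cmatrix A)"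
    using eigenvalues_similar_subset eigenvalues_transpose by metis
  then have "sampling_bound B \<Delta>" using bound by (auto simp: sampling_bound_def)
  from sampled_flow_inj[OF \<Delta> bound this eq] show ?thesis using BS by simp
qed

section \<open>Full turns\<close>

text \<open>By cyclicity and anticommutation the trace of \<open>J ** S ** J\<close> equals minus
  itself, so \<open>transpose J ** S ** J\<close> has trace 0. That trace is the sum of the forms of
  \<open>S\<close> at the columns of \<open>J\<close>.\<close>

lemma skew_commutator_zero:
  fixes J S :: "real^'n^'n"
  assumes S: "symmetric_posdef S" and J: "antisymmetric J" and JS: "J ** S = - (S ** J)"
  shows "J = 0"
proof -
  have "trace (J ** (S ** J)) = trace (S ** J ** J)" by (rule trace_mul_sym)
  moreover have "J ** (S ** J) = - (S ** J ** J)"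
    by (simp add: matrix_mul_assoc JS matrix_mult.minus_left)
  ultimately have "trace (transpose J ** S ** J) = 0"
    using J by (simp add: antisymmetric_def matrix_mult.minus_left matrix_mul_assoc)
      (simp add: trace_def sum_negf)
  moreover have "trace (transpose J ** S ** J) = (\<Sum>i\<in>UNIV. (J *v axis i 1) \<bullet> (S *v (J *v axis i 1)))"
  proof -
    have "(transpose J ** S ** J) $ i $ i = axis i 1 \<bullet> ((transpose J ** S ** J) *v axis i 1)" for i
      by (simp add: matrix_vector_mult_axis inner_axis' column_def)
    also have "axis i 1 \<bullet> ((transpose J ** S ** J) *v axis i 1) = (J *v axis i 1) \<bullet> (S *v (J *v axis i 1))" for i
      using inner_sandwich[of "axis i 1" "transpose J" S] by (simp del: transpose_matrix_vector)
    finally show ?thesis by (simp add: trace_def)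
  qed
  ultimately have "(J *v axis i 1) \<bullet> (S *v (J *v axis i 1)) = 0" for i
    using sum_nonneg_eq_0_iff[of UNIV "\<lambda>i. (J *v axis i 1) \<bullet> (S *v (J *v axis i 1))"] posdef_nonneg[OF S]
    by simp
  then have "J *v axis i 1 = 0" for i
    using psd_kernel[OF posdef_symmetric[OF S] posdef_nonneg[OF S]] posdef_positive[OF S] by force
  then show "J = 0" by (simp add: matrix_vector_mult_axis column_def vec_eq_iff)
qed

text \<open>For \<open>A = c + w J\<close>, symmetry of \<open>A ** S\<close> reduces to
  \<open>w (J S + S J) = 0\<close>, and \<open>w\<close> is nonzero because
  \<open>w * \<Delta> = 2 * pi\<close>.\<close>

lemma full_turn_circulation_nonzero:
  fixes A S K :: "real^'n^'n"
  assumes S: "symmetric_posdef S" and A: "lyapunov A S K" and turn: "full_turn_drift A \<Delta>"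
  shows "circulation A S K \<noteq> 0"
proof
  assume "circulation A S K = 0"
  then have sym: "A ** S = S ** transpose A" by (simp add: circulation_zero_iff[OF A])
  obtain c w J where J: "w * \<Delta> = 2 * pi" "rotation_generator J" "A = c *\<^sub>R mat 1 + w *\<^sub>R J"
    using turn unfolding full_turn_drift_def by blast
  have anti: "antisymmetric J" and "J \<noteq> 0" using J(2) by (auto simp: rotation_generator_def)
  have "J ** S = - (S ** J) \<or> w = 0"
    using sym anti by (simp add: J(3) transpose_add transpose_scalar antisymmetric_def
        matrix_mult.add_left matrix_mult.add_right matrix_mult_scaleR_left matrix_mult_scaleR_right
        matrix_mult.minus_left matrix_mult.minus_right)
  moreover have "w \<noteq> 0" using J(1) by auto
  ultimately have "J ** S = - (S ** J)" by blast
  then have "J = 0" by (rule skew_commutator_zero[OF S anti])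
  then show False using \<open>J \<noteq> 0\<close> by simp
qed

lemma scaleR_mat_1: "c *\<^sub>R mat 1 = (mat c :: real^'n^'n)"
  by (simp add: mat_def vec_eq_iff)

lemma matrix_exp_full_turns:
  fixes J :: "real^'n^'n"
  assumes "matrix_exp ((2 * pi) *\<^sub>R J) = mat 1"
  shows "matrix_exp ((- (real k * (2 * pi))) *\<^sub>R J) = mat 1"
proof -
  have "matrix_exp ((real k * (2 * pi)) *\<^sub>R J) = mat 1"
  proof (induction k)
    case (Suc k)
    have "matrix_exp ((real (Suc k) * (2 * pi)) *\<^sub>R J)
        = matrix_exp ((real k * (2 * pi)) *\<^sub>R J) ** matrix_exp ((2 * pi) *\<^sub>R J)"
      unfolding matrix_exp_add_scaleR[symmetric] by (simp add: algebra_simps)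
    then show ?case by (simp only: Suc assms matrix_mul_lid)
  qed simp
  then show ?thesis
    using matrix_exp_minus_mult[of "(real k * (2 * pi)) *\<^sub>R J"] by simp
qed

lemma full_turn_autocov_symmetric:
  fixes A S :: "real^'n^'n"
  assumes S: "transpose S = S" and turn: "full_turn_drift A \<Delta>"
  shows "transpose (flow A (real k * \<Delta>) ** S) = flow A (real k * \<Delta>) ** S"
proof -
  obtain c w J where J: "w * \<Delta> = 2 * pi" "matrix_exp ((2 * pi) *\<^sub>R J) = mat 1" "A = c *\<^sub>R mat 1 + w *\<^sub>R J"
    using turn unfolding full_turn_drift_def rotation_generator_def by blast
  have "(- (real k * \<Delta>)) *\<^sub>R A = (- (real k * (w * \<Delta>))) *\<^sub>R J + mat (- (real k * \<Delta>) * c)"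
    unfolding J(3) scaleR_mat_1[of "- (real k * \<Delta>) * c", symmetric] by (simp add: algebra_simps)
  then have "flow A (real k * \<Delta>) = mat (exp (- (real k * \<Delta>) * c))"
    by (simp only: J(1) matrix_exp_add_mat matrix_exp_full_turns[OF J(2)] matrix_mul_rid)
  then show ?thesis
    by (simp only: scaleR_mat_1[of "exp _", symmetric] matrix_mult_scaleR_left matrix_mul_lid transpose_scalar S)
qed

lemma skew_unit_mult_nth:
  "(skew_unit i j ** X) $ a $ b = (if a = i then X $ j $ b else 0) - (if a = j then X $ i $ b else 0)"
proof -
  have "(skew_unit i j ** X) $ a $ b
      = (\<Sum>c\<in>UNIV. (if c = j then (if a = i then X $ c $ b else 0) else 0)
          - (if c = i then (if a = j then X $ c $ b else 0) else 0))"
    unfolding matrix_matrix_mult_def vec_lambda_beta skew_unit_nth left_diff_distrib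
    by (intro sum.cong refl arg_cong2[of _ _ _ _ "(-)"]) simp_all
  then show ?thesis by (simp add: sum_subtractf)
qed

lemma rotation_generator_skew_unit:
  assumes "i \<noteq> j"
  shows "rotation_generator (skew_unit i j :: real^'n^'n)"
proof -
  define J :: "real^'n^'n" where "J = skew_unit i j"
  have cube: "J ** (J ** J) = - J"
    using assms by (simp add: vec_eq_iff J_def skew_unit_mult_nth skew_unit_nth)
  \<comment> \<open>Rodrigues' rotation formula. It solves the equation because
    \<open>J ** (J ** J) = - J\<close>, and at \<open>2 * pi\<close> it returns to
    \<open>mat 1\<close>.\<close>
  define X where "X t = mat 1 + sin t *\<^sub>R J + (1 - cos t) *\<^sub>R (J ** J)" for t
  have "(X has_vector_derivative J ** X t) (at t)" for t
  proof -
    have "(X has_vector_derivative cos t *\<^sub>R J + sin t *\<^sub>R (J ** J)) (at t)"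
      unfolding X_def by (auto intro!: derivative_eq_intros)
    moreover have "J ** X t = cos t *\<^sub>R J + sin t *\<^sub>R (J ** J)"
      by (simp add: X_def matrix_mult.add_right matrix_mult.diff_right
          matrix_mult_scaleR_right cube scaleR_left_diff_distrib)
    ultimately show ?thesis by simp
  qed
  from matrix_ode_unique[OF convex_UNIV UNIV_I this UNIV_I, of "2 * pi"]
  have "matrix_exp ((2 * pi) *\<^sub>R J) = mat 1" by (simp add: X_def)
  moreover have "J $ i $ j = 1" using assms by (simp add: J_def skew_unit_nth)
  then have "J \<noteq> 0" by auto
  ultimately show ?thesis
    using antisymmetric_skew_unit[of i j] by (simp add: rotation_generator_def J_def)
qed

text \<open>With \<open>c = 1\<close> and \<open>J\<close> antisymmetric, \<open>A\<close> plus its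
  transpose is twice the identity, which explains the pair \<open>mat 1\<close>,
  \<open>2 *\<^sub>R mat 1\<close>. Two coordinates are required to have a plane to rotate.\<close>

lemma full_turn_drift_exists:
  assumes "2 \<le> CARD('n)" "0 < \<Delta>"
  obtains A :: "real^'n^'n" where "full_turn_drift A \<Delta>" "lyapunov A (mat 1) (2 *\<^sub>R mat 1)"
proof -
  have "\<not> card (UNIV :: 'n set) \<le> Suc 0" using assms(1) by simp
  then obtain i j :: 'n where ij: "i \<noteq> j"
    using card_le_Suc0_iff_eq[OF finite_class.finite_UNIV] by blast
  define J :: "real^'n^'n" where "J = skew_unit i j"
  define A where "A = 1 *\<^sub>R mat 1 + (2 * pi / \<Delta>) *\<^sub>R J"
  have "full_turn_drift A \<Delta>"
    unfolding full_turn_drift_def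
    by (rule exI[of _ 1], rule exI[of _ "2 * pi / \<Delta>"], rule exI[of _ J])
      (use assms(2) rotation_generator_skew_unit[OF ij] in \<open>simp add: A_def J_def\<close>)
  moreover have "lyapunov A (mat 1) (2 *\<^sub>R mat 1)"
    using antisymmetric_skew_unit[of i j]
    by (simp add: lyapunov_def A_def J_def[symmetric] transpose_add transpose_scalar antisymmetric_def scaleR_2)
  ultimately show thesis by (rule that)
qed

section \<open>Joint laws are determined by linear functionals\<close>

lemma (in prob_space) integrable_bounded:
  fixes f :: "'a \<Rightarrow> 'b::{banach, second_countable_topology}"
  assumes "f \<in> borel_measurable M" "\<And>\<omega>. norm (f \<omega>) \<le> B"
  shows "integrable M f"
  using integrable_const_bound[of f B] assms by auto

text \<open>The weight divided by its mean is a probability density, under which the characteristic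
  function of \<open>X\<close> is the weighted Fourier integral over \<open>m\<close>. This brings
  weighted integrals within reach of Levy's theorem.\<close>

lemma (in prob_space) weighted_law:
  fixes X w :: "'a \<Rightarrow> real"
  assumes X [measurable]: "X \<in> borel_measurable M" and w [measurable]: "w \<in> borel_measurable M"
    and w0: "\<And>\<omega>. 0 \<le> w \<omega>" and wc: "\<And>\<omega>. w \<omega> \<le> c"
    and m: "m = (\<integral>\<omega>. w \<omega> \<partial>M)" "0 < m"
  obtains L where "real_distribution L"
    "\<And>t. char L t = (CLINT \<omega>|M. w \<omega> * iexp (t * X \<omega>)) / m"
    "\<And>A. A \<in> sets borel \<Longrightarrow> measure L A * m = (\<integral>\<omega>. w \<omega> * indicator A (X \<omega>) \<partial>M)"
proof -
  define D where "D = density M (\<lambda>\<omega>. ennreal (w \<omega> / m))"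
  have [measurable_cong, simp]: "sets D = sets M" by (simp add: D_def)
  have int_w: "integrable M w" by (rule integrable_bounded[where B = c]) (use w0 wc in auto)
  have "emeasure D (space D) = (\<integral>\<^sup>+\<omega>. ennreal (w \<omega> / m) \<partial>M)"
    by (simp add: D_def emeasure_density cong: nn_integral_cong)
  also have "\<dots> = ennreal (\<integral>\<omega>. w \<omega> / m \<partial>M)"
    by (rule nn_integral_eq_integral) (use int_w w0 m(2) in auto)
  also have "\<dots> = 1" using m by simp
  finally interpret D: prob_space D by (rule prob_spaceI)
  define L where "L = distr D borel X"
  interpret L: real_distribution L
    unfolding L_def by (rule D.real_distribution_distr) simp
  show thesis
  proof
    show "real_distribution L" ..
    show "char L t = (CLINT \<omega>|M. w \<omega> * iexp (t * X \<omega>)) / m" for t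
    proof -
      have "char L t = (CLINT \<omega>|D. iexp (t * X \<omega>))"
        unfolding char_def L_def by (rule integral_distr) simp_all
      also have "\<dots> = (CLINT \<omega>|M. (w \<omega> / m) *\<^sub>R iexp (t * X \<omega>))"
        unfolding D_def by (rule integral_density) (use w0 m(2) in auto)
      also have "\<dots> = (CLINT \<omega>|M. (w \<omega> * iexp (t * X \<omega>)) / m)"
        by (simp add: scaleR_conv_of_real)
      finally show ?thesis by simp
    qed
    fix A :: "real set" assume A [measurable]: "A \<in> sets borel"
    have "measure L A = (\<integral>x. indicator A x \<partial>L)" by simp
    also have "\<dots> = (\<integral>\<omega>. indicator A (X \<omega>) \<partial>D)"
      unfolding L_def by (rule integral_distr) simp_all
    also have "\<dots> = (\<integral>\<omega>. (w \<omega> / m) *\<^sub>R indicator A (X \<omega>) \<partial>M)"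
      unfolding D_def by (rule integral_density) (use w0 m(2) in auto)
    finally show "measure L A * m = (\<integral>\<omega>. w \<omega> * indicator A (X \<omega>) \<partial>M)"
      using m(2) by simp
  qed
qed

text \<open>At \<open>t = 0\<close> the hypothesis equates the total masses, so one normalization
  serves both sides. Mass 0 cannot be normalized, but then both integrals are 0.\<close>

lemma Levy_uniqueness_weighted:
  fixes X w :: "'a \<Rightarrow> real" and Y v :: "'b \<Rightarrow> real"
  assumes "prob_space M" "prob_space N"
    and X [measurable]: "X \<in> borel_measurable M" and w [measurable]: "w \<in> borel_measurable M"
    and Y [measurable]: "Y \<in> borel_measurable N" and v [measurable]: "v \<in> borel_measurable N"
    and w0: "\<And>\<omega>. 0 \<le> w \<omega>" and wc: "\<And>\<omega>. w \<omega> \<le> c"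
    and v0: "\<And>\<omega>. 0 \<le> v \<omega>" and vc: "\<And>\<omega>. v \<omega> \<le> c"
    and char: "\<And>t. (CLINT \<omega>|M. w \<omega> * iexp (t * X \<omega>)) = (CLINT \<omega>|N. v \<omega> * iexp (t * Y \<omega>))"
    and A [measurable]: "A \<in> sets borel"
  shows "(\<integral>\<omega>. w \<omega> * indicator A (X \<omega>) \<partial>M) = (\<integral>\<omega>. v \<omega> * indicator A (Y \<omega>) \<partial>N)"
proof -
  interpret M: prob_space M by fact
  interpret N: prob_space N by fact
  define m where "m = (\<integral>\<omega>. w \<omega> \<partial>M)"
  have mN: "m = (\<integral>\<omega>. v \<omega> \<partial>N)"
  proof -
    have "complex_of_real m = complex_of_real (\<integral>\<omega>. v \<omega> \<partial>N)"
      using char[of 0] unfolding m_def integral_complex_of_real[symmetric] by simp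
    then show ?thesis by (simp only: of_real_eq_iff)
  qed
  have int_w: "integrable M w" by (rule M.integrable_bounded[where B = c]) (use w0 wc in auto)
  have int_v: "integrable N v" by (rule N.integrable_bounded[where B = c]) (use v0 vc in auto)
  have "0 \<le> m" unfolding m_def using w0 by simp
  show ?thesis
  proof (cases "m = 0")
    case True
    have "0 \<le> c" using w0 wc order_trans by blast
    then have ints: "integrable M (\<lambda>\<omega>. w \<omega> * indicator A (X \<omega>))" "integrable N (\<lambda>\<omega>. v \<omega> * indicator A (Y \<omega>))"
      using w0 wc v0 vc
      by (auto intro!: M.integrable_bounded[where B = c] N.integrable_bounded[where B = c] split: split_indicator)
    have "0 \<le> (\<integral>\<omega>. w \<omega> * indicator A (X \<omega>) \<partial>M)" "0 \<le> (\<integral>\<omega>. v \<omega> * indicator A (Y \<omega>) \<partial>N)"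
      using w0 v0 by (auto intro!: integral_nonneg)
    moreover have "(\<integral>\<omega>. w \<omega> * indicator A (X \<omega>) \<partial>M) \<le> (\<integral>\<omega>. w \<omega> \<partial>M)"
      by (rule integral_mono[OF ints(1) int_w]) (use w0 in \<open>auto split: split_indicator\<close>)
    moreover have "(\<integral>\<omega>. v \<omega> * indicator A (Y \<omega>) \<partial>N) \<le> (\<integral>\<omega>. v \<omega> \<partial>N)"
      by (rule integral_mono[OF ints(2) int_v]) (use v0 in \<open>auto split: split_indicator\<close>)
    ultimately show ?thesis using True mN by (simp add: m_def)
  next
    case False
    then have "0 < m" using \<open>0 \<le> m\<close> by simp
    obtain L where L: "real_distribution L"
      "\<And>t. char L t = (CLINT \<omega>|M. w \<omega> * iexp (t * X \<omega>)) / m"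
      "\<And>A. A \<in> sets borel \<Longrightarrow> measure L A * m = (\<integral>\<omega>. w \<omega> * indicator A (X \<omega>) \<partial>M)"
      using M.weighted_law[OF X w w0 wc m_def \<open>0 < m\<close>] by blast
    obtain L' where L': "real_distribution L'"
      "\<And>t. char L' t = (CLINT \<omega>|N. v \<omega> * iexp (t * Y \<omega>)) / m"
      "\<And>A. A \<in> sets borel \<Longrightarrow> measure L' A * m = (\<integral>\<omega>. v \<omega> * indicator A (Y \<omega>) \<partial>N)"
      using N.weighted_law[OF Y v v0 vc mN \<open>0 < m\<close>] by blast
    have "L = L'" by (rule Levy_uniqueness) (use L(1,2) L'(1,2) char in \<open>auto simp: fun_eq_iff\<close>)
    then show ?thesis using L(3)[OF A] L'(3)[OF A] by simp
  qed
qed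

lemma iexp_eq_cos_sin: "iexp x = of_real (cos x) + \<i> * of_real (sin x)"
  by (simp add: exp_eq_polar cis_conv_exp[symmetric] complex_eq_iff)

lemma cos_iexp: "complex_of_real (cos x) = (iexp x + iexp (- x)) / 2"
  unfolding iexp_eq_cos_sin by simp

lemma sin_iexp: "complex_of_real (sin x) = - \<i> * (iexp x - iexp (- x)) / 2"
  unfolding iexp_eq_cos_sin by simp

lemma iexp_linear:
  "iexp (0 * \<theta> + x) = iexp x" "iexp (1 * \<theta> + x) = iexp \<theta> * iexp x"
  "iexp ((- 1) * \<theta> + x) = iexp (- \<theta>) * iexp x"
  by (simp_all add: exp_add[symmetric] algebra_simps)

lemma integral_linear_combination:
  fixes f g h :: "'a \<Rightarrow> complex"
  assumes "integrable M f" "integrable M g" "integrable M h"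
  shows "(CLINT x|M. f x + c * g x + d * h x) = (CLINT x|M. f x) + c * (CLINT x|M. g x) + d * (CLINT x|M. h x)"
  using assms by simp

lemma norm_iexp [simp]: "norm (iexp x) = 1"
  by (simp add: norm_exp_i_times)

text \<open>The signed weights \<open>cos \<theta>\<close> and \<open>sin \<theta>\<close> are made positive by adding \<open>1\<close>, so that one coordinate
  can be localized by Levy's theorem for positive measures.\<close>
lemma localize_coordinate:
  fixes X \<theta> Z :: "'a \<Rightarrow> real" and Y \<eta> W :: "'b \<Rightarrow> real"
  assumes M: "prob_space M" and N: "prob_space N"
    and X [measurable]: "X \<in> borel_measurable M" "\<theta> \<in> borel_measurable M" "Z \<in> borel_measurable M"
    and Y [measurable]: "Y \<in> borel_measurable N" "\<eta> \<in> borel_measurable N" "W \<in> borel_measurable N"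
    and Z: "\<And>\<omega>. 0 \<le> Z \<omega>" "\<And>\<omega>. Z \<omega> \<le> 1" and W: "\<And>\<omega>. 0 \<le> W \<omega>" "\<And>\<omega>. W \<omega> \<le> 1"
    and char: "\<And>s t. (CLINT \<omega>|M. Z \<omega> * iexp (s * \<theta> \<omega> + t * X \<omega>)) = (CLINT \<omega>|N. W \<omega> * iexp (s * \<eta> \<omega> + t * Y \<omega>))"
    and A [measurable]: "A \<in> sets borel"
  shows "(CLINT \<omega>|M. of_real (Z \<omega> * indicator A (X \<omega>)) * iexp (\<theta> \<omega>))
    = (CLINT \<omega>|N. of_real (W \<omega> * indicator A (Y \<omega>)) * iexp (\<eta> \<omega>))"
proof -
  interpret M: prob_space M by fact
  interpret N: prob_space N by fact
  have intM: "integrable M (\<lambda>\<omega>. of_real (Z \<omega>) * iexp (s * \<theta> \<omega> + t * X \<omega>))" for s t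
    by (rule M.integrable_bounded[where B = 1]) (use Z in \<open>simp_all add: norm_mult\<close>)
  have intN: "integrable N (\<lambda>\<omega>. of_real (W \<omega>) * iexp (s * \<eta> \<omega> + t * Y \<omega>))" for s t
    by (rule N.integrable_bounded[where B = 1]) (use W in \<open>simp_all add: norm_mult\<close>)
  have one: "(\<integral>\<omega>. Z \<omega> * indicator A (X \<omega>) \<partial>M) = (\<integral>\<omega>. W \<omega> * indicator A (Y \<omega>) \<partial>N)"
    by (rule Levy_uniqueness_weighted[OF M N, where c = 1]) (use Z W char[of 0] in auto)
  have weight: "0 \<le> z * (1 + cos x)" "z * (1 + cos x) \<le> 2" "0 \<le> z * (1 + sin x)" "z * (1 + sin x) \<le> 2"
    if "0 \<le> z" "z \<le> 1" for z x :: real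
    using that mult_mono[of z 1 "1 + cos x" 2] mult_mono[of z 1 "1 + sin x" 2]
      cos_ge_minus_one[of x] cos_le_one[of x] sin_ge_minus_one[of x] sin_le_one[of x]
    by (auto intro!: mult_nonneg_nonneg simp del: sin_ge_minus_one cos_ge_minus_one)
  have cos_expand: "z * (1 + (a + b) / 2) * e = z * e + (1/2) * (z * (a * e)) + (1/2) * (z * (b * e))"
    and sin_expand: "z * (1 + - \<i> * (a - b) / 2) * e
      = z * e + (- \<i> / 2) * (z * (a * e)) + (\<i> / 2) * (z * (b * e))" for z a b e :: complex
    by (simp_all add: field_simps)
  have cos: "(\<integral>\<omega>. (Z \<omega> * (1 + cos (\<theta> \<omega>))) * indicator A (X \<omega>) \<partial>M)
      = (\<integral>\<omega>. (W \<omega> * (1 + cos (\<eta> \<omega>))) * indicator A (Y \<omega>) \<partial>N)"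
  proof (rule Levy_uniqueness_weighted[OF M N, where c = 2])
    \<comment> \<open>Written in exponentials, the weight needs the hypothesis \<open>char\<close>
      only at the frequencies \<open>s = 0\<close>, \<open>1\<close> and \<open>-1\<close>.\<close>
    have expand: "complex_of_real (z * (1 + cos \<theta>)) * iexp (t * x)
      = of_real z * iexp (0 * \<theta> + t * x) + (1/2) * (of_real z * iexp (1 * \<theta> + t * x))
        + (1/2) * (of_real z * iexp ((- 1) * \<theta> + t * x))" for z \<theta> x t
      unfolding iexp_linear unfolding of_real_mult of_real_add of_real_1 cos_iexp by (rule cos_expand)
    show "(CLINT \<omega>|M. of_real (Z \<omega> * (1 + cos (\<theta> \<omega>))) * iexp (t * X \<omega>))
        = (CLINT \<omega>|N. of_real (W \<omega> * (1 + cos (\<eta> \<omega>))) * iexp (t * Y \<omega>))" for t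
      unfolding expand integral_linear_combination[OF intM intM intM]
        integral_linear_combination[OF intN intN intN] char ..
  qed (simp_all add: weight Z W)
  have sin: "(\<integral>\<omega>. (Z \<omega> * (1 + sin (\<theta> \<omega>))) * indicator A (X \<omega>) \<partial>M)
      = (\<integral>\<omega>. (W \<omega> * (1 + sin (\<eta> \<omega>))) * indicator A (Y \<omega>) \<partial>N)"
  proof (rule Levy_uniqueness_weighted[OF M N, where c = 2])
    have expand: "complex_of_real (z * (1 + sin \<theta>)) * iexp (t * x)
      = of_real z * iexp (0 * \<theta> + t * x) + (- \<i> / 2) * (of_real z * iexp (1 * \<theta> + t * x))
        + (\<i> / 2) * (of_real z * iexp ((- 1) * \<theta> + t * x))" for z \<theta> x t
      unfolding iexp_linear unfolding of_real_mult of_real_add of_real_1 sin_iexp by (rule sin_expand)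
    show "(CLINT \<omega>|M. of_real (Z \<omega> * (1 + sin (\<theta> \<omega>))) * iexp (t * X \<omega>))
        = (CLINT \<omega>|N. of_real (W \<omega> * (1 + sin (\<eta> \<omega>))) * iexp (t * Y \<omega>))" for t
      unfolding expand integral_linear_combination[OF intM intM intM]
        integral_linear_combination[OF intN intN intN] char ..
  qed (simp_all add: weight Z W)
  \<comment> \<open>The added constants are taken off again: \<open>exp (i \<theta>) = (1 + cos
    \<theta>) + i (1 + sin \<theta>) - (1 + i)\<close>.\<close>
  have split: "of_real (z * a) * iexp \<theta> = of_real ((z * (1 + cos \<theta>)) * a)
      + \<i> * of_real ((z * (1 + sin \<theta>)) * a) + (- (1 + \<i>)) * of_real ((z * 1) * a)" for z a \<theta>
    by (simp add: iexp_eq_cos_sin algebra_simps)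
  have bnd: "norm (complex_of_real (z * f * indicator A x)) \<le> 2" if "0 \<le> z" "z \<le> 1" "\<bar>f\<bar> \<le> 2" for z f x
  proof -
    have "\<bar>z * f\<bar> \<le> 1 * 2" unfolding abs_mult using that by (intro mult_mono) auto
    then show ?thesis by (simp add: norm_mult abs_mult split: split_indicator)
  qed
  have le2: "\<bar>1 + cos x\<bar> \<le> 2" "\<bar>1 + sin x\<bar> \<le> 2" for x :: real
    using cos_ge_minus_one[of x] cos_le_one[of x] sin_ge_minus_one[of x] sin_le_one[of x] by linarith+
  have I: "integrable M (\<lambda>\<omega>. complex_of_real (Z \<omega> * 1 * indicator A (X \<omega>)))"
    "integrable M (\<lambda>\<omega>. complex_of_real (Z \<omega> * (1 + cos (\<theta> \<omega>)) * indicator A (X \<omega>)))"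
    "integrable M (\<lambda>\<omega>. complex_of_real (Z \<omega> * (1 + sin (\<theta> \<omega>)) * indicator A (X \<omega>)))"
    "integrable N (\<lambda>\<omega>. complex_of_real (W \<omega> * 1 * indicator A (Y \<omega>)))"
    "integrable N (\<lambda>\<omega>. complex_of_real (W \<omega> * (1 + cos (\<eta> \<omega>)) * indicator A (Y \<omega>)))"
    "integrable N (\<lambda>\<omega>. complex_of_real (W \<omega> * (1 + sin (\<eta> \<omega>)) * indicator A (Y \<omega>)))"
    by (intro M.integrable_bounded[where B = 2] N.integrable_bounded[where B = 2] bnd Z W le2; simp)+
  show ?thesis
    unfolding split integral_linear_combination[OF I(2,3,1)] integral_linear_combination[OF I(5,6,4)]
    unfolding integral_complex_of_real cos sin using one by simp
qed

lemma (in prob_space) prob_box: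
  assumes K: "finite K" and [measurable]: "\<And>k. X k \<in> borel_measurable M" "\<And>k. A k \<in> sets borel"
  shows "prob {\<omega> \<in> space M. \<forall>k\<in>K. X k \<omega> \<in> A k} = expectation (\<lambda>\<omega>. \<Prod>k\<in>K. indicator (A k) (X k \<omega> :: real))"
proof -
  have "{\<omega> \<in> space M. \<forall>k\<in>K. X k \<omega> \<in> A k} \<in> sets M" using K by measurable
  then have "prob {\<omega> \<in> space M. \<forall>k\<in>K. X k \<omega> \<in> A k}
      = expectation (indicator {\<omega> \<in> space M. \<forall>k\<in>K. X k \<omega> \<in> A k})" by simp
  also have "\<dots> = expectation (\<lambda>\<omega>. \<Prod>k\<in>K. indicator (A k) (X k \<omega>))"
    using K by (intro Bochner_Integration.integral_cong) (auto simp: indicator_def)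
  finally show ?thesis .
qed

text \<open>Coordinates are converted one at a time from Fourier factors to indicators; the product
  of the finished indicators is the weight in \<open>[0, 1]\<close> for the next use of
  \<open>localize_coordinate\<close>.\<close>

theorem joint_law_eqI:
  fixes X :: "'k \<Rightarrow> 'a \<Rightarrow> real" and Y :: "'k \<Rightarrow> 'b \<Rightarrow> real"
  assumes M: "prob_space M" and N: "prob_space N" and K: "finite K"
    and X [measurable]: "\<And>k. X k \<in> borel_measurable M" and Y [measurable]: "\<And>k. Y k \<in> borel_measurable N"
    and char: "\<And>u. (CLINT \<omega>|M. iexp (\<Sum>k\<in>K. u k * X k \<omega>)) = (CLINT \<omega>|N. iexp (\<Sum>k\<in>K. u k * Y k \<omega>))"
    and A: "\<And>k. A k \<in> sets borel"
  shows "measure M {\<omega> \<in> space M. \<forall>k\<in>K. X k \<omega> \<in> A k} = measure N {\<omega> \<in> space N. \<forall>k\<in>K. Y k \<omega> \<in> A k}"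
proof -
  interpret M: prob_space M by fact
  interpret N: prob_space N by fact
  note [measurable] = A
  have main: "(CLINT \<omega>|M. of_real (\<Prod>k\<in>I. indicator (A k) (X k \<omega>)) * iexp (\<Sum>k\<in>K - I. u k * X k \<omega>))
      = (CLINT \<omega>|N. of_real (\<Prod>k\<in>I. indicator (A k) (Y k \<omega>)) * iexp (\<Sum>k\<in>K - I. u k * Y k \<omega>))"
    if "I \<subseteq> K" for I u
    using finite_subset[OF that K] that
  proof (induction I arbitrary: u rule: finite_induct)
    case empty
    then show ?case using char[of u] by simp
  next
    case (insert i I)
    have [simp]: "finite (K - I)" using K by simp
    \<comment> \<open>Two free parameters sit in one frequency vector: \<open>s\<close> scales the
      coordinates still to come, \<open>t\<close> belongs to the coordinate \<open>i\<close> being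
      localized.\<close>
    have split: "(\<Sum>k\<in>K - I. ((\<lambda>k. s * u k)(i := t)) k * x k) = s * (\<Sum>k\<in>K - insert i I. u k * x k) + t * x i"
      for s t and x :: "'k \<Rightarrow> real"
    proof -
      have "(\<Sum>k\<in>K - I. ((\<lambda>k. s * u k)(i := t)) k * x k)
          = t * x i + (\<Sum>k\<in>(K - I) - {i}. ((\<lambda>k. s * u k)(i := t)) k * x k)"
        using insert.hyps insert.prems by (subst sum.remove[of _ i]) auto
      also have "(\<Sum>k\<in>(K - I) - {i}. ((\<lambda>k. s * u k)(i := t)) k * x k) = s * (\<Sum>k\<in>K - insert i I. u k * x k)"
        unfolding sum_distrib_left by (intro sum.cong) auto
      finally show ?thesis by simp
    qed
    have "(CLINT \<omega>|M. of_real ((\<Prod>k\<in>I. indicator (A k) (X k \<omega>)) * indicator (A i) (X i \<omega>)) * iexp (\<Sum>k\<in>K - insert i I. u k * X k \<omega>))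
      = (CLINT \<omega>|N. of_real ((\<Prod>k\<in>I. indicator (A k) (Y k \<omega>)) * indicator (A i) (Y i \<omega>)) * iexp (\<Sum>k\<in>K - insert i I. u k * Y k \<omega>))"
    proof (rule localize_coordinate[OF M N])
      show "(CLINT \<omega>|M. of_real (\<Prod>k\<in>I. indicator (A k) (X k \<omega>)) * iexp (s * (\<Sum>k\<in>K - insert i I. u k * X k \<omega>) + t * X i \<omega>))
          = (CLINT \<omega>|N. of_real (\<Prod>k\<in>I. indicator (A k) (Y k \<omega>)) * iexp (s * (\<Sum>k\<in>K - insert i I. u k * Y k \<omega>) + t * Y i \<omega>))" for s t
        using insert.IH[of "(\<lambda>k. s * u k)(i := t)"] insert.prems unfolding split by simp
    qed (auto intro!: prod_nonneg prod_le_1)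
    then show ?case using insert.hyps by (simp add: mult.commute)
  qed
  note M.prob_box[of K X A] N.prob_box[of K Y A]
  moreover have "complex_of_real (\<integral>\<omega>. (\<Prod>k\<in>K. indicator (A k) (X k \<omega>)) \<partial>M)
      = complex_of_real (\<integral>\<omega>. (\<Prod>k\<in>K. indicator (A k) (Y k \<omega>)) \<partial>N)"
    using main[of K] unfolding integral_complex_of_real[symmetric] by simp
  ultimately show ?thesis using K X Y A by (simp only: of_real_eq_iff)
qed

text \<open>Closed orthants \<open>{..a}\<close> are stable under intersection, generate the Borel
  sets and are boxes in coordinates, so \<open>joint_law_eqI\<close> decides them.\<close>

lemma vector_law_eqI:
  fixes \<mu> \<nu> :: "(real^'n) measure"
  assumes \<mu>: "prob_space \<mu>" "sets \<mu> = sets borel" and \<nu>: "prob_space \<nu>" "sets \<nu> = sets borel"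
    and char: "\<And>u. (CLINT z|\<mu>. iexp (u \<bullet> z)) = (CLINT z|\<nu>. iexp (u \<bullet> z))"
  shows "\<mu> = \<nu>"
proof -
  interpret \<mu>: prob_space \<mu> by fact
  interpret \<nu>: prob_space \<nu> by fact
  have space: "space \<mu> = UNIV" "space \<nu> = UNIV"
    using sets_eq_imp_space_eq[OF \<mu>(2)] sets_eq_imp_space_eq[OF \<nu>(2)] by simp_all
  have gen: "sets (borel :: (real^'n) measure) = sigma_sets UNIV (range (\<lambda>a. {..a}))"
    by (subst borel_eq_atMost) simp
  show ?thesis
  proof (rule measure_eqI_generator_eq[where A = "\<lambda>i. {.. (\<chi> j. real i)}" and \<Omega> = UNIV and E = "range (\<lambda>a. {..a})"])
    show "Int_stable (range (\<lambda>a :: real^'n. {..a}))"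
    proof -
      have "{..a} \<inter> {..b} = {..inf a b}" for a b :: "real^'n" by auto
      then show ?thesis by (auto simp: Int_stable_def)
    qed
    show "emeasure \<mu> B = emeasure \<nu> B" if B: "B \<in> range (\<lambda>a. {..a})" for B
    proof -
      obtain a where a: "B = {..a}" using B by auto
      have "measure \<mu> {z \<in> space \<mu>. \<forall>k\<in>UNIV. z $ k \<in> {..a $ k}} = measure \<nu> {z \<in> space \<nu>. \<forall>k\<in>UNIV. z $ k \<in> {..a $ k}}"
      proof (rule joint_law_eqI[OF \<mu>(1) \<nu>(1)])
        have "(\<Sum>k\<in>UNIV. u k * z $ k) = (\<chi> k. u k) \<bullet> z" for u and z :: "real^'n"
          by (simp add: inner_vec_def)
        then show "(CLINT \<omega>|\<mu>. iexp (\<Sum>k\<in>UNIV. u k * \<omega> $ k)) = (CLINT \<omega>|\<nu>. iexp (\<Sum>k\<in>UNIV. u k * \<omega> $ k))" for u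
          using char[of "\<chi> k. u k"] by simp
        have nth: "(\<lambda>z :: real^'n. z $ k) \<in> borel_measurable borel" for k
          by (intro borel_measurable_continuous_onI continuous_intros)
        show "(\<lambda>z. z $ k) \<in> borel_measurable \<mu>" "(\<lambda>z. z $ k) \<in> borel_measurable \<nu>" for k
          using nth[of k] by (simp_all add: measurable_cong_sets[OF \<mu>(2) refl] measurable_cong_sets[OF \<nu>(2) refl])
      qed auto
      moreover have "{z :: real^'n. \<forall>k\<in>UNIV. z $ k \<in> {..a $ k}} = B"
        by (auto simp: a less_eq_vec_def)
      ultimately show ?thesis
        by (simp add: space \<mu>.emeasure_eq_measure \<nu>.emeasure_eq_measure)
    qed
    show "(\<Union>i. {.. (\<chi> j. real i)}) = (UNIV :: (real^'n) set)"
    proof (intro set_eqI iffI UNIV_I)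
      fix z :: "real^'n"
      obtain i :: nat where "norm z \<le> real i" using real_arch_simple by blast
      then have "z $ j \<le> real i" for j using component_le_norm_cart[of z j] by (auto dest: abs_le_D1)
      then show "z \<in> (\<Union>i. {.. (\<chi> j. real i)})" by (auto simp: less_eq_vec_def)
    qed
  qed (auto simp: \<mu>(2) \<nu>(2) gen)
qed

section \<open>Normal laws\<close>

lemma sets_centred_normal [simp, measurable_cong]: "sets (centred_normal v) = sets borel"
  by (simp add: centred_normal_def)

lemma real_distribution_centred_normal:
  assumes "0 \<le> v"
  shows "real_distribution (centred_normal v)"
proof (intro real_distribution.intro real_distribution_axioms.intro)
  show "prob_space (centred_normal v)"
    using assms prob_space_normal_density[of "sqrt v" 0]
    by (auto simp: centred_normal_def intro: prob_space_return)
qed simp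

lemma centred_normal_moments:
  assumes "0 \<le> v"
  shows "integrable (centred_normal v) (\<lambda>x. x\<^sup>2)" "(\<integral>x. x\<^sup>2 \<partial>centred_normal v) = v"
    "integrable (centred_normal v) (\<lambda>x. x)" "(\<integral>x. x \<partial>centred_normal v) = 0"
proof -
  have "integrable (centred_normal v) (\<lambda>x. x\<^sup>2) \<and> (\<integral>x. x\<^sup>2 \<partial>centred_normal v) = v \<and>
    integrable (centred_normal v) (\<lambda>x. x) \<and> (\<integral>x. x \<partial>centred_normal v) = 0"
  proof (cases "v = 0")
    case True
    interpret prob_space "return borel (0 :: real)" by (rule prob_space_return) simp
    have "AE x in return borel (0 :: real). norm (x\<^sup>2) \<le> 0" by (subst AE_return) simp_all
    then have "integrable (return borel (0 :: real)) (\<lambda>x. x\<^sup>2)" by (rule integrable_const_bound) simp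
    moreover have "AE x in return borel (0 :: real). norm x \<le> 0" by (subst AE_return) simp_all
    then have "integrable (return borel (0 :: real)) (\<lambda>x. x)" by (rule integrable_const_bound) simp
    moreover have "(\<integral>x. x\<^sup>2 \<partial>return borel (0 :: real)) = 0\<^sup>2" by (rule integral_return) simp_all
    moreover have "(\<integral>x. x \<partial>return borel (0 :: real)) = 0" by (rule integral_return) simp_all
    moreover have "centred_normal v = return borel 0" using True by (simp add: centred_normal_def)
    ultimately show ?thesis using True by (simp only: power_zero_numeral simp_thms)
  next
    case False
    then have s: "0 < sqrt v" using assms by simp
    show ?thesis
      using False assms integrable_normal_moment[OF s, of 0 2] integral_normal_moment_even[OF s, of 0 1]
        integrable_normal_moment_nz_1[OF s, of 0] integral_normal_moment_nz_1[OF s, of 0]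
      by (simp add: centred_normal_def integrable_density integral_density)
  qed
  then show "integrable (centred_normal v) (\<lambda>x. x\<^sup>2)" "(\<integral>x. x\<^sup>2 \<partial>centred_normal v) = v"
    "integrable (centred_normal v) (\<lambda>x. x)" "(\<integral>x. x \<partial>centred_normal v) = 0" by auto
qed

lemma char_centred_normal:
  assumes "0 \<le> v"
  shows "char (centred_normal v) t = exp (- (t\<^sup>2 * v) / 2)"
proof (cases "v = 0")
  case True
  then show ?thesis by (simp add: char_def centred_normal_def integral_return)
next
  case False
  then have s: "0 < sqrt v" using assms by simp
  interpret std: prob_space std_normal_distribution by (rule prob_space_normal_density) simp
  have "distributed std_normal_distribution lborel (\<lambda>x. x) std_normal_density"
    by (auto simp: distributed_def intro!: distr_id2)
  from std.normal_density_affine[OF this, of "sqrt v" 0] s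
  have "distributed std_normal_distribution lborel (\<lambda>x. sqrt v * x) (normal_density 0 (sqrt v))"
    by simp
  then have "density lborel (\<lambda>x. ennreal (normal_density 0 (sqrt v) x))
      = distr std_normal_distribution lborel (\<lambda>x. sqrt v * x)"
    by (simp add: distributed_def)
  then have "char (centred_normal v) t = char std_normal_distribution (t * sqrt v)"
    using False by (simp add: char_def centred_normal_def integral_distr mult.assoc)
  then show ?thesis
    using assms by (simp add: char_std_normal_distribution power_mult_distrib exp_of_real)
qed

lemma inner_measurable [measurable]: "(\<lambda>z. u \<bullet> z) \<in> borel_measurable (borel :: (real^'n) measure)"
  by (intro borel_measurable_continuous_onI continuous_intros)

lemma vec_nth_measurable [measurable]: "(\<lambda>z. z $ i) \<in> borel_measurable (borel :: (real^'n) measure)"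
  by (intro borel_measurable_continuous_onI continuous_intros)

lemma matrix_vector_measurable [measurable]: "(\<lambda>z. T *v z) \<in> borel_measurable (borel :: (real^'n) measure)"
  for T :: "real^'n^'m"
  by (intro borel_measurable_continuous_onI linear_continuous_on) (simp add: linear_linear)

text \<open>The definition speaks only of linear functionals; the zero functional already reveals
  total mass 1.\<close>

lemma is_normal_law_prob_space:
  assumes "is_normal_law \<mu> V"
  shows "prob_space \<mu>"
proof -
  have s: "sets \<mu> = sets borel"
    and d: "distr \<mu> borel (\<lambda>z. 0 \<bullet> z) = centred_normal (0 \<bullet> (V *v 0))"
    using assms[unfolded is_normal_law_def] by blast+
  have "prob_space (distr \<mu> borel (\<lambda>z. 0 \<bullet> z))"
    using real_distribution_centred_normal[of 0] unfolding d by (simp add: real_distribution_def)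
  then show ?thesis
    by (rule prob_space_distrD[rotated])
      (unfold measurable_cong_sets[OF s refl], rule inner_measurable)
qed

lemma char_distr_inner:
  fixes \<mu> :: "(real^'n) measure"
  assumes "sets \<mu> = sets borel"
  shows "char (distr \<mu> borel (\<lambda>z. u \<bullet> z)) t = (CLINT z|\<mu>. iexp ((t *\<^sub>R u) \<bullet> z))"
proof -
  have "(\<lambda>z. u \<bullet> z) \<in> borel_measurable \<mu>"
    unfolding measurable_cong_sets[OF assms refl] by (rule inner_measurable)
  then have "char (distr \<mu> borel (\<lambda>z. u \<bullet> z)) t = (CLINT z|\<mu>. iexp (t * (u \<bullet> z)))"
    unfolding char_def by (rule integral_distr) simp
  then show ?thesis by simp
qed

lemma char_normal_law:
  assumes "is_normal_law \<mu> V" "\<And>v. 0 \<le> v \<bullet> (V *v v)"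
  shows "(CLINT z|\<mu>. iexp (u \<bullet> z)) = exp (- (u \<bullet> (V *v u)) / 2)"
proof -
  have "(CLINT z|\<mu>. iexp (u \<bullet> z)) = char (centred_normal (u \<bullet> (V *v u))) 1"
    using assms(1) char_distr_inner[of \<mu> u 1] by (simp add: is_normal_law_def)
  then show ?thesis by (simp add: char_centred_normal assms(2))
qed

lemma is_normal_lawI:
  fixes V :: "real^'n^'n"
  assumes "prob_space \<mu>" and s: "sets \<mu> = sets borel" and V: "\<And>v. 0 \<le> v \<bullet> (V *v v)"
    and char: "\<And>u. (CLINT z|\<mu>. iexp (u \<bullet> z)) = exp (- (u \<bullet> (V *v u)) / 2)"
  shows "is_normal_law \<mu> V"
  unfolding is_normal_law_def
proof (intro conjI allI s)
  fix u
  interpret prob_space \<mu> by fact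
  have meas: "(\<lambda>z. u \<bullet> z) \<in> borel_measurable \<mu>"
    unfolding measurable_cong_sets[OF s refl] by (rule inner_measurable)
  show "distr \<mu> borel (\<lambda>z. u \<bullet> z) = centred_normal (u \<bullet> (V *v u))"
  proof (rule Levy_uniqueness)
    show "char (distr \<mu> borel (\<lambda>z. u \<bullet> z)) = char (centred_normal (u \<bullet> (V *v u)))"
      by (simp only: fun_eq_iff char_distr_inner[OF s] char char_centred_normal[OF V] quadratic_scale simp_thms)
  qed (use meas V real_distribution_centred_normal in auto)
qed

lemma is_normal_law_unique:
  fixes \<mu> \<nu> :: "(real^'n) measure"
  assumes "is_normal_law \<mu> V" "is_normal_law \<nu> V" "\<And>v. 0 \<le> v \<bullet> (V *v v)"
  shows "\<mu> = \<nu>"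
proof (rule vector_law_eqI[OF is_normal_law_prob_space[OF assms(1)] _ is_normal_law_prob_space[OF assms(2)]])
  show "sets \<mu> = sets borel" "sets \<nu> = sets borel" using assms by (simp_all add: is_normal_law_def)
  show "(CLINT z|\<mu>. iexp (u \<bullet> z)) = (CLINT z|\<nu>. iexp (u \<bullet> z))" for u
    unfolding char_normal_law[OF assms(1,3)] char_normal_law[OF assms(2,3)] ..
qed

lemma is_normal_law_linear_image:
  fixes T :: "real^'n^'m"
  assumes "is_normal_law \<mu> V"
  shows "is_normal_law (distr \<mu> borel (\<lambda>z. T *v z)) (T ** V ** transpose T)"
  unfolding is_normal_law_def
proof (intro conjI allI)
  fix u
  have s [measurable_cong]: "sets \<mu> = sets borel" using assms by (simp add: is_normal_law_def)
  have "distr (distr \<mu> borel (\<lambda>z. T *v z)) borel (\<lambda>z. u \<bullet> z) = distr \<mu> borel (\<lambda>z. (transpose T *v u) \<bullet> z)"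
    by (subst distr_distr) (simp_all add: o_def inner_matrix_transpose del: transpose_matrix_vector)
  then show "distr (distr \<mu> borel (\<lambda>z. T *v z)) borel (\<lambda>z. u \<bullet> z) = centred_normal (u \<bullet> ((T ** V ** transpose T) *v u))"
    using assms by (simp only: is_normal_law_def inner_sandwich)
qed simp

text \<open>A factor \<open>T\<close> with \<open>V = T ** transpose T\<close> maps the standard
  normal law to the desired one. \<open>\<gamma>\<close> will come from a Brownian
  increment.\<close>

lemma normal_law_exists:
  fixes V :: "real^'n^'n"
  assumes G: "is_normal_law \<gamma> (mat 1 :: real^'n^'n)" and V: "transpose V = V" "\<And>v. 0 \<le> v \<bullet> (V *v v)"
  shows "\<exists>\<mu> :: (real^'n) measure. is_normal_law \<mu> V"
proof -
  obtain T :: "real^'n^'n" where "V = T ** transpose T" using psd_factor[OF V] .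
  then show ?thesis using is_normal_law_linear_image[OF G, of T] by auto
qed

lemma random_variable_moments:
  fixes X :: "'a \<Rightarrow> real"
  assumes [measurable]: "X \<in> borel_measurable M" and X: "distr M borel X = centred_normal v" and v: "0 \<le> v"
  shows "integrable M (\<lambda>\<omega>. (X \<omega>)\<^sup>2)" "(\<integral>\<omega>. (X \<omega>)\<^sup>2 \<partial>M) = v" "integrable M X" "(\<integral>\<omega>. X \<omega> \<partial>M) = 0"
proof -
  note m = centred_normal_moments[OF v, folded X]
  show "integrable M (\<lambda>\<omega>. (X \<omega>)\<^sup>2)"
    by (rule integrable_distr[OF assms(1) m(1)])
  show "(\<integral>\<omega>. (X \<omega>)\<^sup>2 \<partial>M) = v"
    using m(2) by (subst (asm) integral_distr[OF assms(1)]) simp_all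
  show "integrable M X"
    by (rule integrable_distr[OF assms(1) m(3)])
  show "(\<integral>\<omega>. X \<omega> \<partial>M) = 0"
    using m(4) by (subst (asm) integral_distr[OF assms(1)]) simp_all
qed

lemma abs_mult_le_sum_squares: "\<bar>a * b\<bar> \<le> a\<^sup>2 + b\<^sup>2" for a b :: real
  using sum_squares_bound[of "\<bar>a\<bar>" "\<bar>b\<bar>"] mult_nonneg_nonneg[of "\<bar>a\<bar>" "\<bar>b\<bar>"]
  unfolding abs_mult power2_abs mult.assoc by linarith

lemma integrable_mult_of_squares:
  fixes f g :: "'a \<Rightarrow> real"
  assumes [measurable]: "f \<in> borel_measurable M" "g \<in> borel_measurable M"
    and "integrable M (\<lambda>\<omega>. (f \<omega>)\<^sup>2)" "integrable M (\<lambda>\<omega>. (g \<omega>)\<^sup>2)"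
  shows "integrable M (\<lambda>\<omega>. f \<omega> * g \<omega>)"
proof (rule Bochner_Integration.integrable_bound)
  show "integrable M (\<lambda>\<omega>. (f \<omega>)\<^sup>2 + (g \<omega>)\<^sup>2)" using assms by simp
  show "AE \<omega> in M. norm (f \<omega> * g \<omega>) \<le> norm ((f \<omega>)\<^sup>2 + (g \<omega>)\<^sup>2)"
    using abs_mult_le_sum_squares by simp
qed simp

lemma gaussian_vector_moments:
  fixes X :: "'a \<Rightarrow> real^'n" and V :: "real^'n^'n"
  assumes [measurable]: "X \<in> borel_measurable M"
    and X: "\<And>u. distr M borel (\<lambda>\<omega>. u \<bullet> X \<omega>) = centred_normal (u \<bullet> (V *v u))"
    and V: "transpose V = V" "\<And>v. 0 \<le> v \<bullet> (V *v v)"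
  shows "integrable M (\<lambda>\<omega>. (X \<omega> $ i)\<^sup>2)" "integrable M (\<lambda>\<omega>. X \<omega> $ i)" "(\<integral>\<omega>. X \<omega> $ i \<partial>M) = 0"
    and "(\<integral>\<omega>. X \<omega> $ i * X \<omega> $ j \<partial>M) = V $ i $ j"
proof -
  have nth: "axis i 1 \<bullet> X \<omega> = X \<omega> $ i" for i \<omega> by (simp add: inner_axis')
  note m = random_variable_moments[OF _ X V(2)]
  have sq: "integrable M (\<lambda>\<omega>. (X \<omega> $ i)\<^sup>2)" for i
    using m(1)[of "axis i 1"] by (simp add: nth)
  then show "integrable M (\<lambda>\<omega>. (X \<omega> $ i)\<^sup>2)" .
  show "integrable M (\<lambda>\<omega>. X \<omega> $ i)" "(\<integral>\<omega>. X \<omega> $ i \<partial>M) = 0"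
    using m(3,4)[of "axis i 1"] by (simp_all add: nth)
  have prod: "integrable M (\<lambda>\<omega>. X \<omega> $ i * X \<omega> $ j)"
    by (rule integrable_mult_of_squares) (simp_all add: sq)
  have diag: "(\<integral>\<omega>. (X \<omega> $ i)\<^sup>2 \<partial>M) = V $ i $ i" for i
    using m(2)[of "axis i 1"] by (simp add: nth matrix_vector_mult_axis inner_axis' column_def)
  \<comment> \<open>Polarization: the mixed moment comes from the variance along
    \<open>axis i 1 + axis j 1\<close>.\<close>
  have "(\<integral>\<omega>. (X \<omega> $ i)\<^sup>2 + 2 * (X \<omega> $ i * X \<omega> $ j) + (X \<omega> $ j)\<^sup>2 \<partial>M)
      = (axis i 1 + 1 *\<^sub>R axis j 1) \<bullet> (V *v (axis i 1 + 1 *\<^sub>R axis j 1))"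
    using m(2)[of "axis i 1 + 1 *\<^sub>R axis j 1"]
    by (simp add: inner_add_left nth power2_sum algebra_simps)
  also have "\<dots> = V $ i $ i + 2 * V $ j $ i + V $ j $ j"
    unfolding quadratic_expand[OF V(1)] by (simp add: matrix_vector_mult_axis inner_axis' column_def)
  also have "V $ j $ i = V $ i $ j" using V(1) by (metis transpose_def vec_lambda_beta)
  finally show "(\<integral>\<omega>. X \<omega> $ i * X \<omega> $ j \<partial>M) = V $ i $ j"
    using sq[of i] sq[of j] prod by (simp add: diag)
qed

section \<open>Invariant laws of the transition semigroup\<close>

text \<open>Fubini on the product measure turns independence of state and innovation into a product
  of characteristic functions.\<close>

lemma char_transition:
  fixes E :: "real^'n^'n"
  assumes \<mu>: "prob_space \<mu>" "sets \<mu> = sets borel" and \<nu>: "prob_space \<nu>" "sets \<nu> = sets borel"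
  shows "(CLINT z|distr (\<mu> \<Otimes>\<^sub>M \<nu>) borel (\<lambda>(y, z). E *v y + z). iexp (u \<bullet> z))
    = (CLINT y|\<mu>. iexp ((transpose E *v u) \<bullet> y)) * (CLINT z|\<nu>. iexp (u \<bullet> z))"
proof -
  interpret \<mu>: prob_space \<mu> by fact
  interpret \<nu>: prob_space \<nu> by fact
  interpret pair_prob_space \<mu> \<nu> ..
  note [measurable_cong] = \<mu>(2) \<nu>(2)
  let ?f = "\<lambda>(y, z). iexp (u \<bullet> (E *v y + z))"
  have int: "integrable (\<mu> \<Otimes>\<^sub>M \<nu>) ?f"
    by (rule P.integrable_bounded[where B = 1]) (auto split: prod.split)
  have "(CLINT z|distr (\<mu> \<Otimes>\<^sub>M \<nu>) borel (\<lambda>(y, z). E *v y + z). iexp (u \<bullet> z)) = (CLINT p|\<mu> \<Otimes>\<^sub>M \<nu>. ?f p)"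
    by (subst integral_distr) (auto simp: case_prod_beta' intro!: Bochner_Integration.integral_cong)
  also have "\<dots> = (CLINT y|\<mu>. CLINT z|\<nu>. ?f (y, z))" by (rule integral_fst'[symmetric, OF int])
  also have "\<dots> = (CLINT y|\<mu>. CLINT z|\<nu>. iexp ((transpose E *v u) \<bullet> y) * iexp (u \<bullet> z))"
    by (simp add: inner_add_right inner_matrix_transpose exp_add distrib_left del: transpose_matrix_vector)
  finally show ?thesis by simp
qed

lemma char_continuous_at_0:
  fixes \<mu> :: "(real^'n) measure"
  assumes "prob_space \<mu>" "sets \<mu> = sets borel" "(y \<longlongrightarrow> 0) at_top"
  shows "((\<lambda>h :: real. CLINT z|\<mu>. iexp (y h \<bullet> z)) \<longlongrightarrow> 1) at_top"
proof -
  interpret prob_space \<mu> by fact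
  note [measurable_cong] = assms(2)
  have "((\<lambda>h. CLINT z|\<mu>. iexp (y h \<bullet> z)) \<longlongrightarrow> (CLINT z|\<mu>. 1)) at_top"
  proof (rule integral_dominated_convergence_at_top[where w = "\<lambda>_. 1"])
    show "AE z in \<mu>. ((\<lambda>h. iexp (y h \<bullet> z)) \<longlongrightarrow> 1) at_top"
    proof (intro AE_I2)
      fix z
      have "((\<lambda>h. iexp (y h \<bullet> z)) \<longlongrightarrow> iexp (0 \<bullet> z)) at_top"
        by (intro tendsto_intros assms(3))
      then show "((\<lambda>h. iexp (y h \<bullet> z)) \<longlongrightarrow> 1) at_top" by simp
    qed
  qed auto
  then show ?thesis by (simp add: prob_space)
qed

text \<open>Invariance gives an identity of characteristic functions at every lag; as the lag grows,
  the initial state is forgotten and the innovation variance tends to that of \<open>S\<close>.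
  Conversely, by the closed form of the innovation covariance, the variances of both summands add up
  to that of \<open>S\<close>. \<open>\<gamma>\<close> guarantees that the innovation laws
  exist.\<close>

theorem ou_stationary_law_iff:
  fixes B S K :: "real^'n^'n"
  assumes G: "is_normal_law \<gamma> (mat 1 :: real^'n^'n)"
    and S: "symmetric_posdef S" and K: "symmetric_posdef K" and B: "lyapunov B S K"
  shows "ou_stationary_law B K \<mu> \<longleftrightarrow> is_normal_law \<mu> S"
proof
  let ?E = "\<lambda>h. flow B h"
  note psd = ou_innovation_cov_psd[OF B S K]
  {
    assume "ou_stationary_law B K \<mu>"
    then have \<mu>: "prob_space \<mu>" "sets \<mu> = sets borel"
      and step: "\<And>h. 0 \<le> h \<Longrightarrow> \<exists>\<nu>. is_normal_law \<nu> (ou_innovation_cov B K h) \<and>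
        distr (\<mu> \<Otimes>\<^sub>M \<nu>) borel (\<lambda>(y, z). ?E h *v y + z) = \<mu>"
      by (auto simp: ou_stationary_law_def)
    show "is_normal_law \<mu> S"
    proof (rule is_normal_lawI[OF \<mu> posdef_nonneg[OF S]])
      fix u
      define f where "f h = (CLINT y|\<mu>. iexp ((transpose (?E h) *v u) \<bullet> y))
        * complex_of_real (exp (- (u \<bullet> (ou_innovation_cov B K h *v u)) / 2))" for h
      have "f h = (CLINT z|\<mu>. iexp (u \<bullet> z))" if h: "0 \<le> h" for h
      proof -
        obtain \<nu> where \<nu>: "is_normal_law \<nu> (ou_innovation_cov B K h)"
          "distr (\<mu> \<Otimes>\<^sub>M \<nu>) borel (\<lambda>(y, z). ?E h *v y + z) = \<mu>"
          using step[OF h] by blast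
        have "sets \<nu> = sets borel" using \<nu>(1) by (simp add: is_normal_law_def)
        from char_transition[OF \<mu> is_normal_law_prob_space[OF \<nu>(1)] this, of "?E h" u]
        show ?thesis unfolding \<nu>(2) char_normal_law[OF \<nu>(1) psd(2)[OF h]] f_def by simp
      qed
      then have "(f \<longlongrightarrow> (CLINT z|\<mu>. iexp (u \<bullet> z))) at_top"
        by (intro tendsto_eventually eventually_at_top_linorderI[of 0]) simp
      moreover have "(f \<longlongrightarrow> 1 * complex_of_real (exp (- (u \<bullet> (S *v u)) / 2))) at_top"
        unfolding f_def
        by (intro tendsto_intros char_continuous_at_0[OF \<mu>] flow_decay[OF B S K]
            ou_innovation_cov_tendsto[OF B S K]) simp
      ultimately show "(CLINT z|\<mu>. iexp (u \<bullet> z)) = complex_of_real (exp (- (u \<bullet> (S *v u)) / 2))"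
        using tendsto_unique[OF trivial_limit_at_top_linorder, of f] by simp
    qed
  next
    assume normal: "is_normal_law \<mu> S"
    have \<mu>: "prob_space \<mu>" "sets \<mu> = sets borel"
      using normal is_normal_law_prob_space by (auto simp: is_normal_law_def)
    show "ou_stationary_law B K \<mu>"
      unfolding ou_stationary_law_def
    proof (intro conjI \<mu> allI impI)
      fix h :: real assume h: "0 \<le> h"
      obtain \<nu> :: "(real^'n) measure" where \<nu>: "is_normal_law \<nu> (ou_innovation_cov B K h)"
        using normal_law_exists[OF G psd[OF h]] by blast
      have \<nu>': "prob_space \<nu>" "sets \<nu> = sets borel"
        using \<nu> is_normal_law_prob_space by (auto simp: is_normal_law_def)
      interpret \<mu>: prob_space \<mu> by fact
      interpret \<nu>: prob_space \<nu> by fact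
      interpret pair_prob_space \<mu> \<nu> ..
      note [measurable_cong] = \<mu>(2) \<nu>'(2)
      have "distr (\<mu> \<Otimes>\<^sub>M \<nu>) borel (\<lambda>(y, z). ?E h *v y + z) = \<mu>"
      proof (rule vector_law_eqI[OF _ _ \<mu>])
        show "prob_space (distr (\<mu> \<Otimes>\<^sub>M \<nu>) borel (\<lambda>(y, z). ?E h *v y + z))"
          by (rule P.prob_space_distr) simp
        fix u
        have "(transpose (?E h) *v u) \<bullet> (S *v (transpose (?E h) *v u)) + u \<bullet> (ou_innovation_cov B K h *v u)
            = u \<bullet> (S *v u)"
          by (simp add: ou_innovation_cov_eq[OF B h] matrix_vector_mult_diff_rdistrib inner_diff_right
              inner_sandwich del: transpose_matrix_vector)
        then show "(CLINT z|distr (\<mu> \<Otimes>\<^sub>M \<nu>) borel (\<lambda>(y, z). ?E h *v y + z). iexp (u \<bullet> z)) = (CLINT z|\<mu>. iexp (u \<bullet> z))"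
          unfolding char_transition[OF \<mu> \<nu>'] char_normal_law[OF normal posdef_nonneg[OF S]]
            char_normal_law[OF \<nu> psd(2)[OF h]] of_real_mult[symmetric] exp_add[symmetric]
          by (simp add: add_divide_distrib[symmetric] del: transpose_matrix_vector)
      qed simp
      then show "\<exists>\<nu>. is_normal_law \<nu> (ou_innovation_cov B K h) \<and>
          distr (\<mu> \<Otimes>\<^sub>M \<nu>) borel (\<lambda>(y, z). ?E h *v y + z) = \<mu>"
        using \<nu> by blast
    qed
  }
qed

section \<open>Time integrals of continuous processes\<close>

lemma floor_grid_tendsto: "(\<lambda>n. of_int \<lfloor>real (Suc n) * r\<rfloor> / real (Suc n)) \<longlonglongrightarrow> r"
proof (rule real_tendsto_sandwich)
  have "(\<lambda>n. r - 1 / real (Suc n)) \<longlonglongrightarrow> r - 0"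
    by (intro tendsto_diff tendsto_const LIMSEQ_Suc lim_1_over_n)
  then show "(\<lambda>n. r - 1 / real (Suc n)) \<longlonglongrightarrow> r" by simp
  show "\<forall>\<^sub>F n in sequentially. r - 1 / real (Suc n) \<le> of_int \<lfloor>real (Suc n) * r\<rfloor> / real (Suc n)"
  proof (intro always_eventually allI)
    fix n
    have "real (Suc n) * r - 1 \<le> of_int \<lfloor>real (Suc n) * r\<rfloor>" by linarith
    then have "(real (Suc n) * r - 1) / real (Suc n) \<le> of_int \<lfloor>real (Suc n) * r\<rfloor> / real (Suc n)"
      by (intro divide_right_mono) simp_all
    then show "r - 1 / real (Suc n) \<le> of_int \<lfloor>real (Suc n) * r\<rfloor> / real (Suc n)"
      by (simp add: diff_divide_distrib del: of_nat_Suc)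
  qed
  show "\<forall>\<^sub>F n in sequentially. of_int \<lfloor>real (Suc n) * r\<rfloor> / real (Suc n) \<le> r"
  proof (intro always_eventually allI)
    fix n
    have "of_int \<lfloor>real (Suc n) * r\<rfloor> \<le> real (Suc n) * r" by linarith
    then show "of_int \<lfloor>real (Suc n) * r\<rfloor> / real (Suc n) \<le> r"
      by (simp add: divide_le_eq mult.commute del: of_nat_Suc)
  qed
qed simp

text \<open>Time is rounded down to a grid: the approximants use countably many times, and path
  continuity gives pointwise convergence.\<close>

lemma continuous_process_measurable:
  fixes z :: "real \<Rightarrow> 'a \<Rightarrow> real"
  assumes meas: "\<And>r. z r \<in> borel_measurable M" and cont: "\<And>\<omega>. continuous_on UNIV (\<lambda>r. z r \<omega>)"
  shows "(\<lambda>p. z (fst p) (snd p)) \<in> borel_measurable (borel \<Otimes>\<^sub>M M)"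
proof (rule borel_measurable_LIMSEQ_real)
  fix p :: "real \<times> 'a"
  show "(\<lambda>n. z (of_int \<lfloor>real (Suc n) * fst p\<rfloor> / real (Suc n)) (snd p)) \<longlonglongrightarrow> z (fst p) (snd p)"
    by (rule continuous_on_tendsto_compose[OF cont floor_grid_tendsto]) simp_all
next
  fix n
  note [measurable] = meas
  show "(\<lambda>p. z (of_int \<lfloor>real (Suc n) * fst p\<rfloor> / real (Suc n)) (snd p)) \<in> borel_measurable (borel \<Otimes>\<^sub>M M)"
    by (rule measurable_compose_countable[where f = "\<lambda>i p. z (of_int i / real (Suc n)) (snd p)"])
      measurable
qed

text \<open>Fubini applies because \<open>\<bar>z Y\<bar> \<le> z\<^sup>2 + Y\<^sup>2\<close> and
  the second moments of \<open>z\<close> are bounded uniformly in time. Stating the result with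
  \<open>has_integral\<close> prepares for differentiation in \<open>t\<close>.\<close>

lemma (in prob_space) time_integral_expectation:
  fixes z :: "real \<Rightarrow> 'a \<Rightarrow> real"
  assumes meas: "\<And>r. z r \<in> borel_measurable M" and cont: "\<And>\<omega>. continuous_on UNIV (\<lambda>r. z r \<omega>)"
    and sq: "\<And>r. integrable M (\<lambda>\<omega>. (z r \<omega>)\<^sup>2)" and B: "\<And>r. expectation (\<lambda>\<omega>. (z r \<omega>)\<^sup>2) \<le> B"
    and Y [measurable]: "Y \<in> borel_measurable M" and Y2: "integrable M (\<lambda>\<omega>. (Y \<omega>)\<^sup>2)" and t: "0 \<le> t"
  shows "(\<lambda>\<omega>. integral {0..t} (\<lambda>r. z r \<omega>)) \<in> borel_measurable M"
    and "integrable M (\<lambda>\<omega>. integral {0..t} (\<lambda>r. z r \<omega>) * Y \<omega>)"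
    and "((\<lambda>r. expectation (\<lambda>\<omega>. z r \<omega> * Y \<omega>)) has_integral
      expectation (\<lambda>\<omega>. integral {0..t} (\<lambda>r. z r \<omega>) * Y \<omega>)) {0..t}"
proof -
  interpret P: pair_sigma_finite lborel M ..
  have [measurable]: "z r \<in> borel_measurable M" for r by (rule meas)
  have zm [measurable]: "(\<lambda>p. z (fst p) (snd p)) \<in> borel_measurable (lborel \<Otimes>\<^sub>M M)"
    using continuous_process_measurable[OF meas cont] by (simp cong: measurable_cong_sets)
  have path: "(LBINT r. indicator {0..t} r * z r \<omega>) = integral {0..t} (\<lambda>r. z r \<omega>)" for \<omega>
  proof -
    have "set_integrable lborel {0..t} (\<lambda>r. z r \<omega>)"
      by (intro borel_integrable_atLeastAtMost' continuous_on_subset[OF cont]) simp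
    from set_borel_integral_eq_integral(2)[OF this] show ?thesis
      by (simp add: set_lebesgue_integral_def)
  qed
  define F where "F r \<omega> = indicator {0..t} r * (z r \<omega> * Y \<omega>)" for r \<omega>
  have Fm [measurable]: "case_prod F \<in> borel_measurable (lborel \<Otimes>\<^sub>M M)"
    unfolding F_def case_prod_beta' by measurable
  have zY: "integrable M (\<lambda>\<omega>. z r \<omega> * Y \<omega>)" for r
    by (rule integrable_mult_of_squares) (simp_all add: sq Y2)
  have bound: "expectation (\<lambda>\<omega>. \<bar>z r \<omega> * Y \<omega>\<bar>) \<le> B + expectation (\<lambda>\<omega>. (Y \<omega>)\<^sup>2)" for r
  proof -
    have "expectation (\<lambda>\<omega>. \<bar>z r \<omega> * Y \<omega>\<bar>) \<le> expectation (\<lambda>\<omega>. (z r \<omega>)\<^sup>2 + (Y \<omega>)\<^sup>2)"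
      using zY sq Y2 by (intro integral_mono abs_mult_le_sum_squares) simp_all
    also have "\<dots> = expectation (\<lambda>\<omega>. (z r \<omega>)\<^sup>2) + expectation (\<lambda>\<omega>. (Y \<omega>)\<^sup>2)"
      using sq Y2 by simp
    finally show ?thesis using B[of r] by simp
  qed
  have int: "integrable (lborel \<Otimes>\<^sub>M M) (case_prod F)"
  proof (rule P.Fubini_integrable[OF Fm])
    show "integrable lborel (\<lambda>r. \<integral>\<omega>. norm (case_prod F (r, \<omega>)) \<partial>M)"
    proof (rule Bochner_Integration.integrable_bound)
      show "integrable lborel (\<lambda>r. indicator {0..t} r * (B + expectation (\<lambda>\<omega>. (Y \<omega>)\<^sup>2)))"
        by (intro integrable_mult_left integrable_real_indicator) (simp_all add: t)
      have "(\<lambda>p. norm (case_prod F p)) \<in> borel_measurable (lborel \<Otimes>\<^sub>M M)" by measurable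
      then show "(\<lambda>r. \<integral>\<omega>. norm (case_prod F (r, \<omega>)) \<partial>M) \<in> borel_measurable lborel"
        by (intro borel_measurable_lebesgue_integral) (simp add: case_prod_beta')
      show "AE r in lborel. norm (\<integral>\<omega>. norm (case_prod F (r, \<omega>)) \<partial>M)
          \<le> norm (indicator {0..t} r * (B + expectation (\<lambda>\<omega>. (Y \<omega>)\<^sup>2)))"
      proof (intro AE_I2)
        fix r :: real
        have "norm (\<integral>\<omega>. norm (case_prod F (r, \<omega>)) \<partial>M) = indicator {0..t} r * expectation (\<lambda>\<omega>. \<bar>z r \<omega> * Y \<omega>\<bar>)"
          by (simp add: F_def abs_mult)
        also have "\<dots> \<le> indicator {0..t} r * (B + expectation (\<lambda>\<omega>. (Y \<omega>)\<^sup>2))"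
          by (intro mult_left_mono bound) simp
        also have "\<dots> \<le> norm (indicator {0..t} r * (B + expectation (\<lambda>\<omega>. (Y \<omega>)\<^sup>2)))" by simp
        finally show "norm (\<integral>\<omega>. norm (case_prod F (r, \<omega>)) \<partial>M)
          \<le> norm (indicator {0..t} r * (B + expectation (\<lambda>\<omega>. (Y \<omega>)\<^sup>2)))" .
      qed
    qed
    show "AE r in lborel. integrable M (\<lambda>\<omega>. case_prod F (r, \<omega>))"
      using zY by (simp add: F_def)
  qed
  have inner: "(LBINT r. F r \<omega>) = integral {0..t} (\<lambda>r. z r \<omega>) * Y \<omega>" for \<omega>
    unfolding F_def path[symmetric] mult.assoc[symmetric] by simp
  have outer: "expectation (F r) = indicator {0..t} r * expectation (\<lambda>\<omega>. z r \<omega> * Y \<omega>)" for r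
  proof -
    have "F r = (\<lambda>\<omega>. indicator {0..t} r * (z r \<omega> * Y \<omega>))" by (simp add: F_def fun_eq_iff)
    then show ?thesis by simp
  qed
  have "(\<lambda>\<omega>. LBINT r. indicator {0..t} r * z r \<omega>) \<in> borel_measurable M"
  proof (rule sigma_finite_measure.borel_measurable_lebesgue_integral[OF lborel.sigma_finite_measure_axioms])
    have "(\<lambda>p. z (fst (snd p, fst p)) (snd (snd p, fst p))) \<in> borel_measurable (M \<Otimes>\<^sub>M lborel)"
      by (rule measurable_compose[OF _ zm]) measurable
    then show "(\<lambda>(\<omega>, r). indicator {0..t} r * z r \<omega>) \<in> borel_measurable (M \<Otimes>\<^sub>M lborel)"
      by (simp add: case_prod_beta')
  qed
  then show "(\<lambda>\<omega>. integral {0..t} (\<lambda>r. z r \<omega>)) \<in> borel_measurable M" by (simp only: path)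
  show "integrable M (\<lambda>\<omega>. integral {0..t} (\<lambda>r. z r \<omega>) * Y \<omega>)"
    using P.integrable_snd[OF int] by (simp only: inner)
  have "set_integrable lborel {0..t} (\<lambda>r. expectation (\<lambda>\<omega>. z r \<omega> * Y \<omega>))"
    using P.integrable_fst[OF int] by (simp add: outer set_integrable_def)
  from set_borel_integral_eq_integral[OF this]
  have "((\<lambda>r. expectation (\<lambda>\<omega>. z r \<omega> * Y \<omega>)) has_integral
      (LBINT r. indicator {0..t} r * expectation (\<lambda>\<omega>. z r \<omega> * Y \<omega>))) {0..t}"
    by (simp add: has_integral_integrable_integral set_lebesgue_integral_def)
  also have "(LBINT r. indicator {0..t} r * expectation (\<lambda>\<omega>. z r \<omega> * Y \<omega>)) = (LBINT r. expectation (F r))"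
    by (simp only: outer)
  also have "\<dots> = expectation (\<lambda>\<omega>. LBINT r. F r \<omega>)"
    by (rule P.Fubini_integral[OF int, symmetric])
  finally show "((\<lambda>r. expectation (\<lambda>\<omega>. z r \<omega> * Y \<omega>)) has_integral
      expectation (\<lambda>\<omega>. integral {0..t} (\<lambda>r. z r \<omega>) * Y \<omega>)) {0..t}"
    by (simp only: inner)
qed

section \<open>Moments and laws of processes\<close>

lemma process_measurable:
  assumes "\<And>t. x t \<in> borel_measurable M"
  shows "(\<lambda>\<omega> t. x t \<omega>) \<in> measurable M (\<Pi>\<^sub>M t\<in>UNIV. borel)"
  using assms by (intro measurable_PiM_single') (auto simp: space_PiM)

lemma cross_moment_process_law:
  fixes x y :: "real \<Rightarrow> 'a \<Rightarrow> real^'n"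
  assumes x: "\<And>t. x t \<in> borel_measurable M" and y: "\<And>t. y t \<in> borel_measurable M"
    and law: "process_law M x = process_law M y"
  shows "cross_moment M (x s) (x t) = cross_moment M (y s) (y t)"
proof -
  have eq: "(\<integral>\<omega>. z s \<omega> $ i * z t \<omega> $ j \<partial>M) = (\<integral>p. p s $ i * p t $ j \<partial>process_law M z)"
    if "\<And>t. z t \<in> borel_measurable M" for z :: "real \<Rightarrow> 'a \<Rightarrow> real^'n" and i j
    unfolding process_law_def
    by (subst integral_distr[OF process_measurable[OF that]]) simp_all
  show ?thesis
    unfolding cross_moment_def eq[where z = x, OF x] eq[where z = y, OF y] law ..
qed

lemma cross_moment_swap: "cross_moment M X Y = transpose (cross_moment M Y X)"
  by (simp add: cross_moment_def transpose_def vec_eq_iff mult.commute)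

text \<open>The existential witnesses of \<open>stationary_ou\<close> are fixed here.
  \<open>S\<close> is absent on purpose: the covariance is computed from the process and identified
  with \<open>S\<close> only in \<open>V_eq\<close>.\<close>

locale ou_process = prob_space M
  for M :: "'a measure" and F :: "real \<Rightarrow> 'a measure" and W x :: "real \<Rightarrow> 'a \<Rightarrow> real^'n"
    and A R K :: "real^'n^'n" +
  assumes gaussian: "centred_gaussian_process M x"
    and stationary: "stationary_process M x"
    and brownian: "brownian_motion M F W"
    and root: "symmetric_posdef R" "R ** R = K"
    and adapted: "\<And>t. x t \<in> borel_measurable (F t)"
    and path: "AE \<omega> in M. continuous_on UNIV (\<lambda>t. x t \<omega>) \<and>
       (\<forall>s t. s \<le> t \<longrightarrow>
          x t \<omega> - x s \<omega> = - integral {s..t} (\<lambda>r. A *v x r \<omega>) + R *v (W t \<omega> - W s \<omega>))"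

lemma stationary_ouE:
  assumes "stationary_ou M A K x"
  obtains F W R where "ou_process M F W x A R K"
  using assms unfolding stationary_ou_def ou_process_def ou_process_axioms_def by blast

context ou_process
begin

lemma x_measurable [measurable]: "x t \<in> borel_measurable M"
  using gaussian by (simp add: centred_gaussian_process_def)

lemma W_measurable [measurable]: "W t \<in> borel_measurable M"
  using brownian by (simp add: brownian_motion_def)

definition V :: "real^'n^'n" where "V = cross_moment M (x 0) (x 0)"

definition C :: "real \<Rightarrow> real^'n^'n" where "C h = cross_moment M (x h) (x 0)"

lemma cross_moment_shift: "cross_moment M (x (s + h)) (x (t + h)) = cross_moment M (x s) (x t)"
  using cross_moment_process_law[of "\<lambda>t. x (t + h)" M x s t] stationary
  by (simp add: stationary_process_def)

lemma cross_moment_eq_C: "cross_moment M (x s) (x t) = C (s - t)"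
  using cross_moment_shift[of "s - t" t 0] by (simp add: C_def)

lemma expectation_x_x: "expectation (\<lambda>\<omega>. x s \<omega> $ i * x t \<omega> $ j) = C (s - t) $ i $ j"
  unfolding cross_moment_eq_C[symmetric] by (simp add: cross_moment_def)

lemma C_minus: "C (- h) = transpose (C h)"
  using cross_moment_eq_C[of 0 h] cross_moment_swap[of M "x 0" "x h"] by (simp add: C_def)

lemma C_0: "C 0 = V"
  by (simp add: C_def V_def)

lemma V_symmetric: "transpose V = V"
  using C_minus[of 0] by (simp add: C_0)

lemma linear_functional_law:
  assumes "finite I"
  obtains v where "0 \<le> v" "distr M borel (\<lambda>\<omega>. \<Sum>t\<in>I. u t \<bullet> x t \<omega>) = centred_normal v"
  using gaussian assms by (auto simp: centred_gaussian_process_def)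

lemma x_component_square_integrable: "integrable M (\<lambda>\<omega>. (x t \<omega> $ i)\<^sup>2)"
proof -
  obtain v where "0 \<le> v" "distr M borel (\<lambda>\<omega>. \<Sum>t\<in>{t}. axis i 1 \<bullet> x t \<omega>) = centred_normal v"
    by (rule linear_functional_law[of "{t}" "\<lambda>_. axis i 1"]) auto
  then show ?thesis
    using random_variable_moments(1)[of "\<lambda>\<omega>. x t \<omega> $ i" M v] by (simp add: inner_axis')
qed

lemma expectation_x_square: "expectation (\<lambda>\<omega>. (x t \<omega> $ i)\<^sup>2) = V $ i $ i"
  using expectation_x_x[of t i t i] by (simp add: C_0 power2_eq_square)

lemma C_bound: "\<bar>C h $ i $ j\<bar> \<le> V $ i $ i + V $ j $ j"
proof -
  have "\<bar>C h $ i $ j\<bar> \<le> expectation (\<lambda>\<omega>. \<bar>x h \<omega> $ i * x 0 \<omega> $ j\<bar>)"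
    using expectation_x_x[of h i 0 j] integral_abs_bound[of M "\<lambda>\<omega>. x h \<omega> $ i * x 0 \<omega> $ j"] by simp
  also have "\<dots> \<le> expectation (\<lambda>\<omega>. (x h \<omega> $ i)\<^sup>2 + (x 0 \<omega> $ j)\<^sup>2)"
    using integrable_mult_of_squares[of "\<lambda>\<omega>. x h \<omega> $ i" M "\<lambda>\<omega>. x 0 \<omega> $ j"]
    by (intro integral_mono abs_mult_le_sum_squares)
      (simp_all add: x_component_square_integrable)
  also have "\<dots> = V $ i $ i + V $ j $ j"
    by (simp add: x_component_square_integrable expectation_x_square)
  finally show ?thesis .
qed

text \<open>The time integral of \<open>x\<close> over \<open>[0, t]\<close>, set to zero on a null set so that it is measurable.\<close>
lemma time_integral:
  assumes t: "0 \<le> t"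
  obtains J :: "'a \<Rightarrow> real^'n" where "J \<in> borel_measurable M"
    "AE \<omega> in M. x t \<omega> + A *v J \<omega> = x 0 \<omega> + R *v (W t \<omega> - W 0 \<omega>)"
    "\<And>i Y. Y \<in> borel_measurable M \<Longrightarrow> integrable M (\<lambda>\<omega>. (Y \<omega>)\<^sup>2) \<Longrightarrow> integrable M (\<lambda>\<omega>. J \<omega> $ i * Y \<omega>)"
    "\<And>i Y. Y \<in> borel_measurable M \<Longrightarrow> integrable M (\<lambda>\<omega>. (Y \<omega>)\<^sup>2) \<Longrightarrow>
      ((\<lambda>r. expectation (\<lambda>\<omega>. x r \<omega> $ i * Y \<omega>)) has_integral expectation (\<lambda>\<omega>. J \<omega> $ i * Y \<omega>)) {0..t}"
proof -
  from path[unfolded eventually_ae_filter] obtain N where N: "N \<in> null_sets M"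
    and N': "{\<omega> \<in> space M. \<not> (continuous_on UNIV (\<lambda>t. x t \<omega>) \<and> (\<forall>s t. s \<le> t \<longrightarrow>
          x t \<omega> - x s \<omega> = - integral {s..t} (\<lambda>r. A *v x r \<omega>) + R *v (W t \<omega> - W s \<omega>)))} \<subseteq> N"
    by blast
  define G where "G = space M - N"
  have good: "continuous_on UNIV (\<lambda>t. x t \<omega>)"
    "x t \<omega> - x 0 \<omega> = - integral {0..t} (\<lambda>r. A *v x r \<omega>) + R *v (W t \<omega> - W 0 \<omega>)" if "\<omega> \<in> G" for \<omega>
    using N' t that unfolding G_def by blast+
  have [measurable]: "G \<in> sets M" using N by (auto simp: G_def)
  define y where "y r \<omega> = (if \<omega> \<in> G then x r \<omega> else 0)" for r \<omega>
  have AE_good: "AE \<omega> in M. \<omega> \<in> G"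
    using N AE_not_in[OF N] by (auto simp: G_def)
  have cont: "continuous_on UNIV (\<lambda>r. y r \<omega>)" for \<omega>
    using good(1)[of \<omega>] by (cases "\<omega> \<in> G") (simp_all add: y_def)
  have y_meas [measurable]: "y r \<in> borel_measurable M" for r
    unfolding y_def by measurable
  have AE_y: "AE \<omega> in M. y r \<omega> = x r \<omega>" for r
    using AE_good by eventually_elim (simp add: y_def)
  have y_sq: "integrable M (\<lambda>\<omega>. (y r \<omega> $ i)\<^sup>2)" "expectation (\<lambda>\<omega>. (y r \<omega> $ i)\<^sup>2) \<le> V $ i $ i" for r i
  proof -
    have AE: "AE \<omega> in M. (x r \<omega> $ i)\<^sup>2 = (y r \<omega> $ i)\<^sup>2" using AE_y[of r] by eventually_elim simp
    show "integrable M (\<lambda>\<omega>. (y r \<omega> $ i)\<^sup>2)"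
      by (rule integrable_cong_AE_imp[OF x_component_square_integrable _ AE]) simp
    have "expectation (\<lambda>\<omega>. (x r \<omega> $ i)\<^sup>2) = expectation (\<lambda>\<omega>. (y r \<omega> $ i)\<^sup>2)"
      by (rule integral_cong_AE[OF _ _ AE]) simp_all
    then show "expectation (\<lambda>\<omega>. (y r \<omega> $ i)\<^sup>2) \<le> V $ i $ i" by (simp add: expectation_x_square)
  qed
  define J where "J \<omega> = (\<chi> i. integral {0..t} (\<lambda>r. y r \<omega> $ i))" for \<omega>
  have cont_i: "continuous_on UNIV (\<lambda>r. y r \<omega> $ i)" for \<omega> i
    by (intro continuous_intros cont)
  have y_meas_i: "(\<lambda>\<omega>. y r \<omega> $ i) \<in> borel_measurable M" for r i by measurable
  note fubini = time_integral_expectation[OF y_meas_i cont_i y_sq _ _ t]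
  show thesis
  proof
    have "(\<lambda>\<omega>. J \<omega> $ i) \<in> borel_measurable M" for i
      using fubini(1)[of "\<lambda>_. 0" i] by (simp add: J_def)
    then show "J \<in> borel_measurable M"
      by (intro borel_measurable_euclidean_space[THEN iffD2]) (auto simp: Basis_vec_def inner_axis)
    show "AE \<omega> in M. x t \<omega> + A *v J \<omega> = x 0 \<omega> + R *v (W t \<omega> - W 0 \<omega>)"
      using AE_good
    proof eventually_elim
      fix \<omega> assume \<omega>: "\<omega> \<in> G"
      have int: "(\<lambda>r. x r \<omega>) integrable_on {0..t}"
        by (intro integrable_continuous_interval continuous_on_subset[OF good(1)[OF \<omega>]]) simp
      then have "J \<omega> = integral {0..t} (\<lambda>r. x r \<omega>)"
        using \<omega> by (simp add: J_def y_def vec_eq_iff)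
      moreover have "integral {0..t} (\<lambda>r. A *v x r \<omega>) = A *v integral {0..t} (\<lambda>r. x r \<omega>)"
        using integral_linear[OF int, of "\<lambda>v. A *v v"] by (simp add: o_def linear_linear)
      ultimately show "x t \<omega> + A *v J \<omega> = x 0 \<omega> + R *v (W t \<omega> - W 0 \<omega>)"
        using good(2)[OF \<omega>] by (simp add: algebra_simps)
    qed
    fix i and Y :: "'a \<Rightarrow> real"
    assume Y [measurable]: "Y \<in> borel_measurable M" and Y2: "integrable M (\<lambda>\<omega>. (Y \<omega>)\<^sup>2)"
    show "integrable M (\<lambda>\<omega>. J \<omega> $ i * Y \<omega>)"
      using fubini(2)[OF Y Y2, of i] by (simp add: J_def)
    have "expectation (\<lambda>\<omega>. y r \<omega> $ i * Y \<omega>) = expectation (\<lambda>\<omega>. x r \<omega> $ i * Y \<omega>)" for r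
    proof (rule integral_cong_AE)
      show "AE \<omega> in M. y r \<omega> $ i * Y \<omega> = x r \<omega> $ i * Y \<omega>"
        using AE_y[of r] by eventually_elim simp
    qed simp_all
    then show "((\<lambda>r. expectation (\<lambda>\<omega>. x r \<omega> $ i * Y \<omega>)) has_integral expectation (\<lambda>\<omega>. J \<omega> $ i * Y \<omega>)) {0..t}"
      using fubini(3)[OF Y Y2, of i] by (simp add: J_def)
  qed
qed

section \<open>Brownian increments\<close>

lemma increment_law:
  assumes "s \<le> t"
  shows "subalgebra M (F s)"
    and "indep_set (sets (F s)) (sets (vimage_algebra (space M) (\<lambda>\<omega>. W t \<omega> - W s \<omega>) borel))"
    and "is_normal_law (distr M borel (\<lambda>\<omega>. W t \<omega> - W s \<omega>)) ((t - s) *\<^sub>R mat 1)"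
  using brownian assms unfolding brownian_motion_def by blast+

lemma increment_moments:
  assumes t: "0 \<le> t"
  shows "integrable M (\<lambda>\<omega>. ((W t \<omega> - W 0 \<omega>) $ i)\<^sup>2)" "integrable M (\<lambda>\<omega>. (W t \<omega> - W 0 \<omega>) $ i)"
    and "expectation (\<lambda>\<omega>. (W t \<omega> - W 0 \<omega>) $ i) = 0"
    and "expectation (\<lambda>\<omega>. (W t \<omega> - W 0 \<omega>) $ i * (W t \<omega> - W 0 \<omega>) $ j) = (t *\<^sub>R mat 1 :: real^'n^'n) $ i $ j"
proof -
  have law: "is_normal_law (distr M borel (\<lambda>\<omega>. W t \<omega> - W 0 \<omega>)) (t *\<^sub>R mat 1)"
    using increment_law(3)[OF t] by simp
  have meas: "(\<lambda>\<omega>. W t \<omega> - W 0 \<omega>) \<in> borel_measurable M" by measurable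
  have d: "distr M borel (\<lambda>\<omega>. u \<bullet> (W t \<omega> - W 0 \<omega>)) = centred_normal (u \<bullet> ((t *\<^sub>R mat 1) *v u))" for u
    using law distr_distr[OF inner_measurable meas, of u]
    by (simp add: is_normal_law_def o_def)
  have psd: "transpose (t *\<^sub>R mat 1 :: real^'n^'n) = t *\<^sub>R mat 1" "0 \<le> v \<bullet> ((t *\<^sub>R mat 1) *v v)" for v :: "real^'n"
    using t by (simp_all add: transpose_scalar matrix_vector_mult_scaleR_left)
  show "integrable M (\<lambda>\<omega>. ((W t \<omega> - W 0 \<omega>) $ i)\<^sup>2)" "integrable M (\<lambda>\<omega>. (W t \<omega> - W 0 \<omega>) $ i)"
    "expectation (\<lambda>\<omega>. (W t \<omega> - W 0 \<omega>) $ i) = 0"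
    "expectation (\<lambda>\<omega>. (W t \<omega> - W 0 \<omega>) $ i * (W t \<omega> - W 0 \<omega>) $ j) = (t *\<^sub>R mat 1 :: real^'n^'n) $ i $ j"
    by (rule gaussian_vector_moments[OF meas d psd])+
qed

text \<open>\<open>x 0\<close> is measurable with respect to \<open>F 0\<close>, hence independent
  of the later increment, whose mean is 0. The work lies in passing from independent sigma-algebras
  to single coordinates.\<close>

lemma increment_uncorrelated:
  assumes t: "0 \<le> t"
  shows "expectation (\<lambda>\<omega>. (W t \<omega> - W 0 \<omega>) $ k * x 0 \<omega> $ j) = 0"
proof -
  let ?D = "\<lambda>\<omega>. W t \<omega> - W 0 \<omega>"
  have sub: "subalgebra M (F 0)" and
    indep: "indep_set (sets (F 0)) (sets (vimage_algebra (space M) ?D borel))"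
    by (rule increment_law[OF t])+
  have space: "space (F 0) = space M" using sub by (simp add: subalgebra_def)
  have int: "integrable M (\<lambda>\<omega>. x 0 \<omega> $ j)"
    by (rule square_integrable_imp_integrable) (simp_all add: x_component_square_integrable)
  have "indep_var borel (\<lambda>\<omega>. x 0 \<omega> $ j) borel (\<lambda>\<omega>. ?D \<omega> $ k)"
    unfolding indep_var_eq
  proof (intro conjI)
    let ?S1 = "{(\<lambda>\<omega>. x 0 \<omega> $ j) -` B \<inter> space M |B. B \<in> sets borel}"
    let ?S2 = "{(\<lambda>\<omega>. ?D \<omega> $ k) -` B \<inter> space M |B. B \<in> sets borel}"
    have m1: "(\<lambda>\<omega>. x 0 \<omega> $ j) \<in> borel_measurable (F 0)"
      by (rule measurable_compose[OF adapted]) simp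
    have "?S1 \<subseteq> sets (F 0)" using measurable_sets[OF m1] unfolding space by blast
    then have 1: "sigma_sets (space M) ?S1 \<subseteq> sets (F 0)"
      using sets.sigma_sets_subset[of ?S1 "F 0"] space by simp
    have "?D \<in> measurable (vimage_algebra (space M) ?D borel) borel"
      by (rule measurable_vimage_algebra1) simp
    then have m2: "(\<lambda>\<omega>. ?D \<omega> $ k) \<in> borel_measurable (vimage_algebra (space M) ?D borel)"
      by (rule measurable_compose) simp
    have "?S2 \<subseteq> sets (vimage_algebra (space M) ?D borel)"
      using measurable_sets[OF m2] unfolding space_vimage_algebra by blast
    then have 2: "sigma_sets (space M) ?S2 \<subseteq> sets (vimage_algebra (space M) ?D borel)"
      using sets.sigma_sets_subset[of ?S2 "vimage_algebra (space M) ?D borel"] by simp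
    show "indep_set (sigma_sets (space M) ?S1) (sigma_sets (space M) ?S2)"
      using indep 1 2 unfolding indep_set_def by (elim indep_sets_mono_sets) (auto split: bool.splits)
  qed simp_all
  from indep_var_lebesgue_integral[OF this int increment_moments(2)[OF t]]
  show ?thesis
    unfolding increment_moments(3)[OF t] mult_zero_right by (simp only: mult.commute)
qed

end

section \<open>The stationary covariance\<close>

lemma borel_measurable_vecI:
  fixes f :: "'a \<Rightarrow> real^'n"
  assumes "\<And>i. (\<lambda>\<omega>. f \<omega> $ i) \<in> borel_measurable M"
  shows "f \<in> borel_measurable M"
  using assms by (intro borel_measurable_euclidean_space[THEN iffD2]) (auto simp: Basis_vec_def inner_axis)

definition square_integrable :: "'a measure \<Rightarrow> ('a \<Rightarrow> real) \<Rightarrow> bool" where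
  "square_integrable M f \<longleftrightarrow> f \<in> borel_measurable M \<and> integrable M (\<lambda>\<omega>. (f \<omega>)\<^sup>2)"

lemma square_integrable_mult: "square_integrable M f \<Longrightarrow> square_integrable M g \<Longrightarrow> integrable M (\<lambda>\<omega>. f \<omega> * g \<omega>)"
  by (auto simp: square_integrable_def intro: integrable_mult_of_squares)

lemma square_integrable_add:
  assumes "square_integrable M f" "square_integrable M g"
  shows "square_integrable M (\<lambda>\<omega>. f \<omega> + g \<omega>)"
  using assms square_integrable_mult[OF assms]
  by (simp add: square_integrable_def power2_sum mult.assoc borel_measurable_add)

lemma square_integrable_cmult: "square_integrable M f \<Longrightarrow> square_integrable M (\<lambda>\<omega>. c * f \<omega>)"
  by (simp add: square_integrable_def power_mult_distrib borel_measurable_times)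

lemma square_integrable_diff:
  assumes "square_integrable M f" "square_integrable M g"
  shows "square_integrable M (\<lambda>\<omega>. f \<omega> - g \<omega>)"
  using square_integrable_add[OF assms(1) square_integrable_cmult[OF assms(2), of "- 1"]] by simp

lemma square_integrable_sum:
  "(\<And>i. i \<in> I \<Longrightarrow> square_integrable M (f i)) \<Longrightarrow> square_integrable M (\<lambda>\<omega>. \<Sum>i\<in>I. f i \<omega>)"
  by (induction I rule: infinite_finite_induct) (simp_all add: square_integrable_add, simp_all add: square_integrable_def)

text \<open>The reflected argument \<open>t - r\<close> arises from pairing the time integral with
  the end point \<open>x t\<close>. As \<open>t\<close> shrinks to 0, only values of
  \<open>c\<close> near 0 are averaged.\<close>

lemma average_tendsto:
  fixes c g :: "real \<Rightarrow> real"
  assumes cont: "continuous_on {0..1} c"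
    and int: "\<And>t. 0 \<le> t \<Longrightarrow> ((\<lambda>r. c (t - r)) has_integral g t) {0..t}"
  shows "((\<lambda>t. g t / t) \<longlongrightarrow> c 0) (at_right 0)"
proof (rule tendstoI)
  fix e :: real assume e: "0 < e"
  then obtain d where d: "0 < d" "\<And>s. s \<in> {0..1} \<Longrightarrow> dist s 0 < d \<Longrightarrow> dist (c s) (c 0) < e / 2"
    using cont[unfolded continuous_on_iff, rule_format, of 0 "e / 2"] by auto
  have "dist (g t / t) (c 0) < e" if t: "0 < t" "t < min d 1" for t
  proof -
    have "((\<lambda>r. c (t - r) - c 0) has_integral g t - t * c 0) (cbox 0 t)"
      using has_integral_diff[OF int[of t] has_integral_const_real[of "c 0" 0 t]] t by simp
    then have "norm (g t - t * c 0) \<le> e / 2 * measure lborel (cbox 0 t)"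
    proof (rule has_integral_bound[rotated])
      fix r assume "r \<in> cbox 0 t"
      then have "dist (c (t - r)) (c 0) < e / 2" using t by (intro d(2)) (auto simp: dist_real_def)
      then show "norm (c (t - r) - c 0) \<le> e / 2" by (simp add: dist_real_def)
    qed (use e in simp)
    then have "\<bar>g t - t * c 0\<bar> \<le> e / 2 * t" using t by simp
    moreover have "g t / t - c 0 = (g t - t * c 0) / t" using t by (simp add: field_simps)
    ultimately have "\<bar>g t / t - c 0\<bar> \<le> e / 2" using t by (simp add: abs_divide divide_le_eq)
    then show ?thesis using e by (simp add: dist_real_def)
  qed
  then show "\<forall>\<^sub>F t in at_right 0. dist (g t / t) (c 0) < e"
    using d(1) by (auto simp: eventually_at_right_field intro!: exI[of _ "min d 1"])
qed

context ou_process
begin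

lemma x_square_integrable: "square_integrable M (\<lambda>\<omega>. x t \<omega> $ i)"
  by (simp add: square_integrable_def x_component_square_integrable)

lemma increment_square_integrable: "0 \<le> t \<Longrightarrow> square_integrable M (\<lambda>\<omega>. (W t \<omega> - W 0 \<omega>) $ i)"
  using increment_moments(1) by (simp add: square_integrable_def)

lemma covariance_integral_equation:
  assumes t: "0 \<le> t"
  shows "(\<lambda>r. C r $ k $ j) integrable_on {0..t}"
    and "C t $ i $ j = V $ i $ j - (\<Sum>k\<in>UNIV. A $ i $ k * integral {0..t} (\<lambda>r. C r $ k $ j))"
proof -
  obtain J where J: "J \<in> borel_measurable M"
    "AE \<omega> in M. x t \<omega> + A *v J \<omega> = x 0 \<omega> + R *v (W t \<omega> - W 0 \<omega>)"
    "\<And>i Y. Y \<in> borel_measurable M \<Longrightarrow> integrable M (\<lambda>\<omega>. (Y \<omega>)\<^sup>2) \<Longrightarrow> integrable M (\<lambda>\<omega>. J \<omega> $ i * Y \<omega>)"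
    "\<And>i Y. Y \<in> borel_measurable M \<Longrightarrow> integrable M (\<lambda>\<omega>. (Y \<omega>)\<^sup>2) \<Longrightarrow>
      ((\<lambda>r. expectation (\<lambda>\<omega>. x r \<omega> $ i * Y \<omega>)) has_integral expectation (\<lambda>\<omega>. J \<omega> $ i * Y \<omega>)) {0..t}"
    using time_integral[OF t] by blast
  note [measurable] = J(1)
  have Ym: "(\<lambda>\<omega>. x 0 \<omega> $ j) \<in> borel_measurable M" by measurable
  have hi: "((\<lambda>r. C r $ k $ j) has_integral expectation (\<lambda>\<omega>. J \<omega> $ k * x 0 \<omega> $ j)) {0..t}" for k
    using J(4)[OF Ym x_component_square_integrable, of k] by (simp add: expectation_x_x)
  then show "(\<lambda>r. C r $ k $ j) integrable_on {0..t}" by blast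
  have JY: "integrable M (\<lambda>\<omega>. J \<omega> $ k * x 0 \<omega> $ j)" for k
    by (rule J(3)[OF Ym x_component_square_integrable])
  have xY: "integrable M (\<lambda>\<omega>. x s \<omega> $ i * x 0 \<omega> $ j)" for s
    by (intro square_integrable_mult x_square_integrable)
  have DY: "integrable M (\<lambda>\<omega>. (W t \<omega> - W 0 \<omega>) $ k * x 0 \<omega> $ j)" for k
    by (intro square_integrable_mult x_square_integrable increment_square_integrable t)
  have "expectation (\<lambda>\<omega>. x t \<omega> $ i * x 0 \<omega> $ j + (\<Sum>k\<in>UNIV. A $ i $ k * (J \<omega> $ k * x 0 \<omega> $ j)))
      = expectation (\<lambda>\<omega>. x 0 \<omega> $ i * x 0 \<omega> $ j + (\<Sum>k\<in>UNIV. R $ i $ k * ((W t \<omega> - W 0 \<omega>) $ k * x 0 \<omega> $ j)))"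
  proof (rule integral_cong_AE)
    show "AE \<omega> in M. x t \<omega> $ i * x 0 \<omega> $ j + (\<Sum>k\<in>UNIV. A $ i $ k * (J \<omega> $ k * x 0 \<omega> $ j))
        = x 0 \<omega> $ i * x 0 \<omega> $ j + (\<Sum>k\<in>UNIV. R $ i $ k * ((W t \<omega> - W 0 \<omega>) $ k * x 0 \<omega> $ j))"
      using J(2)
    proof eventually_elim
      fix \<omega> assume "x t \<omega> + A *v J \<omega> = x 0 \<omega> + R *v (W t \<omega> - W 0 \<omega>)"
      then have "(x t \<omega> + A *v J \<omega>) $ i * x 0 \<omega> $ j = (x 0 \<omega> + R *v (W t \<omega> - W 0 \<omega>)) $ i * x 0 \<omega> $ j" by simp
      then show "x t \<omega> $ i * x 0 \<omega> $ j + (\<Sum>k\<in>UNIV. A $ i $ k * (J \<omega> $ k * x 0 \<omega> $ j))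
        = x 0 \<omega> $ i * x 0 \<omega> $ j + (\<Sum>k\<in>UNIV. R $ i $ k * ((W t \<omega> - W 0 \<omega>) $ k * x 0 \<omega> $ j))"
        by (simp only: vector_add_component matrix_vector_mult_def vec_lambda_beta distrib_right
            sum_distrib_right mult.assoc)
    qed
  qed measurable
  then have "C t $ i $ j + (\<Sum>k\<in>UNIV. A $ i $ k * expectation (\<lambda>\<omega>. J \<omega> $ k * x 0 \<omega> $ j)) = V $ i $ j"
    using xY JY DY by (simp add: expectation_x_x C_0 increment_uncorrelated[OF t] del: vector_minus_component)
  then show "C t $ i $ j = V $ i $ j - (\<Sum>k\<in>UNIV. A $ i $ k * integral {0..t} (\<lambda>r. C r $ k $ j))"
    unfolding integral_unique[OF hi] by linarith
qed

text \<open>Regularity is gained from the integral equation: integrable entries make its right side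
  continuous, and continuity will in turn make it differentiable.\<close>

lemma C_continuous: "continuous_on {0..b} (\<lambda>t. C t $ i $ j)"
proof (cases "0 \<le> b")
  case True
  have "continuous_on {0..b} (\<lambda>t. V $ i $ j - (\<Sum>k\<in>UNIV. A $ i $ k * integral {0..t} (\<lambda>r. C r $ k $ j)))"
    by (intro continuous_intros indefinite_integral_continuous_1 covariance_integral_equation(1)[OF True])
  then show ?thesis
    by (rule continuous_on_cong[THEN iffD1, rotated 2]) (use covariance_integral_equation(2) in auto)
qed simp

lemma C_flow:
  assumes t: "0 \<le> t"
  shows "C t = flow A t ** V"
proof -
  have "(C has_vector_derivative (- A) ** C s) (at s within {0..t})" if s: "s \<in> {0..t}" for s
  proof (intro has_vector_derivative_vecI)
    fix i j
    have "((\<lambda>u. V $ i $ j - (\<Sum>k\<in>UNIV. A $ i $ k * integral {0..u} (\<lambda>r. C r $ k $ j))) has_vector_derivative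
        0 - (\<Sum>k\<in>UNIV. A $ i $ k * C s $ k $ j)) (at s within {0..t})"
      by (intro has_vector_derivative_diff has_vector_derivative_const has_vector_derivative_sum
          has_vector_derivative_mult_right integral_has_vector_derivative C_continuous s)
    moreover have "0 - (\<Sum>k\<in>UNIV. A $ i $ k * C s $ k $ j) = ((- A) ** C s) $ i $ j"
      by (simp add: matrix_matrix_mult_def sum_negf)
    ultimately have "((\<lambda>u. V $ i $ j - (\<Sum>k\<in>UNIV. A $ i $ k * integral {0..u} (\<lambda>r. C r $ k $ j))) has_vector_derivative
        ((- A) ** C s) $ i $ j) (at s within {0..t})" by simp
    then show "((\<lambda>u. C u $ i $ j) has_vector_derivative ((- A) ** C s) $ i $ j) (at s within {0..t})"
      by (rule has_vector_derivative_transform[rotated 2])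
        (use s covariance_integral_equation(2) in auto)
  qed
  from matrix_ode_unique[OF convex_real_interval(5) _ this] t show ?thesis by (simp add: C_0)
qed

text \<open>Compare the second moments of the two sides of \<open>x\<^sub>t + A \<integral>\<^sub>0\<^sup>t x = x\<^sub>0 + R (W\<^sub>t - W\<^sub>0)\<close>:
  to first order in \<open>t\<close> this is the Lyapunov equation.\<close>
lemma second_moment_expansion:
  obtains g :: "real \<Rightarrow> 'n \<Rightarrow> 'n \<Rightarrow> real" and H :: real where
    "\<And>t k j. 0 \<le> t \<Longrightarrow> ((\<lambda>r. C (t - r) $ j $ k) has_integral g t k j) {0..t}"
    "\<And>t i j. 0 \<le> t \<Longrightarrow> \<bar>t * K $ i $ j - (\<Sum>k\<in>UNIV. A $ i $ k * g t k j) - (\<Sum>k\<in>UNIV. A $ j $ k * g t k i)\<bar> \<le> H * t\<^sup>2"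
proof -
  \<comment> \<open>\<open>a\<close> bounds every absolute row sum of \<open>A\<close>, and
    \<open>b\<close> bounds every entry of \<open>C\<close> by \<open>C_bound\<close>; the remainder
    constant becomes \<open>a * a * b\<close>.\<close>
  define a where "a = (\<Sum>i\<in>UNIV. \<Sum>k\<in>UNIV. \<bar>A $ i $ k\<bar>)"
  define b where "b = 2 * (\<Sum>i\<in>UNIV. \<bar>V $ i $ i\<bar>)"
  have a: "(\<Sum>k\<in>UNIV. \<bar>A $ i $ k\<bar>) \<le> a" for i
    unfolding a_def by (rule member_le_sum) (auto intro: sum_nonneg)
  have a0: "0 \<le> a" unfolding a_def by (intro sum_nonneg) auto
  have Vb: "2 * V $ i $ i \<le> b" for i
    using member_le_sum[of i UNIV "\<lambda>i. \<bar>V $ i $ i\<bar>"] by (simp add: b_def)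
  have Cb: "\<bar>C h $ i $ j\<bar> \<le> b" for h i j
    using C_bound[of h i j] Vb[of i] Vb[of j] by linarith
  have b0: "0 \<le> b" unfolding b_def by (simp add: sum_nonneg)
  have lin: "\<bar>\<Sum>k\<in>UNIV. A $ i $ k * f k\<bar> \<le> a * B" if "\<And>k. \<bar>f k\<bar> \<le> B" "0 \<le> B" for f B i
  proof -
    have "\<bar>\<Sum>k\<in>UNIV. A $ i $ k * f k\<bar> \<le> (\<Sum>k\<in>UNIV. \<bar>A $ i $ k\<bar> * B)"
      by (rule order_trans[OF sum_abs sum_mono]) (simp add: abs_mult mult_left_mono that)
    also have "\<dots> \<le> a * B" unfolding sum_distrib_right[symmetric] by (rule mult_right_mono[OF a that(2)])
    finally show ?thesis .
  qed
  have main: "\<exists>g. (\<forall>k j. ((\<lambda>r. C (t - r) $ j $ k) has_integral g k j) {0..t}) \<and>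
    (\<forall>i j. \<bar>t * K $ i $ j - (\<Sum>k\<in>UNIV. A $ i $ k * g k j) - (\<Sum>k\<in>UNIV. A $ j $ k * g k i)\<bar> \<le> a * a * b * t\<^sup>2)"
    if t: "0 \<le> t" for t
  proof -
    obtain J where J: "J \<in> borel_measurable M"
      "AE \<omega> in M. x t \<omega> + A *v J \<omega> = x 0 \<omega> + R *v (W t \<omega> - W 0 \<omega>)"
      "\<And>i Y. Y \<in> borel_measurable M \<Longrightarrow> integrable M (\<lambda>\<omega>. (Y \<omega>)\<^sup>2) \<Longrightarrow> integrable M (\<lambda>\<omega>. J \<omega> $ i * Y \<omega>)"
      "\<And>i Y. Y \<in> borel_measurable M \<Longrightarrow> integrable M (\<lambda>\<omega>. (Y \<omega>)\<^sup>2) \<Longrightarrow>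
        ((\<lambda>r. expectation (\<lambda>\<omega>. x r \<omega> $ i * Y \<omega>)) has_integral expectation (\<lambda>\<omega>. J \<omega> $ i * Y \<omega>)) {0..t}"
      using time_integral[OF t] by blast
    note [measurable] = J(1)
    define D where "D i \<omega> = (\<Sum>k\<in>UNIV. R $ i $ k * (W t \<omega> - W 0 \<omega>) $ k)" for i \<omega>
    define P where "P i \<omega> = (\<Sum>k\<in>UNIV. A $ i $ k * J \<omega> $ k)" for i \<omega>
    have AE: "AE \<omega> in M. \<forall>i. x t \<omega> $ i + P i \<omega> = x 0 \<omega> $ i + D i \<omega>"
      using J(2) by eventually_elim (auto simp: vec_eq_iff matrix_vector_mult_def P_def D_def)
    have D: "square_integrable M (D i)" for i
      unfolding D_def[abs_def] by (intro square_integrable_sum square_integrable_cmult increment_square_integrable t)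
    have [measurable]: "D i \<in> borel_measurable M" for i using D by (simp add: square_integrable_def)
    have [measurable]: "P i \<in> borel_measurable M" for i unfolding P_def[abs_def] by measurable
    have P: "square_integrable M (P i)" for i
    proof -
      \<comment> \<open>Square integrability of \<open>P\<close> is read off the equation, not
        estimated from the time integral.\<close>
      have "square_integrable M (\<lambda>\<omega>. x 0 \<omega> $ i + D i \<omega> - x t \<omega> $ i)"
        by (intro square_integrable_add square_integrable_diff x_square_integrable D)
      moreover have "AE \<omega> in M. (x 0 \<omega> $ i + D i \<omega> - x t \<omega> $ i)\<^sup>2 = (P i \<omega>)\<^sup>2"
        using AE by eventually_elim (metis add_diff_cancel_left')
      ultimately show ?thesis
        unfolding square_integrable_def by (auto intro: integrable_cong_AE_imp)
    qed
    have JY: "integrable M (\<lambda>\<omega>. J \<omega> $ k * Y \<omega>)"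
      "((\<lambda>r. expectation (\<lambda>\<omega>. x r \<omega> $ k * Y \<omega>)) has_integral expectation (\<lambda>\<omega>. J \<omega> $ k * Y \<omega>)) {0..t}"
      if "square_integrable M Y" for k Y
      using J(3,4) that by (auto simp: square_integrable_def)
    have PY: "expectation (\<lambda>\<omega>. P i \<omega> * Y \<omega>) = (\<Sum>k\<in>UNIV. A $ i $ k * expectation (\<lambda>\<omega>. J \<omega> $ k * Y \<omega>))"
      if "square_integrable M Y" for i Y
      using JY(1)[OF that] by (simp add: P_def sum_distrib_right mult.assoc)
    have bound: "\<bar>expectation (\<lambda>\<omega>. J \<omega> $ k * Y \<omega>)\<bar> \<le> B * t"
      if "square_integrable M Y" "\<And>r. \<bar>expectation (\<lambda>\<omega>. x r \<omega> $ k * Y \<omega>)\<bar> \<le> B" "0 \<le> B" for k Y B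
      using has_integral_bound[OF that(3), of "\<lambda>r. expectation (\<lambda>\<omega>. x r \<omega> $ k * Y \<omega>)" _ 0 t]
        JY(2)[OF that(1)] that(2) t by simp
    define g where "g k j = expectation (\<lambda>\<omega>. J \<omega> $ k * x t \<omega> $ j)" for k j
    have "C (r - t) $ k $ j = C (t - r) $ j $ k" for r k j
      using C_minus[of "t - r"] by (simp add: transpose_def)
    then have g: "((\<lambda>r. C (t - r) $ j $ k) has_integral g k j) {0..t}" for k j
      using JY(2)[OF x_square_integrable[of t j], of k] by (simp add: expectation_x_x g_def)
    have Jx: "\<bar>expectation (\<lambda>\<omega>. J \<omega> $ k * x r \<omega> $ j)\<bar> \<le> b * t" for k r j
      by (rule bound[OF x_square_integrable _ b0]) (simp add: expectation_x_x Cb)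
    have "\<bar>expectation (\<lambda>\<omega>. P j \<omega> * x r \<omega> $ k)\<bar> \<le> a * (b * t)" for r k j
      unfolding PY[OF x_square_integrable] by (rule lin) (use Jx b0 t in auto)
    then have xP: "\<bar>expectation (\<lambda>\<omega>. x r \<omega> $ k * P j \<omega>)\<bar> \<le> a * (b * t)" for r k j
      by (simp add: mult.commute)
    have "\<bar>expectation (\<lambda>\<omega>. J \<omega> $ k * P j \<omega>)\<bar> \<le> a * (b * t) * t" for k j
      by (rule bound[OF P xP]) (use a0 b0 t in simp)
    \<comment> \<open>Two time integrals, each over length \<open>t\<close>, make this term of
      second order.\<close>
    then have PP: "\<bar>expectation (\<lambda>\<omega>. P i \<omega> * P j \<omega>)\<bar> \<le> a * (a * (b * t) * t)" for i j
      unfolding PY[OF P] by (rule lin) (use a0 b0 t in simp)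
    have Px: "expectation (\<lambda>\<omega>. P i \<omega> * x t \<omega> $ j) = (\<Sum>k\<in>UNIV. A $ i $ k * g k j)" for i j
      by (simp only: PY[OF x_square_integrable] g_def)
    have x0D: "expectation (\<lambda>\<omega>. D i \<omega> * x 0 \<omega> $ j) = 0" for i j
    proof -
      have "integrable M (\<lambda>\<omega>. (W t \<omega> - W 0 \<omega>) $ k * x 0 \<omega> $ j)" for k
        by (intro square_integrable_mult x_square_integrable increment_square_integrable t)
      then show ?thesis
        by (simp add: D_def sum_distrib_right mult.assoc increment_uncorrelated[OF t] del: vector_minus_component)
    qed
    have DD: "expectation (\<lambda>\<omega>. D i \<omega> * D j \<omega>) = t * K $ i $ j" for i j
    proof -
      have "integrable M (\<lambda>\<omega>. (W t \<omega> - W 0 \<omega>) $ k * (W t \<omega> - W 0 \<omega>) $ l)" for k l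
        by (intro square_integrable_mult increment_square_integrable t)
      then have "expectation (\<lambda>\<omega>. \<Sum>k\<in>UNIV. \<Sum>l\<in>UNIV. (R $ i $ k * R $ j $ l) * ((W t \<omega> - W 0 \<omega>) $ k * (W t \<omega> - W 0 \<omega>) $ l))
          = (\<Sum>k\<in>UNIV. \<Sum>l\<in>UNIV. (R $ i $ k * R $ j $ l) * (t *\<^sub>R mat 1 :: real^'n^'n) $ k $ l)"
        by (simp add: increment_moments(4)[OF t] del: vector_minus_component vector_scaleR_component)
      also have "\<dots> = (\<Sum>k\<in>UNIV. \<Sum>l\<in>UNIV. if l = k then t * (R $ i $ k * R $ j $ k) else 0)"
        by (intro sum.cong refl) (simp add: mat_def)
      also have "\<dots> = t * (\<Sum>k\<in>UNIV. R $ i $ k * R $ j $ k)"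
        by (simp add: sum_distrib_left)
      also have "(\<Sum>k\<in>UNIV. R $ i $ k * R $ j $ k) = (R ** transpose R) $ i $ j"
        by (simp add: matrix_matrix_mult_def transpose_def)
      also have "R ** transpose R = K" using root by (simp add: posdef_symmetric)
      finally show ?thesis
        by (simp add: D_def sum_product mult_ac del: vector_minus_component)
    qed
    have "\<bar>t * K $ i $ j - (\<Sum>k\<in>UNIV. A $ i $ k * g k j) - (\<Sum>k\<in>UNIV. A $ j $ k * g k i)\<bar> \<le> a * a * b * t\<^sup>2" for i j
    proof -
      note ints = square_integrable_mult[OF x_square_integrable x_square_integrable]
        square_integrable_mult[OF P x_square_integrable] square_integrable_mult[OF P P]
        square_integrable_mult[OF D x_square_integrable] square_integrable_mult[OF D D]
      \<comment> \<open>With \<open>x t\<close> and \<open>P\<close> on the same side,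
        \<open>D\<close> meets only \<open>x 0\<close> and itself, so its cross terms have mean
        0.\<close>
      have "expectation (\<lambda>\<omega>. x t \<omega> $ i * x t \<omega> $ j + P j \<omega> * x t \<omega> $ i + P i \<omega> * x t \<omega> $ j + P i \<omega> * P j \<omega>)
          = expectation (\<lambda>\<omega>. x 0 \<omega> $ i * x 0 \<omega> $ j + D j \<omega> * x 0 \<omega> $ i + D i \<omega> * x 0 \<omega> $ j + D i \<omega> * D j \<omega>)"
      proof (rule integral_cong_AE)
        show "AE \<omega> in M. x t \<omega> $ i * x t \<omega> $ j + P j \<omega> * x t \<omega> $ i + P i \<omega> * x t \<omega> $ j + P i \<omega> * P j \<omega>
          = x 0 \<omega> $ i * x 0 \<omega> $ j + D j \<omega> * x 0 \<omega> $ i + D i \<omega> * x 0 \<omega> $ j + D i \<omega> * D j \<omega>"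
          using AE
        proof eventually_elim
          fix \<omega> assume "\<forall>i. x t \<omega> $ i + P i \<omega> = x 0 \<omega> $ i + D i \<omega>"
          then have "(x t \<omega> $ i + P i \<omega>) * (x t \<omega> $ j + P j \<omega>) = (x 0 \<omega> $ i + D i \<omega>) * (x 0 \<omega> $ j + D j \<omega>)" by simp
          then show "x t \<omega> $ i * x t \<omega> $ j + P j \<omega> * x t \<omega> $ i + P i \<omega> * x t \<omega> $ j + P i \<omega> * P j \<omega>
            = x 0 \<omega> $ i * x 0 \<omega> $ j + D j \<omega> * x 0 \<omega> $ i + D i \<omega> * x 0 \<omega> $ j + D i \<omega> * D j \<omega>"
            by (simp add: algebra_simps)
        qed
      qed measurable
      then have "V $ i $ j + (\<Sum>k\<in>UNIV. A $ j $ k * g k i) + (\<Sum>k\<in>UNIV. A $ i $ k * g k j)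
          + expectation (\<lambda>\<omega>. P i \<omega> * P j \<omega>) = V $ i $ j + t * K $ i $ j"
        by (simp add: ints expectation_x_x C_0 Px x0D DD)
      then have "t * K $ i $ j - (\<Sum>k\<in>UNIV. A $ i $ k * g k j) - (\<Sum>k\<in>UNIV. A $ j $ k * g k i)
          = expectation (\<lambda>\<omega>. P i \<omega> * P j \<omega>)" by simp
      then show ?thesis using PP[of i j] by (simp add: power2_eq_square mult_ac)
    qed
    with g show ?thesis by blast
  qed
  \<comment> \<open>\<open>g\<close> was found for each \<open>t\<close> separately; packaging its
    properties lets one choice function serve all \<open>t\<close>.\<close>
  define Q where "Q t g \<longleftrightarrow> (\<forall>k j. ((\<lambda>r. C (t - r) $ j $ k) has_integral g k j) {0..t}) \<and>
    (\<forall>i j. \<bar>t * K $ i $ j - (\<Sum>k\<in>UNIV. A $ i $ k * g k j) - (\<Sum>k\<in>UNIV. A $ j $ k * g k i)\<bar> \<le> a * a * b * t\<^sup>2)"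
    for t g
  have "\<forall>t. \<exists>g. 0 \<le> t \<longrightarrow> Q t g" using main unfolding Q_def by blast
  from choice[OF this] obtain g where g: "\<And>t. 0 \<le> t \<Longrightarrow> Q t (g t)" by blast
  show thesis
    by (rule that[of g "a * a * b"]; drule g; unfold Q_def; blast)
qed

text \<open>Dividing the expansion by \<open>t\<close> makes the quadratic remainder vanish in the
  limit, and the averages \<open>g t k j / t\<close> tend to entries of \<open>V\<close>.\<close>

lemma lyapunov_V: "lyapunov A V K"
proof -
  obtain g H where g: "\<And>t k j. 0 \<le> t \<Longrightarrow> ((\<lambda>r. C (t - r) $ j $ k) has_integral g t k j) {0..t}"
    and H: "\<And>t i j. 0 \<le> t \<Longrightarrow> \<bar>t * K $ i $ j - (\<Sum>k\<in>UNIV. A $ i $ k * g t k j) - (\<Sum>k\<in>UNIV. A $ j $ k * g t k i)\<bar> \<le> H * t\<^sup>2"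
    using second_moment_expansion by blast
  have avg: "((\<lambda>t. g t k j / t) \<longlongrightarrow> V $ j $ k) (at_right 0)" for k j
    using average_tendsto[of "\<lambda>s. C s $ j $ k" "\<lambda>t. g t k j", OF C_continuous g] by (simp add: C_0)
  have Vs: "V $ j $ i = V $ i $ j" for i j
    using arg_cong[OF V_symmetric, of "\<lambda>M. M $ i $ j"] by (simp add: transpose_def)
  have "(A ** V + V ** transpose A) $ i $ j = K $ i $ j" for i j
  proof -
    let ?f = "\<lambda>t. K $ i $ j - (\<Sum>k\<in>UNIV. A $ i $ k * (g t k j / t)) - (\<Sum>k\<in>UNIV. A $ j $ k * (g t k i / t))"
    have "(?f \<longlongrightarrow> K $ i $ j - (\<Sum>k\<in>UNIV. A $ i $ k * V $ j $ k) - (\<Sum>k\<in>UNIV. A $ j $ k * V $ i $ k)) (at_right 0)"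
      by (intro tendsto_intros avg)
    moreover have "(?f \<longlongrightarrow> 0) (at_right 0)"
    proof (rule Lim_null_comparison)
      show "\<forall>\<^sub>F t in at_right 0. norm (?f t) \<le> H * t"
      proof (intro eventually_at_right_less[THEN eventually_mono])
        fix t :: real assume t: "0 < t"
        have "?f t = (t * K $ i $ j - (\<Sum>k\<in>UNIV. A $ i $ k * g t k j) - (\<Sum>k\<in>UNIV. A $ j $ k * g t k i)) / t"
          using t by (simp add: diff_divide_distrib sum_divide_distrib)
        then have "norm (?f t) \<le> H * t\<^sup>2 / t"
          using H[of t i j] t by (simp only: real_norm_def abs_divide abs_of_pos) (intro divide_right_mono; simp)
        then show "norm (?f t) \<le> H * t" using t by (simp add: power2_eq_square)
      qed
      have "((\<lambda>t. H * t) \<longlongrightarrow> H * 0) (at_right 0)" by (intro tendsto_intros)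
      then show "((\<lambda>t. H * t) \<longlongrightarrow> 0) (at_right 0)" by simp
    qed
    ultimately have "K $ i $ j - (\<Sum>k\<in>UNIV. A $ i $ k * V $ j $ k) - (\<Sum>k\<in>UNIV. A $ j $ k * V $ i $ k) = 0"
      using tendsto_unique[OF trivial_limit_at_right_real] by blast
    then show ?thesis
      by (simp add: matrix_matrix_mult_def transpose_def Vs mult.commute)
  qed
  then show ?thesis by (simp add: lyapunov_def vec_eq_iff)
qed

lemma V_eq:
  assumes "symmetric_posdef S" "symmetric_posdef K" "lyapunov A S K"
  shows "V = S"
  by (rule lyapunov_unique[OF assms V_symmetric lyapunov_V])

lemma C_eq_ou_autocov: "C = ou_autocov A V"
proof
  fix h
  show "C h = ou_autocov A V h"
    using C_flow[of h] C_flow[of "- h"] C_minus[of "- h"] by (auto simp: ou_autocov_def)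
qed

end

section \<open>The law of the process and time reversal\<close>

text \<open>The joint law of all coordinates is determined by \<open>joint_law_eqI\<close>, which localizes real
  coordinates; the law of the vector-valued process is its image.\<close>
theorem process_law_eqI:
  fixes x y :: "real \<Rightarrow> 'a \<Rightarrow> real^'n"
  assumes M: "prob_space M"
    and x [measurable]: "\<And>t. x t \<in> borel_measurable M" and y [measurable]: "\<And>t. y t \<in> borel_measurable M"
    and char: "\<And>I u. finite I \<Longrightarrow>
      (CLINT \<omega>|M. iexp (\<Sum>t\<in>I. u t \<bullet> x t \<omega>)) = (CLINT \<omega>|M. iexp (\<Sum>t\<in>I. u t \<bullet> y t \<omega>))"
  shows "process_law M x = process_law M y"
proof -
  interpret prob_space M by fact
  let ?N = "\<Pi>\<^sub>M k\<in>(UNIV :: (real \<times> 'n) set). (borel :: real measure)"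
  define coord where "coord z = (\<lambda>\<omega> (k :: real \<times> 'n). z (fst k) \<omega> $ snd k)" for z :: "real \<Rightarrow> 'a \<Rightarrow> real^'n"
  define glue where "glue q = (\<lambda>t. \<chi> i. q (t, i))" for q :: "real \<times> 'n \<Rightarrow> real"
  have coord_meas: "coord z \<in> measurable M ?N" if [measurable]: "\<And>t. z t \<in> borel_measurable M" for z
    unfolding coord_def by (intro measurable_PiM_single') (auto simp: space_PiM)
  have glue_meas: "glue \<in> measurable ?N (\<Pi>\<^sub>M t\<in>(UNIV :: real set). (borel :: (real^'n) measure))"
    unfolding glue_def
    by (intro measurable_PiM_single' borel_measurable_vecI) (auto simp: space_PiM)
  have law: "process_law M z = distr (distr M ?N (coord z)) (\<Pi>\<^sub>M t\<in>UNIV. borel) glue"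
    if "\<And>t. z t \<in> borel_measurable M" for z
  proof -
    have "(\<lambda>\<omega> t. z t \<omega>) = glue \<circ> coord z"
      by (simp add: fun_eq_iff glue_def coord_def vec_eq_iff)
    then show ?thesis
      by (simp add: process_law_def distr_distr[OF glue_meas coord_meas[OF that]])
  qed
  have "distr M ?N (coord x) = distr M ?N (coord y)"
  proof (rule measure_eqI_PiM_infinite)
    show "finite_measure (distr M ?N (coord x))"
      by (intro prob_space.finite_measure prob_space_distr coord_meas x)
    fix A :: "real \<times> 'n \<Rightarrow> real set" and J :: "(real \<times> 'n) set"
    assume J: "finite J" and "\<And>k. k \<in> J \<Longrightarrow> A k \<in> sets borel"
    \<comment> \<open>Coordinates outside \<open>J\<close> receive the full line, because
      \<open>joint_law_eqI\<close> asks for a Borel set at every index.\<close>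
    define B where "B k = (if k \<in> J then A k else UNIV)" for k
    have B [measurable]: "B k \<in> sets borel" for k
      using \<open>\<And>k. k \<in> J \<Longrightarrow> A k \<in> sets borel\<close> by (simp add: B_def)
    have emb: "emeasure (distr M ?N (coord z)) (prod_emb UNIV (\<lambda>_. borel) J (Pi\<^sub>E J A))
        = measure M {\<omega> \<in> space M. \<forall>k\<in>J. z (fst k) \<omega> $ snd k \<in> B k}"
      if z: "\<And>t. z t \<in> borel_measurable M" for z :: "real \<Rightarrow> 'a \<Rightarrow> real^'n"
    proof -
      have "prod_emb UNIV (\<lambda>_. borel) J (Pi\<^sub>E J A) \<in> sets ?N"
        using J \<open>\<And>k. k \<in> J \<Longrightarrow> A k \<in> sets borel\<close> by (intro sets_PiM_I) auto
      moreover have "coord z -` prod_emb UNIV (\<lambda>_. borel) J (Pi\<^sub>E J A) \<inter> space M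
          = {\<omega> \<in> space M. \<forall>k\<in>J. z (fst k) \<omega> $ snd k \<in> B k}"
        by (auto simp: prod_emb_def coord_def B_def PiE_iff restrict_def space_PiM extensional_def) force
      ultimately show ?thesis
        by (simp add: emeasure_distr coord_meas[OF z] emeasure_eq_measure)
    qed
    have "measure M {\<omega> \<in> space M. \<forall>k\<in>J. x (fst k) \<omega> $ snd k \<in> B k}
        = measure M {\<omega> \<in> space M. \<forall>k\<in>J. y (fst k) \<omega> $ snd k \<in> B k}"
    proof (rule joint_law_eqI[OF M M J])
      fix u :: "real \<times> 'n \<Rightarrow> real"
      \<comment> \<open>Scalar frequencies at the same time are collected into one vector, to match
        the functionals of the hypothesis \<open>char\<close>.\<close>
      define w :: "real \<Rightarrow> real^'n" where "w t = (\<chi> i. if (t, i) \<in> J then u (t, i) else 0)" for t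
      have "(\<Sum>t\<in>fst ` J. w t \<bullet> z t) = (\<Sum>k\<in>J. u k * z (fst k) $ snd k)" for z
      proof -
        have "(\<Sum>t\<in>fst ` J. w t \<bullet> z t) = (\<Sum>(t, i)\<in>fst ` J \<times> UNIV. if (t, i) \<in> J then u (t, i) * z t $ i else 0)"
          unfolding sum.cartesian_product[symmetric] inner_vec_def
          by (intro sum.cong refl) (simp add: w_def)
        also have "\<dots> = (\<Sum>(t, i)\<in>J. u (t, i) * z t $ i)"
          by (rule sum.mono_neutral_cong_right) (use J in \<open>auto simp: image_iff Bex_def split: if_splits\<close>)
        finally show ?thesis by (simp add: case_prod_beta')
      qed
      then show "(CLINT \<omega>|M. iexp (\<Sum>k\<in>J. u k * x (fst k) \<omega> $ snd k)) = (CLINT \<omega>|M. iexp (\<Sum>k\<in>J. u k * y (fst k) \<omega> $ snd k))"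
        using char[of "fst ` J" w] J by simp
    qed simp_all
    then show "emeasure (distr M ?N (coord x)) (prod_emb UNIV (\<lambda>_. borel) J (Pi\<^sub>E J A))
        = emeasure (distr M ?N (coord y)) (prod_emb UNIV (\<lambda>_. borel) J (Pi\<^sub>E J A))"
      by (simp add: emb x y)
  qed simp_all
  then show ?thesis by (simp add: law x y)
qed

context ou_process
begin

lemma functional_second_moment:
  assumes I: "finite I"
  shows "expectation (\<lambda>\<omega>. (\<Sum>t\<in>I. u t \<bullet> x t \<omega>)\<^sup>2) = (\<Sum>s\<in>I. \<Sum>t\<in>I. u s \<bullet> (C (s - t) *v u t))"
proof -
  have int: "integrable M (\<lambda>\<omega>. x s \<omega> $ i * x t \<omega> $ j)" for s t i j
    by (intro square_integrable_mult x_square_integrable)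
  have "(\<Sum>t\<in>I. u t \<bullet> x t \<omega>)\<^sup>2 = (\<Sum>s\<in>I. \<Sum>t\<in>I. \<Sum>i\<in>UNIV. \<Sum>j\<in>UNIV. (u s $ i * u t $ j) * (x s \<omega> $ i * x t \<omega> $ j))" for \<omega>
    unfolding power2_eq_square sum_product inner_vec_def inner_real_def
    by (intro sum.cong refl) (simp add: mult_ac)
  then have "expectation (\<lambda>\<omega>. (\<Sum>t\<in>I. u t \<bullet> x t \<omega>)\<^sup>2)
      = (\<Sum>s\<in>I. \<Sum>t\<in>I. \<Sum>i\<in>UNIV. \<Sum>j\<in>UNIV. (u s $ i * u t $ j) * C (s - t) $ i $ j)"
    by (simp add: int expectation_x_x)
  also have "\<dots> = (\<Sum>s\<in>I. \<Sum>t\<in>I. u s \<bullet> (C (s - t) *v u t))"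
    unfolding inner_vec_def inner_real_def matrix_vector_mult_def vec_lambda_beta sum_distrib_left
    by (intro sum.cong refl) (simp add: mult_ac)
  finally show ?thesis .
qed

text \<open>The definition of a Gaussian process asserts only that some variance exists; the second
  moment identifies it.\<close>

lemma functional_law:
  assumes I: "finite I"
  shows "distr M borel (\<lambda>\<omega>. \<Sum>t\<in>I. u t \<bullet> x t \<omega>) = centred_normal (\<Sum>s\<in>I. \<Sum>t\<in>I. u s \<bullet> (C (s - t) *v u t))"
    and "0 \<le> (\<Sum>s\<in>I. \<Sum>t\<in>I. u s \<bullet> (C (s - t) *v u t))"
proof -
  obtain v where v: "0 \<le> v" "distr M borel (\<lambda>\<omega>. \<Sum>t\<in>I. u t \<bullet> x t \<omega>) = centred_normal v"
    using linear_functional_law[OF I] by blast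
  have "(\<lambda>\<omega>. \<Sum>t\<in>I. u t \<bullet> x t \<omega>) \<in> borel_measurable M" by measurable
  from random_variable_moments(2)[OF this v(2,1)]
  have "v = (\<Sum>s\<in>I. \<Sum>t\<in>I. u s \<bullet> (C (s - t) *v u t))"
    by (simp add: functional_second_moment[OF I])
  with v show "distr M borel (\<lambda>\<omega>. \<Sum>t\<in>I. u t \<bullet> x t \<omega>) = centred_normal (\<Sum>s\<in>I. \<Sum>t\<in>I. u s \<bullet> (C (s - t) *v u t))"
    "0 \<le> (\<Sum>s\<in>I. \<Sum>t\<in>I. u s \<bullet> (C (s - t) *v u t))" by simp_all
qed

lemma functional_char:
  assumes I: "finite I"
  shows "(CLINT \<omega>|M. iexp (\<Sum>t\<in>I. u t \<bullet> x t \<omega>)) = exp (- (\<Sum>s\<in>I. \<Sum>t\<in>I. u s \<bullet> (C (s - t) *v u t)) / 2)"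
proof -
  have "char (distr M borel (\<lambda>\<omega>. \<Sum>t\<in>I. u t \<bullet> x t \<omega>)) 1 = (CLINT \<omega>|M. iexp (1 * (\<Sum>t\<in>I. u t \<bullet> x t \<omega>)))"
    unfolding char_def by (rule integral_distr) simp_all
  then show ?thesis
    unfolding functional_law(1)[OF I] char_centred_normal[OF functional_law(2)[OF I]]
    by (simp only: mult_1 one_power2)
qed

lemma x_normal_law: "is_normal_law (distr M borel (x t)) V"
  unfolding is_normal_law_def
proof (intro conjI allI)
  fix u
  have "distr (distr M borel (x t)) borel (\<lambda>z. u \<bullet> z) = distr M borel (\<lambda>\<omega>. \<Sum>s\<in>{t}. u \<bullet> x s \<omega>)"
    by (subst distr_distr[OF inner_measurable x_measurable]) (simp add: o_def)
  then show "distr (distr M borel (x t)) borel (\<lambda>z. u \<bullet> z) = centred_normal (u \<bullet> (V *v u))"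
    unfolding functional_law(1)[of "{t}", simplified finite.intros, OF TrueI] by (simp add: C_0)
qed simp

text \<open>Both processes are centred Gaussian, so their laws are fixed by covariances at finitely
  many times; reversal replaces \<open>C h\<close> by \<open>C (- h)\<close>, its transpose.\<close>

lemma time_reversible_iff: "time_reversible M x \<longleftrightarrow> (\<forall>h. C h = transpose (C h))"
proof
  assume rev: "time_reversible M x"
  show "\<forall>h. C h = transpose (C h)"
  proof
    fix h
    have "cross_moment M (x h) (x 0) = cross_moment M (x (- h)) (x (- 0))"
      by (rule cross_moment_process_law[of x M "\<lambda>t. x (- t)"]) (use rev in \<open>simp_all add: time_reversible_def\<close>)
    then show "C h = transpose (C h)" by (simp add: cross_moment_eq_C C_minus)
  qed
next
  assume symmetric: "\<forall>h. C h = transpose (C h)"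
  show "time_reversible M x"
    unfolding time_reversible_def
  proof (rule process_law_eqI)
    show "prob_space M" by (rule prob_space_axioms)
    fix I :: "real set" and u :: "real \<Rightarrow> real^'n" assume I: "finite I"
    have inj: "inj_on uminus I" by (simp add: inj_on_def)
    have C: "C (- s - - t) = C (s - t)" for s t
      using C_minus[of "s - t"] symmetric by (metis minus_diff_eq minus_diff_minus)
    have "(\<Sum>t\<in>I. u t \<bullet> x (- t) \<omega>) = (\<Sum>t\<in>uminus ` I. u (- t) \<bullet> x t \<omega>)" for \<omega>
      by (simp add: sum.reindex[OF inj])
    then have "(CLINT \<omega>|M. iexp (\<Sum>t\<in>I. u t \<bullet> x (- t) \<omega>))
        = exp (- (\<Sum>s\<in>uminus ` I. \<Sum>t\<in>uminus ` I. u (- s) \<bullet> (C (s - t) *v u (- t))) / 2)"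
      using functional_char[of "uminus ` I" "\<lambda>t. u (- t)"] I by simp
    also have "(\<Sum>s\<in>uminus ` I. \<Sum>t\<in>uminus ` I. u (- s) \<bullet> (C (s - t) *v u (- t)))
        = (\<Sum>s\<in>I. \<Sum>t\<in>I. u s \<bullet> (C (s - t) *v u t))"
      unfolding sum.reindex[OF inj] o_def C by simp
    finally show "(CLINT \<omega>|M. iexp (\<Sum>t\<in>I. u t \<bullet> x t \<omega>)) = (CLINT \<omega>|M. iexp (\<Sum>t\<in>I. u t \<bullet> x (- t) \<omega>))"
      unfolding functional_char[OF I] by (rule sym)
  qed measurable
qed

lemma standard_normal_law: "is_normal_law (distr M borel (\<lambda>\<omega>. W 1 \<omega> - W 0 \<omega>)) (mat 1)"
  using increment_law(3)[of 0 1] by simp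

end

lemma stationary_ou_normal_law:
  assumes S: "symmetric_posdef S" and K: "symmetric_posdef K" and B: "lyapunov B S K"
    and y: "stationary_ou N B K y"
  shows "is_normal_law (distr N borel (y t)) S"
proof -
  obtain F W R where "ou_process N F W y B R K" using stationary_ouE[OF y] .
  then interpret ou_process N F W y B R K .
  show ?thesis using x_normal_law V_eq[OF S K B] by simp
qed

lemma drift_family_decomposition:
  assumes "symmetric_posdef S"
  shows "B = gradient_part S K + circulation B S K ** matrix_inv S"
  using drift_circulation[OF assms, of K B]
  by (simp add: gradient_part_def matrix_mult.add_left matrix_mult_scaleR_left)

lemma gradient_part_in_drift_family: "gradient_part S K \<in> drift_family S K"
  unfolding drift_family_def
  by (rule CollectI, rule exI[of _ 0])
    (simp add: gradient_part_def matrix_mult_scaleR_left antisymmetric_def transpose_def vec_eq_iff)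

text \<open>Every functional is constant because the invariant laws themselves coincide. That
  symmetry at one lag is strictly weaker is rendered by three clauses: an implication free of the
  sampling bound, the failure of its converse for any full-turn drift, and a witness that such
  drifts exist in every dimension at least two.\<close>

theorem theorem1:
  fixes S \<Sigma> A Q Q\<Delta> :: "real^'n^'n"
    and M :: "'a measure"
    and x :: "real \<Rightarrow> 'a \<Rightarrow> real^'n"
    and C :: "real \<Rightarrow> real^'n^'n"
    and \<Delta> :: real
  assumes S: "symmetric_posdef S" and \<Sigma>: "symmetric_posdef \<Sigma>"
    and A: "stable_drift A" "lyapunov A S \<Sigma>"
    and x: "stationary_ou M A \<Sigma> x"
    and C: "C = (\<lambda>h. cross_moment M (x h) (x 0))"
    and Q: "Q = circulation A S \<Sigma>"
    and \<Delta>: "0 < \<Delta>"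
    and Q\<Delta>: "Q\<Delta> = (1/2) *\<^sub>R (C \<Delta> - transpose (C \<Delta>))"
  shows
    "\<comment> \<open>the autocovariance\<close>
     (\<forall>t h. cross_moment M (x (t + h)) (x t) = C h) \<and>
     C = ou_autocov A S \<and>
     \<comment> \<open>(i)\<close>
     (identified_set S \<Sigma> = drift_family S \<Sigma> \<and>
      affine (drift_family S \<Sigma>) \<and>
      aff_dim (drift_family S \<Sigma>) = int (CARD('n) * (CARD('n) - 1) div 2) \<and>
      gradient_part S \<Sigma> \<in> drift_family S \<Sigma> \<and>
      (\<forall>B\<in>drift_family S \<Sigma>.
         B = gradient_part S \<Sigma> + circulation B S \<Sigma> ** matrix_inv S) \<and>
      bij_betw (\<lambda>B. circulation B S \<Sigma>) (drift_family S \<Sigma>) {P. antisymmetric P} \<and>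
      (\<forall>B\<in>drift_family S \<Sigma>. stable_drift B) \<and>
      (\<exists>\<mu>. is_normal_law \<mu> S) \<and>
      (\<forall>B\<in>drift_family S \<Sigma>. \<forall>\<mu>. ou_stationary_law B \<Sigma> \<mu> \<longleftrightarrow> is_normal_law \<mu> S) \<and>
      (\<forall>t. is_normal_law (distr M borel (x t)) S) \<and>
      (\<forall>B\<in>drift_family S \<Sigma>. \<forall>(N :: 'b measure) y t.
         stationary_ou N B \<Sigma> y \<longrightarrow> is_normal_law (distr N borel (y t)) S) \<and>
      (\<forall>B\<^sub>1\<in>drift_family S \<Sigma>. \<forall>B\<^sub>2\<in>drift_family S \<Sigma>. \<forall>\<mu>\<^sub>1 \<mu>\<^sub>2.
         ou_stationary_law B\<^sub>1 \<Sigma> \<mu>\<^sub>1 \<and> ou_stationary_law B\<^sub>2 \<Sigma> \<mu>\<^sub>2 \<longrightarrow>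
         (\<forall>functional :: (real^'n) measure \<Rightarrow> 'c. functional \<mu>\<^sub>1 = functional \<mu>\<^sub>2) \<and>
         correlation_matrix \<mu>\<^sub>1 = correlation_matrix \<mu>\<^sub>2 \<and>
         (\<forall>(distances :: real^'n^'n \<Rightarrow> real^'n^'n)
            (graph :: real^'n^'n \<Rightarrow> 'n set set)
            (centrality :: 'n set set \<Rightarrow> real^'n).
            distances (correlation_matrix \<mu>\<^sub>1) = distances (correlation_matrix \<mu>\<^sub>2) \<and>
            graph (distances (correlation_matrix \<mu>\<^sub>1)) =
              graph (distances (correlation_matrix \<mu>\<^sub>2)) \<and>
            centrality (graph (distances (correlation_matrix \<mu>\<^sub>1))) =
              centrality (graph (distances (correlation_matrix \<mu>\<^sub>2)))) \<and>
         principal_components \<mu>\<^sub>1 = principal_components \<mu>\<^sub>2)) \<and>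
     \<comment> \<open>(ii)\<close>
     (sampling_bound A \<Delta> \<longrightarrow>
        (\<forall>B \<Sigma>\<^sub>B. symmetric_posdef \<Sigma>\<^sub>B \<and> stable_drift B \<and> lyapunov B S \<Sigma>\<^sub>B \<and> sampling_bound B \<Delta> \<and>
           ou_autocov B S \<Delta> = C \<Delta> \<longrightarrow> B = A \<and> circulation B S \<Sigma>\<^sub>B = Q) \<and>
        eigenvalues (cmatrix (C \<Delta> ** matrix_inv S)) \<inter> \<real>\<^sub>\<le>\<^sub>0 = {} \<and>
        (\<exists>!L. matrix_exp L = cmatrix (C \<Delta> ** matrix_inv S) \<and>
              (\<forall>l\<in>eigenvalues L. - pi < Im l \<and> Im l < pi)) \<and>
        cmatrix A = (- (1 / \<Delta>)) *\<^sub>R principal_log (cmatrix (C \<Delta> ** matrix_inv S)) \<and>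
        (Q\<Delta> = 0 \<longleftrightarrow> Q = 0)) \<and>
     \<comment> \<open>(iii)\<close>
     (Q = 0 \<longleftrightarrow> (\<forall>h\<ge>0. C h = transpose (C h))) \<and>
     (Q = 0 \<longleftrightarrow> time_reversible M x) \<and>
     (sampling_bound A \<Delta> \<longrightarrow> (Q = 0 \<longleftrightarrow> Q\<Delta> = 0)) \<and>
     (Q = 0 \<longrightarrow> Q\<Delta> = 0) \<and>
     (full_turn_drift A \<Delta> \<longrightarrow>
        Q \<noteq> 0 \<and> Q\<Delta> = 0 \<and> (\<forall>k::nat. transpose (C (real k * \<Delta>)) = C (real k * \<Delta>))) \<and>
     (2 \<le> CARD('n) \<longrightarrow>
        (\<exists>S\<^sub>0 \<Sigma>\<^sub>0 A\<^sub>0 :: real^'n^'n. symmetric_posdef S\<^sub>0 \<and> symmetric_posdef \<Sigma>\<^sub>0 \<and>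
           stable_drift A\<^sub>0 \<and> lyapunov A\<^sub>0 S\<^sub>0 \<Sigma>\<^sub>0 \<and> full_turn_drift A\<^sub>0 \<Delta> \<and>
           circulation A\<^sub>0 S\<^sub>0 \<Sigma>\<^sub>0 \<noteq> 0 \<and>
           (\<forall>k::nat. transpose (ou_autocov A\<^sub>0 S\<^sub>0 (real k * \<Delta>)) =
              ou_autocov A\<^sub>0 S\<^sub>0 (real k * \<Delta>))))"
proof -
  note S_sym = posdef_symmetric[OF S]
  obtain F W R where "ou_process M F W x A R \<Sigma>" using stationary_ouE[OF x] .
  then interpret ou: ou_process M F W x A R \<Sigma> .
  have V: "ou.V = S" by (rule ou.V_eq[OF S \<Sigma> A(2)])
  have C_eq: "C = ou.C" by (simp add: C ou.C_def fun_eq_iff)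
  have C_autocov: "C = ou_autocov A S" using ou.C_eq_ou_autocov by (simp add: C_eq V)
  have C_flow: "C h = flow A h ** S" if "0 \<le> h" for h
    using ou.C_flow[OF that] by (simp add: C_eq V)
  have shift: "cross_moment M (x (t + h)) (x t) = C h" for t h
    by (simp add: ou.cross_moment_eq_C C_eq)
  have normal: "is_normal_law (distr M borel (x t)) S" for t
    using ou.x_normal_law by (simp add: V)
  have family_lyapunov: "lyapunov B S \<Sigma>" if "B \<in> drift_family S \<Sigma>" for B
    using that by (simp add: drift_family_iff[OF S \<Sigma>])
  \<comment> \<open>The noise of the given process supplies the standard normal law needed to build
    the innovations.\<close>
  have stationary_law: "ou_stationary_law B \<Sigma> \<mu> \<longleftrightarrow> is_normal_law \<mu> S" if "B \<in> drift_family S \<Sigma>" for B \<mu>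
    by (rule ou_stationary_law_iff[OF ou.standard_normal_law S \<Sigma> family_lyapunov[OF that]])
  have law_unique: "\<mu>\<^sub>1 = \<mu>\<^sub>2" if "B\<^sub>1 \<in> drift_family S \<Sigma>" "B\<^sub>2 \<in> drift_family S \<Sigma>"
    "ou_stationary_law B\<^sub>1 \<Sigma> \<mu>\<^sub>1" "ou_stationary_law B\<^sub>2 \<Sigma> \<mu>\<^sub>2" for B\<^sub>1 B\<^sub>2 \<mu>\<^sub>1 \<mu>\<^sub>2
    using that stationary_law is_normal_law_unique posdef_nonneg[OF S] by metis

  \<comment> \<open>Symmetry of the autocovariance and reversibility\<close>
  have Q_iff: "Q = 0 \<longleftrightarrow> A ** S = S ** transpose A"
    by (simp add: Q circulation_zero_iff[OF A(2)])
  have Q\<Delta>_iff: "Q\<Delta> = 0 \<longleftrightarrow> transpose (C \<Delta>) = C \<Delta>" by (auto simp: Q\<Delta>)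
  have sym_all: "transpose (C h) = C h" if "Q = 0" "0 \<le> h" for h
    using autocov_symmetric[OF S_sym, of A "- h"] that by (simp add: Q_iff C_flow)
  have Q_zero_iff: "Q = 0 \<longleftrightarrow> (\<forall>h\<ge>0. C h = transpose (C h))"
    using sym_all autocov_symmetric_imp[OF S_sym, of A] by (auto simp: Q_iff C_flow)
  have reversible: "Q = 0 \<longleftrightarrow> time_reversible M x"
  proof -
    have "(\<forall>h\<ge>0. C h = transpose (C h)) \<longleftrightarrow> (\<forall>h. C h = transpose (C h))"
    proof (intro iffI allI)
      fix h assume "\<forall>h\<ge>0. C h = transpose (C h)"
      then show "C h = transpose (C h)"
        using ou.C_minus[of h] by (cases "0 \<le> h") (auto simp: C_eq dest: spec[of _ "- h"])
    qed simp
    then show ?thesis by (simp add: Q_zero_iff ou.time_reversible_iff C_eq)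
  qed
  have Q\<Delta>_zero: "Q = 0 \<longleftrightarrow> Q\<Delta> = 0" if "sampling_bound A \<Delta>"
  proof
    show "Q = 0 \<Longrightarrow> Q\<Delta> = 0" using sym_all[of \<Delta>] \<Delta> by (simp add: Q\<Delta>_iff)
    show "Q\<Delta> = 0 \<Longrightarrow> Q = 0"
      using sampled_autocov_symmetric_imp[OF S \<Delta> that] C_flow[of \<Delta>] \<Delta> by (simp add: Q\<Delta>_iff Q_iff)
  qed

  \<comment> \<open>Identification from the lagged covariance\<close>
  have ratio: "C \<Delta> ** matrix_inv S = flow A \<Delta>"
    using \<Delta> by (simp add: C_flow posdef_mult_inv_right[OF S])
  have identified: "B = A \<and> circulation B S \<Sigma>\<^sub>B = Q"
    if "sampling_bound A \<Delta>" "lyapunov B S \<Sigma>\<^sub>B" "sampling_bound B \<Delta>" "ou_autocov B S \<Delta> = C \<Delta>" for B \<Sigma>\<^sub>B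
  proof -
    have "flow B \<Delta> ** S = flow A \<Delta> ** S"
      using that(4) \<Delta> by (simp add: ou_autocov_def C_flow)
    then have "B = A"
      using sampled_flow_inj[OF \<Delta> that(3,1)] by (simp only: posdef_mult_right_cancel[OF S])
    \<comment> \<open>The noise covariance of the competing system is left free; the Lyapunov
      equation returns it once the drifts agree.\<close>
    moreover from this have "\<Sigma>\<^sub>B = \<Sigma>" using that(2) A(2) by (simp add: lyapunov_def)
    ultimately show ?thesis by (simp add: Q)
  qed
  have principal: "eigenvalues (cmatrix (C \<Delta> ** matrix_inv S)) \<inter> \<real>\<^sub>\<le>\<^sub>0 = {}"
    "\<exists>!L. matrix_exp L = cmatrix (C \<Delta> ** matrix_inv S) \<and> (\<forall>l\<in>eigenvalues L. - pi < Im l \<and> Im l < pi)"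
    "cmatrix A = (- (1 / \<Delta>)) *\<^sub>R principal_log (cmatrix (C \<Delta> ** matrix_inv S))"
    if "sampling_bound A \<Delta>"
  proof -
    note strip = sampling_bound_strip[OF that \<Delta>]
    show "eigenvalues (cmatrix (C \<Delta> ** matrix_inv S)) \<inter> \<real>\<^sub>\<le>\<^sub>0 = {}"
      unfolding ratio cmatrix_matrix_exp by (rule eigenvalues_matrix_exp_nonpos[OF strip])
    show "\<exists>!L. matrix_exp L = cmatrix (C \<Delta> ** matrix_inv S) \<and> (\<forall>l\<in>eigenvalues L. - pi < Im l \<and> Im l < pi)"
      unfolding ratio cmatrix_matrix_exp by (rule principal_log_matrix_exp(1)[OF strip])
    have "principal_log (cmatrix (C \<Delta> ** matrix_inv S)) = cmatrix ((- \<Delta>) *\<^sub>R A)"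
      unfolding ratio cmatrix_matrix_exp by (rule principal_log_matrix_exp(2)[OF strip])
    then show "cmatrix A = (- (1 / \<Delta>)) *\<^sub>R principal_log (cmatrix (C \<Delta> ** matrix_inv S))"
      using \<Delta> by (simp only: cmatrix_scaleR scaleR_scaleR) simp
  qed

  \<comment> \<open>Full turns\<close>
  have turn: "Q \<noteq> 0 \<and> Q\<Delta> = 0 \<and> (\<forall>k::nat. transpose (C (real k * \<Delta>)) = C (real k * \<Delta>))"
    if "full_turn_drift A \<Delta>"
  proof -
    have sym: "transpose (C (real k * \<Delta>)) = C (real k * \<Delta>)" for k :: nat
      using full_turn_autocov_symmetric[OF S_sym that, of k] \<Delta> by (simp add: C_flow)
    show ?thesis
      using sym sym[of 1] full_turn_circulation_nonzero[OF S A(2) that] by (simp add: Q Q\<Delta>_iff)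
  qed
  have example: "\<exists>S\<^sub>0 \<Sigma>\<^sub>0 A\<^sub>0 :: real^'n^'n. symmetric_posdef S\<^sub>0 \<and> symmetric_posdef \<Sigma>\<^sub>0 \<and>
      stable_drift A\<^sub>0 \<and> lyapunov A\<^sub>0 S\<^sub>0 \<Sigma>\<^sub>0 \<and> full_turn_drift A\<^sub>0 \<Delta> \<and> circulation A\<^sub>0 S\<^sub>0 \<Sigma>\<^sub>0 \<noteq> 0 \<and>
      (\<forall>k::nat. transpose (ou_autocov A\<^sub>0 S\<^sub>0 (real k * \<Delta>)) = ou_autocov A\<^sub>0 S\<^sub>0 (real k * \<Delta>))"
    if n: "2 \<le> CARD('n)"
  proof -
    obtain A\<^sub>0 :: "real^'n^'n" where A\<^sub>0: "full_turn_drift A\<^sub>0 \<Delta>" "lyapunov A\<^sub>0 (mat 1) (2 *\<^sub>R mat 1)"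
      using full_turn_drift_exists[OF n \<Delta>] .
    have posdef: "symmetric_posdef (2 *\<^sub>R mat 1 :: real^'n^'n)"
      using mat_1_posdef[where 'n = 'n]
      by (simp add: symmetric_posdef_def transpose_scalar matrix_vector_mult_scaleR_left)
    have "transpose (ou_autocov A\<^sub>0 (mat 1) (real k * \<Delta>)) = ou_autocov A\<^sub>0 (mat 1) (real k * \<Delta>)" for k :: nat
      using full_turn_autocov_symmetric[OF posdef_symmetric[OF mat_1_posdef] A\<^sub>0(1), of k] \<Delta>
      by (simp add: ou_autocov_def)
    then show ?thesis
      using mat_1_posdef posdef lyapunov_stable[OF mat_1_posdef posdef A\<^sub>0(2)] A\<^sub>0
        full_turn_circulation_nonzero[OF mat_1_posdef A\<^sub>0(2,1)] by blast
  qed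

  show ?thesis
  proof (intro conjI ballI allI impI)
    show "\<exists>\<mu> :: (real^'n) measure. is_normal_law \<mu> S" using normal by blast
    show "Q = 0 \<Longrightarrow> Q\<Delta> = 0" using sym_all[of \<Delta>] \<Delta> by (simp add: Q\<Delta>_iff)
  qed (((elim conjE)?, drule (3) law_unique, simp)
    | ((elim conjE)?, (rule shift C_autocov drift_family_eq_identified_set[OF S \<Sigma>]
        affine_drift_family[OF S \<Sigma>] aff_dim_drift_family[OF S] gradient_part_in_drift_family
        drift_family_decomposition[OF S] bij_betw_circulation[OF S \<Sigma>]
        lyapunov_stable[OF S \<Sigma> family_lyapunov] stationary_law normal
        stationary_ou_normal_law[OF S \<Sigma> family_lyapunov] identified[THEN conjunct1]
        identified[THEN conjunct2] principal Q\<Delta>_zero[symmetric] Q_zero_iff reversible Q\<Delta>_zero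
        turn[THEN conjunct1] turn[THEN conjunct2, THEN conjunct1]
        turn[THEN conjunct2, THEN conjunct2, rule_format] example; assumption)))+
qed

end
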